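(* Let $X(t)$, $t\in[0,1]$, be an $\alpha(\cdot)$-locally stationary random process whose smoothness index $\alpha(\cdot)$ satisfies: (C1) $\alpha(\cdot)$ attains its global minimum over $[0,1]$ at the unique point $0$; put $\alpha_0:=\alpha(0)$; (C2) there exist $b,\gamma>0$ such that $\alpha(t)=\alpha_0+b\,t^{\gamma}+o(t^{\gamma})$ as $t\to 0$. Let $p,\tilde p$ be probability densities on $[0,\infty)$ and $0<\rho<1$ such that: (A1) $p$ is bounded and non-increasing, and there are constants $q_1>0$ and $0<q_2<b/\alpha_0$ with $p(u)\ge q_1\exp\{-q_2u^{\gamma}\}$ for all $u\ge 0$; (A2) $\tilde p$ is regularly varying at infinity with some index $r\le -1$, i.e. for all $\lambda>0$, $\tilde p(\lambda u)/\tilde p(u)\to\lambda^{r}$ as $u\to+\infty$; (A3) $q_2\sup_{0\le t\le\rho}\alpha(t)<\inf_{0<t\le\rho}\dfrac{\alpha(t)-\alpha(0)}{t^{\gamma}}$ and $q_2\rho^{\gamma}<1$. Let $X_n$ be the piecewise constant approximations of $X$ corresponding to the composite dilated $(p,\rho,\tilde p)$-designs $T_n=\{t_0(n)<\dots<t_{N(n)}(n)\}$. Then $N(n)\sim n$ and $$\int_0^1 \mathbb{E}\{(X(t)-X_n(t))^2\}\,dt\;\sim\;\frac{K}{n^{\alpha_0}(\log n)^{(\alpha_0+1)/\gamma}}\;\sim\;\frac{K}{N^{\alpha_0}(\log N)^{(\alpha_0+1)/\gamma}}\qquad\text{as } n\to\infty,$$ where $N=N(n)$ and $$K:=\frac{c(0)}{\alpha_0+1}\int_0^\infty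 p(u)^{-\alpha_0}e^{-bu^{\gamma}}\,du,$$ which is finite by (A1), and $c(\cdot)$ is the function from the definition of $\alpha(\cdot)$-local stationarity.
   Context: Write $\|Y\|:=(\mathbb{E}Y^2)^{1/2}$ for a random variable $Y$. A random process $X(t)$, $t\in[0,1]$, with $\mathbb{E}\{X(t)^2\}<\infty$ is called $\alpha(\cdot)$-locally stationary if there are continuous functions $\alpha(\cdot),c(\cdot)$ on $[0,1]$ with $0<\alpha(t)\le 2$ and $c(t)>0$ such that $$\lim_{s\to0}\frac{\|X(t+s)-X(t)\|^2}{|s|^{\alpha(t)}}=c(t)\quad\text{uniformly in } t\in[0,1]$$ (with $s\neq 0$ and $t+s\in[0,1]$). Given knots $0=t_0<t_1<\dots<t_N=1$ (a sampling design), the piecewise constant approximation is $X_n(t):=X(t_{j-1})$ for $t_{j-1}\le t<t_j$, $j=1,\dots,N$. Composite dilated $(p,\rho,\tilde p)$-designs: let $d_n:=(\log n)^{1/\gamma}$ (with $\gamma$ from (C2)), $p_n(t):=d_n\,p(d_nt)$ and $\tilde p_n(t):=d_n\,\tilde p(d_nt)$. For $n$ large, the knots of $T_n$ in $[0,\rho]$ are the points $t\in[0,\rho]$ with $\int_0^{t}p_n(s)\,ds=j/n$ for some integer $0\le j\le n\int_0^\rho p_n(s)\,ds$; the knots in $(\rho,1]$ are the points $t\in(\rho,1]$ with $\int_0^{t}\tilde p_n(s)\,ds=j/n$ for some integer $j$ with $n\int_0^\rho\tilde p_n(s)\,ds<j\le n\int_0^1\tilde p_n(s)\,ds$; in addition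 the endpoint $1$ is included as a knot. The knots are enumerated in increasing order as $0=t_0(n)<t_1(n)<\dots<t_{N(n)}(n)=1$. $a_n\sim b_n$ means $a_n/b_n\to1$. *)

theory Defs
  imports "HOL-Probability.Probability" "HOL-Library.Landau_Symbols"
begin

definition ms_norm :: "'a measure \<Rightarrow> ('a \<Rightarrow> real) \<Rightarrow> real" where
  "ms_norm M Y = sqrt (integral\<^sup>L M (\<lambda>\<omega>. (Y \<omega>)\<^sup>2))"

definition second_order_process :: "'a measure \<Rightarrow> (real \<Rightarrow> 'a \<Rightarrow> real) \<Rightarrow> bool" where
  "second_order_process M X \<longleftrightarrow>
     prob_space M \<and>
     (\<forall>t\<in>{0..1}. X t \<in> borel_measurable M \<and> integrable M (\<lambda>\<omega>. (X t \<omega>)\<^sup>2))"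

definition locally_stationary ::
  "'a measure \<Rightarrow> (real \<Rightarrow> 'a \<Rightarrow> real) \<Rightarrow> (real \<Rightarrow> real) \<Rightarrow> (real \<Rightarrow> real) \<Rightarrow> bool" where
  "locally_stationary M X \<alpha> c \<longleftrightarrow>
     second_order_process M X \<and>
     continuous_on {0..1} \<alpha> \<and> continuous_on {0..1} c \<and>
     (\<forall>t\<in>{0..1}. 0 < \<alpha> t \<and> \<alpha> t \<le> 2 \<and> 0 < c t) \<and>
     (\<forall>\<epsilon>>0. \<exists>\<delta>>0. \<forall>t\<in>{0..1}. \<forall>s. s \<noteq> 0 \<and> \<bar>s\<bar> < \<delta> \<and> t + s \<in> {0..1} \<longrightarrow>
        \<bar>(ms_norm M (\<lambda>\<omega>. X (t + s) \<omega> - X t \<omega>))\<^sup>2 / \<bar>s\<bar> powr \<alpha> t - c t\<bar> < \<epsilon>)"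

text \<open>Values of the function at negative arguments are irrelevant.\<close>

definition prob_density_nonneg :: "(real \<Rightarrow> real) \<Rightarrow> bool" where
  "prob_density_nonneg f \<longleftrightarrow>
     (\<forall>u\<ge>0. 0 \<le> f u) \<and> set_integrable lborel {0..} f \<and> (LBINT u:{0..}. f u) = 1"

text \<open>Since \<open>x / 0 = 0\<close> and the limit is nonzero, the condition forces \<open>f u \<noteq> 0\<close>
  for all large \<open>u\<close>.\<close>

definition regularly_varying :: "(real \<Rightarrow> real) \<Rightarrow> real \<Rightarrow> bool" where
  "regularly_varying f r \<longleftrightarrow>
     (\<forall>l>0. ((\<lambda>u. f (l * u) / f u) \<longlongrightarrow> l powr r) at_top)"

definition dilation_factor :: "real \<Rightarrow> nat \<Rightarrow> real" where
  "dilation_factor \<gamma> n = ln (real n) powr (1 / \<gamma>)"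

definition dilated :: "real \<Rightarrow> (real \<Rightarrow> real) \<Rightarrow> nat \<Rightarrow> real \<Rightarrow> real" where
  "dilated \<gamma> f n t = dilation_factor \<gamma> n * f (dilation_factor \<gamma> n * t)"

definition composite_knots ::
  "real \<Rightarrow> (real \<Rightarrow> real) \<Rightarrow> real \<Rightarrow> (real \<Rightarrow> real) \<Rightarrow> nat \<Rightarrow> real set" where
  "composite_knots \<gamma> p \<rho> q n =
     {t \<in> {0..\<rho>}. \<exists>j::int.
        0 \<le> j \<and> of_int j \<le> real n * (LBINT s:{0..\<rho>}. dilated \<gamma> p n s) \<and>
        (LBINT s:{0..t}. dilated \<gamma> p n s) = of_int j / real n} \<union>
     {t \<in> {\<rho><..1}. \<exists>j::int.
        real n * (LBINT s:{0..\<rho>}. dilated \<gamma> q n s) < of_int j \<and>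
        of_int j \<le> real n * (LBINT s:{0..1}. dilated \<gamma> q n s) \<and>
        (LBINT s:{0..t}. dilated \<gamma> q n s) = of_int j / real n} \<union>
     {1}"

text \<open>For small \<open>n\<close> the set of knots may be infinite, in which case the two
  definitions below yield junk values.\<close>

definition num_intervals ::
  "real \<Rightarrow> (real \<Rightarrow> real) \<Rightarrow> real \<Rightarrow> (real \<Rightarrow> real) \<Rightarrow> nat \<Rightarrow> nat" where
  "num_intervals \<gamma> p \<rho> q n = card (composite_knots \<gamma> p \<rho> q n) - 1"

definition composite_design ::
  "real \<Rightarrow> (real \<Rightarrow> real) \<Rightarrow> real \<Rightarrow> (real \<Rightarrow> real) \<Rightarrow> nat \<Rightarrow> nat \<Rightarrow> real" where
  "composite_design \<gamma> p \<rho> q n j = sorted_list_of_set (composite_knots \<gamma> p \<rho> q n) ! j"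

text \<open>At the right end point of the interval, which lies in no interval
  \<open>[t (j - 1), t j)\<close>, the approximation is given the value of the process there;
  this does not affect integrals over the interval.\<close>

definition piecewise_const_approx ::
  "(real \<Rightarrow> 'a \<Rightarrow> real) \<Rightarrow> (nat \<Rightarrow> real) \<Rightarrow> nat \<Rightarrow> real \<Rightarrow> 'a \<Rightarrow> real" where
  "piecewise_const_approx X t N s =
     (if s < t N then X (t ((THE j. j \<in> {1..N} \<and> t (j - 1) \<le> s \<and> s < t j) - 1))
      else X (t N))"

definition composite_approx ::
  "(real \<Rightarrow> 'a \<Rightarrow> real) \<Rightarrow> real \<Rightarrow> (real \<Rightarrow> real) \<Rightarrow> real \<Rightarrow> (real \<Rightarrow> real) \<Rightarrow>
     nat \<Rightarrow> real \<Rightarrow> 'a \<Rightarrow> real" where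
  "composite_approx X \<gamma> p \<rho> q n =
     piecewise_const_approx X (composite_design \<gamma> p \<rho> q n) (num_intervals \<gamma> p \<rho> q n)"

end

theory Submission
  imports Defs "HOL-Real_Asymp.Real_Asymp"
begin

text \<open>
  Write \<open>P u\<close> for the integral of \<open>p\<close> over \<open>[0, u]\<close>, \<open>d\<close> for the dilation factor, so that
  \<open>d powr \<gamma> = ln n\<close>, and \<open>\<tau> t\<close> for the last knot not exceeding \<open>t\<close>. The approximation at \<open>t\<close> is
  \<open>X (\<tau> t)\<close>. Local stationarity, with \<open>t\<close> itself rather than the knot as base point, gives the
  mean-square error \<open>s powr \<alpha> t * (c t + o(1))\<close> with \<open>s = t - \<tau> t\<close>, uniformly in \<open>t\<close> as soon as the
  mesh tends to 0. This choice of base point makes the exponent exactly \<open>\<alpha> t\<close>, so that the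
  variation of \<open>\<alpha>\<close> inside an interval of the design never has to be estimated.

  On \<open>[0, \<rho>]\<close> substitute \<open>t = u / d\<close>. As \<open>\<alpha> t - \<alpha> 0\<close> is about \<open>b * u powr \<gamma> / ln n\<close>, the factor
  \<open>n powr (\<alpha> 0 - \<alpha> t)\<close> tends to \<open>exp (- b * u powr \<gamma>)\<close>; the dilation is chosen for this balance. The
  knots are level sets of \<open>P\<close>, hence \<open>n * (P u - P (d * \<tau> t))\<close> is the fractional part of \<open>n * P u\<close>,
  and \<open>n * d * s\<close> is asymptotically that fractional part divided by \<open>p u\<close> wherever the monotone
  function \<open>p\<close> is continuous (\<open>spacing_limit\<close>). The rescaled error therefore differs by \<open>o(1)\<close> from
  \<open>c 0 * p u powr (- \<alpha> 0) * exp (- b * u powr \<gamma>) * frac (n * P u) powr \<alpha> 0\<close> for almost every \<open>u\<close>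
  (\<open>pointwise_limit\<close>). The first inequality of (A3) says that the competition between the growth of
  \<open>\<alpha>\<close> and the possible decay of \<open>p\<close> is won by the former on all of \<open>[0, \<rho>]\<close>, which yields the dominating
  function \<open>exp (- \<kappa> * u powr \<gamma>)\<close> (\<open>err_dominated\<close>), and dominated convergence applies.

  The last factor oscillates without a pointwise limit. Under the law with density \<open>p\<close> the function
  \<open>P\<close> is uniformly distributed on \<open>[0, 1]\<close>, so, by a version of Fejer's theorem
  (\<open>fejer_density\<close>), integrals against \<open>frac (n * P u) powr \<alpha> 0\<close> converge to the integral times
  the mean \<open>1 / (\<alpha> 0 + 1)\<close> of \<open>x powr \<alpha> 0\<close> over the unit interval. This is where the constant \<open>K\<close>
  comes from.

  The part \<open>(\<rho>, 1]\<close> is negligible (\<open>tail_negligible\<close>). A regularly varying density has a polynomial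
  lower bound (\<open>regularly_varying_polynomial_lower_bound\<close>), so the spacings there are at most a power
  of \<open>ln n\<close> divided by \<open>n\<close>, while \<open>\<alpha>\<close> stays away from \<open>\<alpha> 0\<close>. Only the interval that contains \<open>\<rho>\<close> can be
  much longer, up to the order \<open>n powr (q2 * \<rho> powr \<gamma> - 1)\<close>; there (A3) at the point \<open>\<rho>\<close> still
  gives an exponent larger than \<open>\<alpha> 0\<close>.
\<close>

section \<open>Primitives of densities\<close>

definition mass :: "(real \<Rightarrow> real) \<Rightarrow> real \<Rightarrow> real" where
  "mass f u = (LBINT s:{0..u}. f s)"

lemma mass_0 [simp]: "mass f 0 = 0"
proof -
  have "(LBINT s:{0..0::real}. f s) = (LBINT s:{}. f s)"
    unfolding set_lebesgue_integral_def
    by (rule integral_discrete_difference[where X="{0}"]) (auto simp: indicator_def)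
  then show ?thesis by (simp add: mass_def set_lebesgue_integral_def)
qed

lemma mass_diff:
  assumes "set_integrable lborel {0..} f" "0 \<le> u" "u \<le> v"
  shows "mass f v - mass f u = (LBINT s:{u..v}. f s)"
proof -
  have "AE x in lborel. x \<noteq> u"
    by (rule AE_lborel_singleton)
  then have "AE x in lborel. \<not> (x \<in> {0..u} \<and> x \<in> {u..v})"
    by eventually_elim auto
  then have "(LBINT s:{0..u} \<union> {u..v}. f s) = (LBINT s:{0..u}. f s) + (LBINT s:{u..v}. f s)"
    using assms by (intro set_integral_Un_AE set_integrable_subset[OF assms(1)]) auto
  moreover have "{0..u} \<union> {u..v} = {0..v}"
    using assms by auto
  ultimately show ?thesis by (simp add: mass_def)
qed

lemma set_integrable_mass_interval:
  assumes "set_integrable lborel {0..} (f :: real \<Rightarrow> real)" "0 \<le> u"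
  shows "set_integrable lborel {u..v} f"
  using assms by (intro set_integrable_subset[OF assms(1)]) auto

lemma set_integrable_const_interval [simp]: "set_integrable lborel {u..v::real} (\<lambda>_. m::real)"
proof -
  have "integrable lborel (indicator {u..v} :: real \<Rightarrow> real)"
    by (rule integrable_real_indicator) (cases "u \<le> v"; simp)+
  then show ?thesis
    unfolding set_integrable_def real_scaleR_def by (rule integrable_mult_left)
qed

lemma set_integral_const_interval:
  "(u::real) \<le> v \<Longrightarrow> (LBINT s:{u..v}. (m::real)) = m * (v - u)"
  by (simp add: set_lebesgue_integral_def)

lemma mass_diff_lower:
  assumes "set_integrable lborel {0..} f" "0 \<le> u" "u \<le> v" "\<And>x. x \<in> {u..v} \<Longrightarrow> m \<le> f x"
  shows "m * (v - u) \<le> mass f v - mass f u"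
  unfolding mass_diff[OF assms(1-3)] set_integral_const_interval[OF assms(3), symmetric]
  by (rule set_integral_mono[OF _ _ assms(4)])
     (simp_all add: set_integrable_mass_interval[OF assms(1,2)])

lemma mass_diff_upper:
  assumes "set_integrable lborel {0..} f" "0 \<le> u" "u \<le> v" "\<And>x. x \<in> {u..v} \<Longrightarrow> f x \<le> m"
  shows "mass f v - mass f u \<le> m * (v - u)"
  unfolding mass_diff[OF assms(1-3)] set_integral_const_interval[OF assms(3), symmetric]
  by (rule set_integral_mono[OF _ _ assms(4)])
     (simp_all add: set_integrable_mass_interval[OF assms(1,2)])

lemma mass_mono:
  assumes "prob_density_nonneg f" "0 \<le> u" "u \<le> v"
  shows "mass f u \<le> mass f v"
  using mass_diff_lower[of f u v 0] assms by (auto simp: prob_density_nonneg_def)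

lemma mass_tendsto_1:
  assumes "prob_density_nonneg f"
  shows "(mass f \<longlongrightarrow> 1) at_top"
proof -
  have int: "integrable lborel (\<lambda>x. indicator {0..} x *\<^sub>R f x)" and 1: "(LBINT u:{0..}. f u) = 1"
    using assms by (auto simp: prob_density_nonneg_def set_integrable_def)
  have "((\<lambda>t. LBINT x. indicator {0..t} x *\<^sub>R f x) \<longlongrightarrow> (LBINT x. indicator {0..} x *\<^sub>R f x)) at_top"
  proof (rule integral_dominated_convergence_at_top[where w="\<lambda>x. \<bar>indicator {0..} x *\<^sub>R f x\<bar>"])
    show "integrable lborel (\<lambda>x. \<bar>indicator {0..} x *\<^sub>R f x\<bar>)"
      using int by (rule integrable_abs)
    show "AE x in lborel. ((\<lambda>t. indicator {0..t} x *\<^sub>R f x) \<longlongrightarrow> indicator {0..} x *\<^sub>R f x) at_top"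
    proof (rule AE_I2)
      fix x :: real
      show "((\<lambda>t. indicator {0..t} x *\<^sub>R f x) \<longlongrightarrow> indicator {0..} x *\<^sub>R f x) at_top"
        by (rule tendsto_eventually, rule eventually_mono[OF eventually_ge_at_top[of x]])
           (auto simp: indicator_def)
    qed
    show "\<forall>\<^sub>F i in at_top. AE x in lborel. norm (indicator {0..i} x *\<^sub>R f x) \<le> \<bar>indicator {0..} x *\<^sub>R f x\<bar>"
      by (auto simp: indicator_def)
    show "(\<lambda>x. indicator {0..} x *\<^sub>R f x) \<in> borel_measurable lborel"
      using int by simp
    show "(\<lambda>x. indicator {0..t} x *\<^sub>R f x) \<in> borel_measurable lborel" for t
    proof -
      have "set_integrable lborel {0..t} f"
        using assms by (intro set_integrable_mass_interval) (auto simp: prob_density_nonneg_def)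
      then show ?thesis by (auto simp: set_integrable_def)
    qed
  qed
  then show ?thesis using 1 by (simp add: mass_def[abs_def] set_lebesgue_integral_def)
qed

lemma mass_le_1:
  assumes "prob_density_nonneg f" "0 \<le> u"
  shows "mass f u \<le> 1"
  by (rule tendsto_lowerbound[OF mass_tendsto_1[OF assms(1)]])
     (auto intro!: mass_mono eventually_mono[OF eventually_ge_at_top[of u]] assms)

lemma continuous_on_mass:
  assumes "prob_density_nonneg f"
  shows "continuous_on {0..} (mass f)"
proof -
  have int: "set_integrable lborel {0..} f"
    using assms by (simp add: prob_density_nonneg_def)
  have "continuous_on {0..v} (mass f)" for v
  proof -
    have i: "f integrable_on {0..v}"
      using set_borel_integral_eq_integral(1)[OF set_integrable_mass_interval[OF int order.refl]] .
    have "continuous_on {0..v} (\<lambda>x. integral {0..x} f)"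
      by (rule indefinite_integral_continuous_1[OF i])
    also have "(\<lambda>x. integral {0..x} f) = mass f"
      by (rule ext) (simp add: mass_def set_borel_integral_eq_integral(2)[OF set_integrable_mass_interval[OF int order.refl]])
    finally show ?thesis .
  qed
  then have "isCont (mass f) x" if "x > 0" for x
    using that by (intro continuous_on_interior[of "{0..x+1}"]) auto
  moreover have "continuous (at 0 within {0..}) (mass f)"
  proof -
    have "continuous (at 0 within {0..1}) (mass f)"
      using \<open>continuous_on {0..1} (mass f)\<close> by (simp add: continuous_on_eq_continuous_within)
    moreover have "at 0 within {0..1} = at 0 within {0::real..}"
      by (rule at_within_nhd[where S="{..<1}"]) auto
    ultimately show ?thesis by simp
  qed
  ultimately show ?thesis
    unfolding continuous_on_eq_continuous_within
    by (metis atLeast_iff continuous_at_imp_continuous_at_within order_le_less)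
qed

text \<open>Turns the defining conditions for the knots into statements about a single function at dilated
  arguments, which is the form used below.\<close>

lemma mass_dilated:
  assumes "dilation_factor \<gamma> n > 0"
  shows "(LBINT s:{0..t}. dilated \<gamma> f n s) = mass f (dilation_factor \<gamma> n * t)"
proof -
  let ?d = "dilation_factor \<gamma> n"
  have "mass f (?d * t) = ?d * (LBINT x. indicator {0..?d*t} (?d * x) *\<^sub>R f (?d * x))"
    unfolding mass_def set_lebesgue_integral_def
    using lborel_integral_real_affine[of ?d "\<lambda>x. indicator {0..?d*t} x *\<^sub>R f x" 0] assms by simp
  also have "\<dots> = (LBINT x. ?d * (indicator {0..?d*t} (?d * x) *\<^sub>R f (?d * x)))"
    by simp
  also have "\<dots> = (LBINT s:{0..t}. dilated \<gamma> f n s)"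
    unfolding set_lebesgue_integral_def dilated_def using assms
    by (intro Bochner_Integration.integral_cong) (auto simp: indicator_def zero_le_mult_iff)
  finally show ?thesis by simp
qed

lemma mass_attains:
  assumes "prob_density_nonneg f" "0 \<le> x" "x \<le> mass f v" "0 \<le> v"
  shows "\<exists>u\<in>{0..v}. mass f u = x"
proof -
  have "continuous_on {0..v} (mass f)"
    by (rule continuous_on_subset[OF continuous_on_mass[OF assms(1)]]) auto
  then show ?thesis
    using IVT'[of "mass f" 0 x v] assms by auto
qed

section \<open>Polynomial lower bounds for regularly varying functions\<close>

text \<open>An Egorov-type statement: the sets increase with \<open>n\<close> to the whole interval \<open>[0, 2]\<close>.\<close>

lemma pointwise_limits_imp_large_uniform_set:
  fixes h :: "nat \<Rightarrow> real \<Rightarrow> real"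
  assumes [measurable]: "\<And>m. h m \<in> borel_measurable borel" "l \<in> borel_measurable borel"
    and lim: "\<And>s. (\<lambda>m. h m s) \<longlonglongrightarrow> l s"
  shows "\<forall>\<^sub>F n in sequentially.
    3 / 2 < measure lborel {s\<in>{0..2}. \<forall>m\<ge>n. \<bar>h m s - l s\<bar> \<le> 1}"
proof -
  define A where "A n = {s\<in>{0..2}. \<forall>m\<ge>n. \<bar>h m s - l s\<bar> \<le> 1}" for n
  have [measurable]: "A n \<in> sets lborel" for n
    unfolding A_def by measurable
  have "incseq A"
    by (auto simp: incseq_def A_def)
  have U: "(\<Union>n. A n) = {0..2}"
  proof (intro equalityI subsetI)
    fix s :: real assume "s \<in> {0..2}"
    moreover from lim[of s] have "\<forall>\<^sub>F m in sequentially. dist (h m s) (l s) < 1"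
      by (rule tendstoD) simp
    then obtain n where "\<forall>m\<ge>n. \<bar>h m s - l s\<bar> < 1"
      by (auto simp: eventually_sequentially dist_real_def)
    ultimately show "s \<in> (\<Union>n. A n)"
      by (auto simp: A_def intro: less_imp_le)
  qed (auto simp: A_def)
  have "(\<lambda>n. measure lborel (A n)) \<longlonglongrightarrow> measure lborel (\<Union>n. A n)"
    by (rule Lim_measure_incseq) (use \<open>incseq A\<close> \<open>\<And>n. A n \<in> sets lborel\<close> in \<open>auto simp: U\<close>)
  then have "(\<lambda>n. measure lborel (A n)) \<longlonglongrightarrow> 2"
    by (simp add: U)
  from order_tendstoD(1)[OF this, of "3/2"] show ?thesis
    by (simp add: A_def)
qed

text \<open>The boundedness half of the uniform convergence theorem for regularly varying functions, in
  additive form. If the bound failed along points \<open>x n\<close> and \<open>x n + t n\<close>, then for large \<open>n\<close> the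
  increments from either point would be well approximated by \<open>r * s\<close> for all \<open>s\<close> in a set of measure
  above 3/2. The two sets, one translated by \<open>t n\<close>, lie in \<open>[0, 3]\<close> and so have a common point; it
  joins \<open>x n\<close> to \<open>x n + t n\<close> by two increments of bounded size.\<close>

lemma increments_locally_bounded:
  fixes G :: "real \<Rightarrow> real"
  assumes [measurable]: "G \<in> borel_measurable borel"
    and lim: "\<And>t. ((\<lambda>x. G (x + t) - G x) \<longlongrightarrow> r * t) at_top"
  shows "\<exists>C X. \<forall>x\<ge>X. \<forall>t\<in>{0..1}. \<bar>G (x + t) - G x\<bar> \<le> C"
proof (rule ccontr)
  assume "\<not> ?thesis"
  then have "\<forall>n::nat. \<exists>x t. x \<ge> real n \<and> t \<in> {0..1} \<and> real n < \<bar>G (x + t) - G x\<bar>"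
    by (meson not_less)
  then obtain x t where x: "\<And>n. x n \<ge> real n" and t: "\<And>n. t n \<in> {0..1}"
    and big: "\<And>n. real n < \<bar>G (x n + t n) - G (x n)\<bar>"
    by metis
  have x_top: "filterlim x at_top sequentially"
    by (rule filterlim_at_top_mono[OF filterlim_real_sequentially]) (use x in simp)
  have xt_top: "filterlim (\<lambda>n. x n + t n) at_top sequentially"
    by (rule filterlim_at_top_mono[OF filterlim_real_sequentially])
       (use x t in \<open>auto intro!: always_eventually add_increasing2\<close>)
  define A where "A n = {s\<in>{0..2}. \<forall>m\<ge>n. \<bar>(G (x m + s) - G (x m)) - r * s\<bar> \<le> 1}" for n
  define B where "B n = {s\<in>{0..2}. \<forall>m\<ge>n. \<bar>(G (x m + t m + s) - G (x m + t m)) - r * s\<bar> \<le> 1}" for n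
  have "\<forall>\<^sub>F n in sequentially. 3 / 2 < measure lborel (A n)"
    unfolding A_def
    by (rule pointwise_limits_imp_large_uniform_set)
       (auto intro: filterlim_compose[OF lim x_top])
  moreover have "\<forall>\<^sub>F n in sequentially. 3 / 2 < measure lborel (B n)"
    unfolding B_def
    by (rule pointwise_limits_imp_large_uniform_set)
       (auto intro: filterlim_compose[OF lim xt_top])
  moreover have "\<forall>\<^sub>F n in sequentially. real n \<ge> 2 + \<bar>r\<bar>"
    by (rule eventually_compose_filterlim[OF eventually_ge_at_top filterlim_real_sequentially])
  ultimately have "\<forall>\<^sub>F n in sequentially. 3 / 2 < measure lborel (A n) \<and>
      3 / 2 < measure lborel (B n) \<and> real n \<ge> 2 + \<bar>r\<bar>"
    by eventually_elim simp
  then obtain n where n: "3 / 2 < measure lborel (A n)" "3 / 2 < measure lborel (B n)"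
      "real n \<ge> 2 + \<bar>r\<bar>"
    by (auto simp: eventually_sequentially)
  have [measurable]: "A n \<in> sets borel" "B n \<in> sets borel"
    unfolding A_def B_def by measurable
  define B' where "B' = {s. s - t n \<in> B n}"
  have [measurable]: "B' \<in> sets borel"
    unfolding B'_def by measurable
  have mB': "measure lborel B' = measure lborel (B n)"
  proof -
    have "measure lborel (B n) = measure (distr lborel borel ((+) (- t n))) (B n)"
      by (simp add: lborel_distr_plus)
    also have "\<dots> = measure lborel B'"
      by (subst measure_distr) (auto simp: B'_def vimage_def algebra_simps)
    finally show ?thesis by simp
  qed
  have "A n \<inter> B' \<noteq> {}"
  proof
    assume disj: "A n \<inter> B' = {}"
    have sub: "A n \<union> B' \<subseteq> {0..3}"
      using t[of n] by (auto simp: A_def B'_def B_def)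
    have fin: "emeasure lborel (A n) \<noteq> \<infinity>" "emeasure lborel B' \<noteq> \<infinity>"
      using emeasure_mono[of "A n" "{0..3}" lborel] emeasure_mono[of B' "{0..3}" lborel] sub
      by (auto simp: top_unique)
    have "measure lborel (A n) + measure lborel B' = measure lborel (A n \<union> B')"
      by (rule measure_Union[symmetric]) (use disj fin in auto)
    also have "\<dots> \<le> measure lborel {0..3::real}"
      by (rule measure_mono_fmeasurable) (use sub in \<open>auto simp: fmeasurable_def\<close>)
    finally show False using n mB' by simp
  qed
  then obtain s where "s \<in> A n" "s \<in> B'" by blast
  then have "\<bar>(G (x n + s) - G (x n)) - r * s\<bar> \<le> 1"
    "\<bar>(G (x n + t n + (s - t n)) - G (x n + t n)) - r * (s - t n)\<bar> \<le> 1"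
    by (auto simp: A_def B_def B'_def)
  then have "\<bar>G (x n + t n) - G (x n)\<bar> \<le> 2 + \<bar>r * t n\<bar>"
    by (simp add: algebra_simps abs_le_iff) linarith
  also have "\<bar>r * t n\<bar> \<le> \<bar>r\<bar>"
    using t[of n] by (simp add: abs_mult mult_left_le)
  finally show False using big[of n] n(3) by simp
qed

text \<open>In logarithmic coordinates a regularly varying function loses at most a constant over each unit
  interval, hence decays at most linearly there, which is polynomially in the original variable.\<close>

lemma regularly_varying_polynomial_lower_bound:
  assumes rv: "regularly_varying f r" and nonneg: "\<And>u. u \<ge> 0 \<Longrightarrow> 0 \<le> f u"
    and meas: "set_borel_measurable borel {0..} f"
  shows "\<exists>c C A. 0 < c \<and> 0 \<le> C \<and> 1 \<le> A \<and> (\<forall>u\<ge>A. c * u powr (- C) \<le> f u)"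
proof -
  define G where "G x = ln (indicator {0..} (exp x) *\<^sub>R f (exp x))" for x :: real
  have G: "G x = ln (f (exp x))" for x
    by (simp add: G_def)
  have [measurable]: "(\<lambda>x. indicator {0..} x *\<^sub>R f x) \<in> borel_measurable borel"
    using meas by (simp add: set_borel_measurable_def)
  have [measurable]: "G \<in> borel_measurable borel"
    unfolding G_def[abs_def] by measurable
  have "((\<lambda>u. f (1 * u) / f u) \<longlongrightarrow> 1 powr r) at_top"
    using rv by (simp only: regularly_varying_def)
  then have "\<forall>\<^sub>F u in at_top. f (1 * u) / f u > 0"
    by (intro order_tendstoD(1)) auto
  then have "\<forall>\<^sub>F u in at_top. f u > 0"
    using eventually_ge_at_top[of 0]
  proof eventually_elim
    case (elim u)
    then show ?case using nonneg[of u] by (cases "f u = 0") auto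
  qed
  then obtain A0 where A0: "\<And>u. u \<ge> A0 \<Longrightarrow> f u > 0"
    by (auto simp: eventually_at_top_linorder)
  have ev: "\<forall>\<^sub>F x in at_top. f (exp (x + t)) > 0" for t :: real
  proof -
    have "filterlim (\<lambda>x. exp (x + t)) at_top at_top"
      by real_asymp
    from eventually_compose_filterlim[OF eventually_ge_at_top[of A0] this]
    show ?thesis by eventually_elim (rule A0)
  qed
  have lim: "((\<lambda>x. G (x + t) - G x) \<longlongrightarrow> r * t) at_top" for t
  proof -
    have "((\<lambda>u. f (exp t * u) / f u) \<longlongrightarrow> exp t powr r) at_top"
      using rv by (auto simp: regularly_varying_def)
    from filterlim_compose[OF this exp_at_top]
    have "((\<lambda>x. f (exp t * exp x) / f (exp x)) \<longlongrightarrow> exp t powr r) at_top" .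
    then have "((\<lambda>x. ln (f (exp t * exp x) / f (exp x))) \<longlongrightarrow> ln (exp t powr r)) at_top"
      by (rule tendsto_ln) simp
    moreover have "\<forall>\<^sub>F x in at_top. ln (f (exp t * exp x) / f (exp x)) = G (x + t) - G x"
      using ev[of t] ev[of 0]
      by eventually_elim (simp add: G ln_div exp_add mult.commute)
    ultimately show ?thesis
      by (simp add: ln_powr tendsto_cong)
  qed
  obtain C0 X0 where CX0: "\<And>x t. x \<ge> X0 \<Longrightarrow> t \<in> {0..1} \<Longrightarrow> \<bar>G (x + t) - G x\<bar> \<le> C0"
    using increments_locally_bounded[OF \<open>G \<in> borel_measurable borel\<close> lim] by blast
  (* exp X is at least A0, so that f is positive beyond it, and at least 1 *)
  define X where "X = max (max X0 0) (ln (max A0 1))"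
  define C where "C = max C0 0"
  have CX: "G (x + t) \<ge> G x - C" if "x \<ge> X" "t \<in> {0..1}" for x t
    using CX0[of x t] that by (auto simp: X_def C_def)
  have step: "G (X + real k) \<ge> G X - C * real k" for k
  proof (induction k)
    case (Suc k)
    then show ?case using CX[of "X + real k" 1] by (simp add: algebra_simps)
  qed simp
  have lower: "G x \<ge> G X - C * (x - X + 1)" if "x \<ge> X" for x
  proof -
    define k where "k = nat \<lfloor>x - X\<rfloor>"
    have k: "real k \<le> x - X" "x - X \<le> real k + 1"
      using that by (auto simp: k_def)
    have "G (X + real k + (x - X - real k)) \<ge> G (X + real k) - C"
      using k by (intro CX) auto
    then have "G x \<ge> G X - C * real k - C"
      using step[of k] by simp
    also have "G X - C * real k - C \<ge> G X - C * (x - X + 1)"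
      using mult_left_mono[OF k(1), of C] by (simp add: C_def algebra_simps)
    finally show ?thesis by simp
  qed
  have "exp (G X + C * X - C) * u powr (- C) \<le> f u" if u: "u \<ge> exp X" for u
  proof -
    have "u > 0" using u by (rule less_le_trans[rotated]) simp
    then have lnu: "ln u \<ge> X" using u by (metis exp_ln_iff exp_le_cancel_iff)
    have "max A0 1 \<le> u"
    proof -
      have "max A0 1 = exp (ln (max A0 1))" by simp
      also have "\<dots> \<le> exp X" by (subst exp_le_cancel_iff) (simp add: X_def)
      also note u
      finally show ?thesis .
    qed
    then have "f u > 0" using A0 by simp
    then have "f u = exp (G (ln u))"
      using \<open>u > 0\<close> by (simp add: G)
    also have "\<dots> \<ge> exp (G X - C * (ln u - X + 1))"
      using lower[OF lnu] by simp
    also have "exp (G X - C * (ln u - X + 1)) = exp (G X + C * X - C) * u powr (- C)"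
      using \<open>u > 0\<close> by (simp add: powr_def exp_add[symmetric] algebra_simps)
    finally show ?thesis by simp
  qed
  moreover have "0 \<le> C" by (simp add: C_def)
  moreover have "1 \<le> exp X" by (simp add: X_def le_max_iff_disj)
  moreover have "0 < exp (G X + C * X - C)" by simp
  ultimately show ?thesis by meson
qed

section \<open>Weak limits of oscillating factors\<close>

text \<open>For uniformly bounded \<open>\<psi> n\<close>, weak convergence to a constant passes to limits in \<open>L\<^sup>1\<close>. Both
  countable disjoint unions of sets and the closure step from simple to integrable functions are
  instances of this.\<close>

lemma weak_limit_closed_L1:
  fixes \<psi> :: "nat \<Rightarrow> 'b \<Rightarrow> real"
  assumes [measurable]: "\<And>n. \<psi> n \<in> borel_measurable M"
    and bound: "\<And>n x. \<bar>\<psi> n x\<bar> \<le> B"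
    and int: "\<And>k. integrable M (g k)" "integrable M f"
    and lim: "\<And>k. (\<lambda>n. LINT x|M. g k x * \<psi> n x) \<longlonglongrightarrow> m * (LINT x|M. g k x)"
    and L1: "(\<lambda>k. LINT x|M. \<bar>f x - g k x\<bar>) \<longlonglongrightarrow> 0"
  shows "(\<lambda>n. LINT x|M. f x * \<psi> n x) \<longlonglongrightarrow> m * (LINT x|M. f x)"
proof (rule tendstoI)
  fix e :: real assume "e > 0"
  have B: "B \<ge> 0" using bound[of 0 undefined] by linarith
  define D where "D = B + \<bar>m\<bar> + 1"
  have "D > 0" using B by (simp add: D_def)
  have "\<forall>\<^sub>F k in sequentially. (LINT x|M. \<bar>f x - g k x\<bar>) < e / (2 * D)"
    by (rule order_tendstoD(2)[OF L1]) (use \<open>e > 0\<close> \<open>D > 0\<close> in simp)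
  then obtain k where k: "(LINT x|M. \<bar>f x - g k x\<bar>) < e / (2 * D)"
    by (auto simp: eventually_sequentially)
  have prod: "integrable M (\<lambda>x. h x * \<psi> n x)" if "integrable M h" for h n
  proof (rule Bochner_Integration.integrable_bound[where f="\<lambda>x. B * h x"])
    show "AE x in M. norm (h x * \<psi> n x) \<le> norm (B * h x)"
      using bound[of n] B by (auto intro!: AE_I2 simp: abs_mult mult.commute[of B] intro!: mult_left_mono)
  qed (use that in auto)
  from lim[of k] have "\<forall>\<^sub>F n in sequentially. dist (LINT x|M. g k x * \<psi> n x) (m * (LINT x|M. g k x)) < e / 2"
    by (rule tendstoD) (use \<open>e > 0\<close> in simp)
  then show "\<forall>\<^sub>F n in sequentially. dist (LINT x|M. f x * \<psi> n x) (m * (LINT x|M. f x)) < e"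
  proof eventually_elim
    case (elim n)
    let ?h = "\<lambda>x. f x - g k x"
    have h: "integrable M ?h" using int by simp
    have "(LINT x|M. f x * \<psi> n x) - m * (LINT x|M. f x) =
        ((LINT x|M. g k x * \<psi> n x) - m * (LINT x|M. g k x)) +
        (LINT x|M. ?h x * \<psi> n x) - m * (LINT x|M. ?h x)"
      using prod[OF h, of n] prod[OF int(1), of k n] prod[OF int(2), of n] int h
      by (simp add: algebra_simps Bochner_Integration.integral_diff)
    moreover have "\<bar>LINT x|M. ?h x * \<psi> n x\<bar> \<le> B * (LINT x|M. \<bar>?h x\<bar>)"
    proof -
      have "\<bar>LINT x|M. ?h x * \<psi> n x\<bar> \<le> (LINT x|M. \<bar>?h x * \<psi> n x\<bar>)"
        by (rule integral_abs_bound)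
      also have "\<dots> \<le> (LINT x|M. B * \<bar>?h x\<bar>)"
        using prod[OF h, of n] h bound[of n]
        by (intro integral_mono integrable_abs integrable_mult_right)
           (auto simp: abs_mult mult.commute[of B] intro!: mult_left_mono)
      finally show ?thesis by simp
    qed
    moreover have "\<bar>m * (LINT x|M. ?h x)\<bar> \<le> \<bar>m\<bar> * (LINT x|M. \<bar>?h x\<bar>)"
      by (auto simp: abs_mult intro!: mult_left_mono integral_abs_bound)
    ultimately have "\<bar>(LINT x|M. f x * \<psi> n x) - m * (LINT x|M. f x)\<bar> \<le>
        \<bar>(LINT x|M. g k x * \<psi> n x) - m * (LINT x|M. g k x)\<bar> + (B + \<bar>m\<bar>) * (LINT x|M. \<bar>?h x\<bar>)"
      by (simp add: algebra_simps)
    also have "(B + \<bar>m\<bar>) * (LINT x|M. \<bar>?h x\<bar>) \<le> D * (LINT x|M. \<bar>?h x\<bar>)"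
      by (intro mult_right_mono) (auto simp: D_def)
    also have "\<dots> \<le> D * (e / (2 * D))"
      using k \<open>D > 0\<close> by (intro mult_left_mono) auto
    also have "\<dots> = e / 2" using \<open>D > 0\<close> by simp
    finally show ?case using elim by (simp add: dist_real_def)
  qed
qed

text \<open>The sets on which the asserted convergence holds form a Dynkin system that contains the half-lines,
  hence all Borel sets; linearity and \<open>weak_limit_closed_L1\<close> extend this to integrable functions.\<close>

lemma weak_limit_from_half_lines:
  fixes \<psi> :: "nat \<Rightarrow> real \<Rightarrow> real"
  assumes "prob_space M" and sets [measurable_cong]: "sets M = sets borel"
    and [measurable]: "\<And>n. \<psi> n \<in> borel_measurable borel"
    and bound: "\<And>n x. \<bar>\<psi> n x\<bar> \<le> B"
    and half: "\<And>a. (\<lambda>n. LINT x|M. indicator {..a} x * \<psi> n x) \<longlonglongrightarrow> m * measure M {..a}"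
    and total: "(\<lambda>n. LINT x|M. \<psi> n x) \<longlonglongrightarrow> m"
    and g: "integrable M g"
  shows "(\<lambda>n. LINT x|M. g x * \<psi> n x) \<longlonglongrightarrow> m * (LINT x|M. g x)"
proof -
  interpret prob_space M by fact
  have B: "B \<ge> 0" using bound[of 0 undefined] by linarith
  have space: "space M = UNIV" using sets_eq_imp_space_eq[OF sets] by simp
  have psi_int: "integrable M (\<psi> n)" for n
    by (rule integrable_const_bound[where B=B]) (use bound in auto)
  have prod: "integrable M (\<lambda>x. indicator A x * \<psi> n x)" if "A \<in> sets borel" for A n
    using integrable_mult_indicator[OF _ psi_int, of A n] that sets by simp
  have ind_int: "integrable M (indicator A :: real \<Rightarrow> real)" if "A \<in> sets borel" for A
    by (rule integrable_real_indicator) (use that sets in \<open>auto simp: less_top[symmetric]\<close>)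
  have ind: "(\<lambda>n. LINT x|M. indicator A x * \<psi> n x) \<longlonglongrightarrow> m * measure M A"
    if "A \<in> sets borel" for A
  proof -
    have b: "sets (borel :: real measure) = sigma_sets UNIV (range (\<lambda>a. {..a}))"
      by (subst borel_eq_atMost) simp
    have stable: "Int_stable (range (\<lambda>a::real. {..a}))"
    proof (rule Int_stableI)
      fix S T assume "S \<in> range (\<lambda>a::real. {..a})" "T \<in> range (\<lambda>a::real. {..a})"
      then obtain a c where "S = {..a}" "T = {..c}" by auto
      then have "S \<inter> T = {..min a c}" by auto
      then show "S \<inter> T \<in> range (\<lambda>a::real. {..a})" by blast
    qed
    note stable
    moreover have "range (\<lambda>a::real. {..a}) \<subseteq> Pow UNIV" by simp
    moreover from that have "A \<in> sigma_sets UNIV (range (\<lambda>a. {..a}))" by (simp add: b)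
    ultimately show ?thesis
    proof (induction rule: sigma_sets_induct_disjoint)
      case (basic A)
      then show ?case using half by auto
    next
      case empty
      then show ?case by simp
    next
      case (compl A)
      then have [measurable]: "A \<in> sets borel" by (simp add: b)
      have "(\<lambda>n. (LINT x|M. \<psi> n x) - (LINT x|M. indicator A x * \<psi> n x)) \<longlonglongrightarrow> m - m * measure M A"
        by (intro tendsto_diff total compl)
      also have "(\<lambda>n. (LINT x|M. \<psi> n x) - (LINT x|M. indicator A x * \<psi> n x)) =
          (\<lambda>n. LINT x|M. indicator (UNIV - A) x * \<psi> n x)"
        by (subst Bochner_Integration.integral_diff[OF psi_int prod[OF \<open>A \<in> sets borel\<close>], symmetric])
           (auto intro!: Bochner_Integration.integral_cong simp: indicator_def)
      also have "m - m * measure M A = m * measure M (UNIV - A)"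
      proof -
        have "A \<in> events" by simp
        from prob_compl[OF this] have "measure M (UNIV - A) = 1 - measure M A"
          by (simp only: space)
        then show ?thesis by (simp add: right_diff_distrib)
      qed
      finally show ?case .
    next
      case (union A)
      then have A [measurable]: "A i \<in> sets borel" for i
        by (auto simp: b)
      let ?U = "\<Union>i. A i" and ?V = "\<lambda>k. \<Union>i<k. A i"
      have UV_int: "integrable M (indicator ?U :: real \<Rightarrow> real)"
        "integrable M (indicator (?V k) :: real \<Rightarrow> real)" for k
        by (rule ind_int, measurable)+
      have Vind: "indicator (?V k) x = (\<Sum>i<k. indicator (A i) x :: real)" for k x
        by (rule indicator_UN_disjoint) (auto intro: disjoint_family_on_mono[OF subset_UNIV union(1)])
      have V: "(LINT x|M. indicator (?V k) x * \<psi> n x) = (\<Sum>i<k. LINT x|M. indicator (A i) x * \<psi> n x)" for k n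
        by (subst Bochner_Integration.integral_sum[symmetric])
           (auto intro!: prod Bochner_Integration.integral_cong union
             simp: Vind sum_distrib_right)
      have "(\<lambda>n. LINT x|M. indicator ?U x * \<psi> n x) \<longlonglongrightarrow> m * (LINT x|M. indicator ?U x)"
      proof (rule weak_limit_closed_L1[where g="\<lambda>k. indicator (?V k)" and B=B])
        fix k
        have "(\<lambda>n. \<Sum>i<k. LINT x|M. indicator (A i) x * \<psi> n x) \<longlonglongrightarrow> (\<Sum>i<k. m * measure M (A i))"
          by (intro tendsto_sum union)
        also have "(\<Sum>i<k. m * measure M (A i)) = m * measure M (?V k)"
          unfolding sum_distrib_left[symmetric]
          by (subst finite_measure_finite_Union)
             (auto simp: disjoint_family_on_mono[OF subset_UNIV union(1)])
        finally show "(\<lambda>n. LINT x|M. indicator (?V k) x * \<psi> n x) \<longlonglongrightarrow> m * (LINT x|M. indicator (?V k) x)"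
          by (simp add: V space)
      next
        have inc: "incseq ?V" by (fastforce simp: incseq_def)
        have UV: "(\<Union>k. ?V k) = ?U" by auto
        have "(\<lambda>k. measure M (?V k)) \<longlonglongrightarrow> measure M (\<Union>k. ?V k)"
          by (rule finite_Lim_measure_incseq[OF _ inc]) auto
        then have "(\<lambda>k. measure M ?U - measure M (?V k)) \<longlonglongrightarrow> measure M ?U - measure M ?U"
          unfolding UV by (intro tendsto_diff tendsto_const)
        also have "(\<lambda>k. measure M ?U - measure M (?V k)) =
            (\<lambda>k. LINT x|M. \<bar>indicator ?U x - indicator (?V k) x\<bar>)"
        proof
          fix k
          have "(LINT x|M. \<bar>indicator ?U x - indicator (?V k) x :: real\<bar>) =
              (LINT x|M. indicator ?U x - indicator (?V k) x)"
            by (intro Bochner_Integration.integral_cong refl) (auto simp: indicator_def)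
          also have "\<dots> = measure M ?U - measure M (?V k)"
            by (subst Bochner_Integration.integral_diff[OF UV_int]) (auto simp: space)
          finally show "measure M ?U - measure M (?V k) = (LINT x|M. \<bar>indicator ?U x - indicator (?V k) x\<bar>)" ..
        qed
        finally show "(\<lambda>k. LINT x|M. \<bar>indicator ?U x - indicator (?V k) x :: real\<bar>) \<longlonglongrightarrow> 0"
          by simp
      next
        show "integrable M (indicator ?U :: real \<Rightarrow> real)" by (fact UV_int(1))
        show "integrable M (indicator (?V k) :: real \<Rightarrow> real)" for k by (fact UV_int(2))
      qed (use bound in auto)
      then show ?case by (simp add: space)
    qed
  qed
  from g show ?thesis
  proof (induction rule: integrable_induct)
    case (base A c)
    then have "(\<lambda>n. c * (LINT x|M. indicator A x * \<psi> n x)) \<longlonglongrightarrow> c * (m * measure M A)"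
      by (intro tendsto_mult_left ind) (simp add: sets)
    moreover have "(LINT x|M. (indicator A x *\<^sub>R c) * \<psi> n x) = c * (LINT x|M. indicator A x * \<psi> n x)" for n
      by (subst integral_mult_right_zero[symmetric]) (simp add: mult_ac)
    moreover have "(LINT x|M. indicator A x *\<^sub>R c) = measure M A * c"
      by (simp add: space)
    ultimately show ?case by (simp only: mult_ac)
  next
    case (add f g)
    have "integrable M (\<lambda>x. h x * \<psi> n x)" if "integrable M h" for h n
    proof (rule Bochner_Integration.integrable_bound[where f="\<lambda>x. B * h x"])
      show "AE x in M. norm (h x * \<psi> n x) \<le> norm (B * h x)"
        using bound[of n] B by (auto intro!: AE_I2 simp: abs_mult mult.commute[of B] intro!: mult_left_mono)
    qed (use that in auto)
    then show ?case
      using add tendsto_add[OF add(3,4)] by (simp add: algebra_simps)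
  next
    case (lim f s)
    have "(\<lambda>k. LINT x|M. \<bar>f x - s k x\<bar>) \<longlonglongrightarrow> (LINT x|M. 0)"
    proof (rule integral_dominated_convergence[where w="\<lambda>x. 3 * norm (f x)"])
      show "AE x in M. (\<lambda>k. \<bar>f x - s k x\<bar>) \<longlonglongrightarrow> 0"
      proof (rule AE_I2)
        fix x assume "x \<in> space M"
        then have "(\<lambda>k. \<bar>f x - s k x\<bar>) \<longlonglongrightarrow> \<bar>f x - f x\<bar>"
          by (intro tendsto_intros lim)
        then show "(\<lambda>k. \<bar>f x - s k x\<bar>) \<longlonglongrightarrow> 0" by simp
      qed
      fix k
      show "AE x in M. norm \<bar>f x - s k x\<bar> \<le> 3 * norm (f x)"
      proof (rule AE_I2)
        fix x assume "x \<in> space M"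
        from lim(3)[OF this, of k] show "norm \<bar>f x - s k x\<bar> \<le> 3 * norm (f x)"
          by simp
      qed
    qed (use lim(1,4) in simp_all)
    then have "(\<lambda>k. LINT x|M. \<bar>f x - s k x\<bar>) \<longlonglongrightarrow> 0" by simp
    from weak_limit_closed_L1[OF _ bound lim(1,4,5) this] show ?case by simp
  qed
qed

lemma frac_measurable [measurable]: "(frac :: real \<Rightarrow> real) \<in> borel_measurable borel"
  unfolding frac_def[abs_def] by measurable

lemma frac_add_nat: "x \<in> {0..<1} \<Longrightarrow> frac (real j + x) = x"
  by (simp add: frac_unique_iff)

lemma integral_frac_cells:
  fixes \<phi> :: "real \<Rightarrow> real" and n :: nat
  assumes [measurable]: "\<phi> \<in> borel_measurable borel" and bound: "\<And>x. \<bar>\<phi> x\<bar> \<le> B" and n: "n > 0"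
  shows "(LBINT v:{0..<real k / real n}. \<phi> (frac (real n * v))) = real k / real n * (LBINT x:{0..<1}. \<phi> x)"
proof (induction k)
  case 0
  then show ?case by (simp add: set_lebesgue_integral_def)
next
  case (Suc k)
  let ?f = "\<lambda>v. \<phi> (frac (real n * v))"
  let ?J = "{real k / real n..<real (Suc k) / real n}"
  have i: "set_integrable lborel {a..<b} ?f" for a b
    unfolding set_integrable_def
  proof (rule Bochner_Integration.integrable_bound[where f="\<lambda>x. B * indicator {a..<b} x"])
    have "integrable lborel (indicator {a..<b} :: real \<Rightarrow> real)"
      by (rule integrable_real_indicator) (cases "a \<le> b"; simp)+
    then show "integrable lborel (\<lambda>x. B * indicator {a..<b} x)" by (rule integrable_mult_right)
  qed (use bound in \<open>auto simp: indicator_def intro: order_trans[OF _ abs_ge_self]\<close>)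
  have "(LBINT v:?J. ?f v) = \<bar>1 / real n\<bar> *\<^sub>R
      (LBINT x. indicator ?J (real k / real n + (1 / real n) * x) *\<^sub>R ?f (real k / real n + (1 / real n) * x))"
    unfolding set_lebesgue_integral_def by (rule lborel_integral_real_affine) (use n in simp)
  also have "(LBINT x. indicator ?J (real k / real n + (1 / real n) * x) *\<^sub>R ?f (real k / real n + (1 / real n) * x)) =
      (LBINT x:{0..<1}. \<phi> x)"
    unfolding set_lebesgue_integral_def
  proof (intro Bochner_Integration.integral_cong refl)
    fix x :: real
    have "real k / real n + (1 / real n) * x \<in> ?J \<longleftrightarrow> x \<in> {0..<1}"
      using n by (auto simp: field_simps)
    moreover have "real n * (real k / real n + (1 / real n) * x) = real k + x"
      using n by (simp add: field_simps)
    ultimately show "indicator ?J (real k / real n + (1 / real n) * x) *\<^sub>R ?f (real k / real n + (1 / real n) * x) =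
        indicator {0..<1} x *\<^sub>R \<phi> x"
      using frac_add_nat[of x k] by (auto simp: indicator_def simp del: of_nat_add)
  qed
  finally have cell: "(LBINT v:?J. ?f v) = 1 / real n * (LBINT x:{0..<1}. \<phi> x)" by simp
  have "{0..<real (Suc k) / real n} = {0..<real k / real n} \<union> ?J"
    by (intro ivl_disj_un_two(3)[symmetric]) (auto intro: divide_right_mono)
  then have "(LBINT v:{0..<real (Suc k) / real n}. ?f v) =
      (LBINT v:{0..<real k / real n}. ?f v) + (LBINT v:?J. ?f v)"
    by (simp only:) (rule set_integral_Un, auto intro: i)
  then show ?case
    using Suc cell by (simp add: algebra_simps add_divide_distrib)
qed

text \<open>All but at most one of the cells of length \<open>1 / n\<close> lie completely inside \<open>[0, a]\<close>, and each of them
  contributes exactly the mean of \<open>\<phi>\<close>.\<close>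

lemma integral_frac_tendsto:
  fixes \<phi> :: "real \<Rightarrow> real"
  assumes [measurable]: "\<phi> \<in> borel_measurable borel" and bound: "\<And>x. \<bar>\<phi> x\<bar> \<le> B" and a: "0 \<le> a"
  shows "(\<lambda>n. LBINT v:{0..a}. \<phi> (frac (real n * v))) \<longlonglongrightarrow> a * (LBINT x:{0..<1}. \<phi> x)"
proof -
  define I where "I = (LBINT x:{0..<1}. \<phi> x)"
  have B: "B \<ge> 0" using bound[of 0] by linarith
  have diff: "\<bar>(LBINT v:{0..a}. \<phi> (frac (real n * v))) - a * I\<bar> \<le> (B + \<bar>I\<bar>) / real n" if n: "n > 0" for n :: nat
  proof -
    define k where "k = nat \<lfloor>real n * a\<rfloor>"
    let ?f = "\<lambda>v. \<phi> (frac (real n * v))"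
    have k: "real k \<le> real n * a" "real n * a < real k + 1"
      using a by (auto simp: k_def)
    have kn: "real k / real n \<le> a"
      using k n by (simp add: field_simps)
    have "a - real k / real n = (real n * a - real k) / real n"
      using n by (simp add: field_simps)
    also have "\<dots> \<le> 1 / real n"
      using k by (intro divide_right_mono) auto
    finally have kn2: "a - real k / real n \<le> 1 / real n" .
    have i: "set_integrable lborel A ?f" if "A \<in> sets borel" "A \<subseteq> {0..a}" for A
      unfolding set_integrable_def
    proof (rule Bochner_Integration.integrable_bound[where f="\<lambda>x. B * indicator {0..a} x"])
      have "integrable lborel (indicator {0..a} :: real \<Rightarrow> real)"
        by (rule integrable_real_indicator) (use a in simp)+
      then show "integrable lborel (\<lambda>x. B * indicator {0..a} x)" by (rule integrable_mult_right)
      show "AE x in lborel. norm (indicator A x *\<^sub>R ?f x) \<le> norm (B * indicator {0..a} x)"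
      proof (rule AE_I2)
        fix x
        show "norm (indicator A x *\<^sub>R ?f x) \<le> norm (B * indicator {0..a} x)"
          using bound[of "frac (real n * x)"] that(2) B by (cases "x \<in> A") auto
      qed
    qed (use that in auto)
    have "{0..a} = {0..<real k / real n} \<union> {real k / real n..a}"
      using kn by (intro ivl_disj_un_two(7)[symmetric]) auto
    then have "(LBINT v:{0..a}. ?f v) = (LBINT v:{0..<real k / real n}. ?f v) + (LBINT v:{real k / real n..a}. ?f v)"
      using kn by (simp only:) (rule set_integral_Un, auto intro!: i)
    also have "(LBINT v:{0..<real k / real n}. ?f v) = real k / real n * I"
      unfolding I_def by (rule integral_frac_cells) (use bound n in auto)
    finally have "(LBINT v:{0..a}. ?f v) - a * I =
        (LBINT v:{real k / real n..a}. ?f v) - (a - real k / real n) * I"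
      by (simp add: algebra_simps)
    moreover have "\<bar>LBINT v:{real k / real n..a}. ?f v\<bar> \<le> B * (a - real k / real n)"
    proof -
      have s: "set_integrable lborel {real k / real n..a} ?f"
        by (rule i) auto
      have "(LBINT v:{real k / real n..a}. ?f v) \<le> (LBINT v:{real k / real n..a}. B)"
        by (rule set_integral_mono[OF s]) (use bound in \<open>auto simp: abs_le_iff\<close>)
      moreover have "(LBINT v:{real k / real n..a}. - B) \<le> (LBINT v:{real k / real n..a}. ?f v)"
        by (rule set_integral_mono[OF _ s]) (use bound in \<open>auto simp: abs_le_iff minus_le_iff\<close>)
      ultimately show ?thesis
        by (simp add: set_integral_const_interval kn abs_le_iff)
    qed
    moreover have "\<bar>(a - real k / real n) * I\<bar> \<le> (a - real k / real n) * \<bar>I\<bar>"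
      using kn by (simp add: abs_mult)
    ultimately have "\<bar>(LBINT v:{0..a}. ?f v) - a * I\<bar> \<le> (B + \<bar>I\<bar>) * (a - real k / real n)"
    proof -
      assume e: "(LBINT v:{0..a}. ?f v) - a * I = (LBINT v:{real k / real n..a}. ?f v) - (a - real k / real n) * I"
        and b1: "\<bar>LBINT v:{real k / real n..a}. ?f v\<bar> \<le> B * (a - real k / real n)"
        and b2: "\<bar>(a - real k / real n) * I\<bar> \<le> (a - real k / real n) * \<bar>I\<bar>"
      show ?thesis
        unfolding e distrib_right mult.commute[of "\<bar>I\<bar>"]
        by (rule order_trans[OF abs_triangle_ineq4 add_mono[OF b1 b2]])
    qed
    also have "\<dots> \<le> (B + \<bar>I\<bar>) * (1 / real n)"
      using kn2 B by (intro mult_left_mono) auto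
    finally show ?thesis by simp
  qed
  have "(\<lambda>n. (LBINT v:{0..a}. \<phi> (frac (real n * v))) - a * I) \<longlonglongrightarrow> 0"
  proof (rule Lim_null_comparison)
    show "\<forall>\<^sub>F n in sequentially. norm ((LBINT v:{0..a}. \<phi> (frac (real n * v))) - a * I) \<le> (B + \<bar>I\<bar>) / real n"
      using eventually_gt_at_top[of 0] by eventually_elim (use diff in simp)
    show "(\<lambda>n. (B + \<bar>I\<bar>) / real n) \<longlonglongrightarrow> 0" by real_asymp
  qed
  then show ?thesis unfolding I_def by (simp add: LIM_zero_iff)
qed

abbreviation density_law :: "(real \<Rightarrow> real) \<Rightarrow> real measure" where
  "density_law f \<equiv> density lborel (\<lambda>u. ennreal (indicator {0..} u * f u))"

lemma mass_neg: "u \<le> 0 \<Longrightarrow> mass f u = 0"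
  using mass_0[of f] by (cases "u = 0") (auto simp: mass_def set_lebesgue_integral_def simp del: mass_0)

lemma prob_density_nonneg_measurable:
  "prob_density_nonneg f \<Longrightarrow> (\<lambda>u. indicator {0..} u * f u) \<in> borel_measurable borel"
  using borel_measurable_integrable[of lborel "\<lambda>u. indicator {0..} u * f u"]
  by (simp add: prob_density_nonneg_def set_integrable_def)

lemma mono_mass: "prob_density_nonneg f \<Longrightarrow> mono (mass f)"
proof (rule monoI)
  fix u v :: real assume f: "prob_density_nonneg f" and "u \<le> v"
  have "mass f (max u 0) \<le> mass f (max v 0)"
    using \<open>u \<le> v\<close> by (intro mass_mono f) auto
  moreover have "mass f (max w 0) = mass f w" for w
    by (cases "w \<le> 0") (auto simp: mass_neg max_def)
  ultimately show "mass f u \<le> mass f v" by simp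
qed

lemma mass_measurable [measurable (raw)]: "prob_density_nonneg f \<Longrightarrow> mass f \<in> borel_measurable borel"
  by (rule borel_measurable_mono) (rule mono_mass)

lemma measure_density_law_atMost:
  assumes "prob_density_nonneg f"
  shows "measure (density_law f) {..u} = mass f u"
proof -
  note [measurable] = prob_density_nonneg_measurable[OF assms]
  have nn: "indicator {0..} x * f x \<ge> 0" for x
    using assms by (auto simp: prob_density_nonneg_def indicator_def)
  have int: "integrable lborel (\<lambda>x. indicator {0..} x * f x)"
    using assms by (simp add: prob_density_nonneg_def set_integrable_def)
  have "emeasure (density_law f) {..u} = (\<integral>\<^sup>+x. ennreal (indicator {0..} x * f x) * indicator {..u} x \<partial>lborel)"
    by (subst emeasure_density) auto
  also have "\<dots> = (\<integral>\<^sup>+x. ennreal (indicator {0..u} x * f x) \<partial>lborel)"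
    by (intro nn_integral_cong) (auto simp: indicator_def)
  also have "\<dots> = ennreal (LBINT x. indicator {0..u} x * f x)"
  proof (rule nn_integral_eq_integral)
    show "integrable lborel (\<lambda>x. indicator {0..u} x * f x)"
      using integrable_mult_indicator[OF _ int, of "{..u}"]
      by (rule Bochner_Integration.integrable_cong[THEN iffD1, rotated -1]) (auto simp: indicator_def)
  qed (use assms in \<open>auto simp: prob_density_nonneg_def indicator_def\<close>)
  finally show ?thesis
    using assms by (subst measure_eq_emeasure_eq_ennreal) (auto simp: mass_def set_lebesgue_integral_def
      prob_density_nonneg_def indicator_def intro!: integral_nonneg_AE)
qed

lemma prob_space_density_law:
  assumes "prob_density_nonneg f"
  shows "prob_space (density_law f)"
proof
  note [measurable] = prob_density_nonneg_measurable[OF assms]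
  have "emeasure (density_law f) UNIV = (\<integral>\<^sup>+x. ennreal (indicator {0..} x * f x) \<partial>lborel)"
    by (subst emeasure_density) auto
  also have "\<dots> = ennreal (LBINT x. indicator {0..} x * f x)"
    by (rule nn_integral_eq_integral)
       (use assms in \<open>auto simp: prob_density_nonneg_def set_integrable_def indicator_def\<close>)
  also have "\<dots> = 1" using assms by (simp add: prob_density_nonneg_def set_lebesgue_integral_def)
  finally show "emeasure (density_law f) (space (density_law f)) = 1" by simp
qed

text \<open>The probability integral transform: a continuous distribution function, regarded as a random
  variable under its own law, is uniform.\<close>

lemma distr_mass_uniform:
  assumes f: "prob_density_nonneg f" and strict: "\<And>u v. 0 \<le> u \<Longrightarrow> u < v \<Longrightarrow> mass f u < mass f v"
  shows "distr (density_law f) borel (mass f) = uniform_measure lborel {0..1}"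
proof -
  note [measurable] = mass_measurable[OF f]
  interpret D: prob_space "density_law f" by (rule prob_space_density_law[OF f])
  interpret U: prob_space "uniform_measure lborel {0..1::real}"
    by (rule prob_space_uniform_measure) auto
  interpret D': prob_space "distr (density_law f) borel (mass f)"
    by (rule D.prob_space_distr) simp
  have nn: "mass f u \<ge> 0" for u
    using mass_mono[OF f, of 0 u] mass_neg[of u f] by (cases "u \<le> 0") auto
  have lt1: "mass f u < 1" for u
    using strict[of "max u 0" "max u 0 + 1"] mass_le_1[OF f, of "max u 0 + 1"] nn
      monoD[OF mono_mass[OF f], of u "max u 0"] by simp
  show ?thesis
  proof (rule cdf_unique)
    show "real_distribution (distr (density_law f) borel (mass f))"
      by unfold_locales simp
    show "real_distribution (uniform_measure lborel {0..1::real})"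
      by unfold_locales simp
    show "cdf (distr (density_law f) borel (mass f)) = cdf (uniform_measure lborel {0..1})"
    proof
      fix x :: real
      have u: "measure (uniform_measure lborel {0..1::real}) {..x} = measure lborel ({0..1} \<inter> {..x})"
        by (subst measure_uniform_measure) auto
      have d: "measure (distr (density_law f) borel (mass f)) {..x} = measure (density_law f) {u. mass f u \<le> x}"
        by (subst measure_distr) (auto simp: vimage_def)
      consider "x < 0" | "x \<ge> 1" | "0 \<le> x" "x < 1" by linarith
      then show "cdf (distr (density_law f) borel (mass f)) x = cdf (uniform_measure lborel {0..1}) x"
      proof cases
        case 1
        then have "{u. mass f u \<le> x} = {}" "{0..1} \<inter> {..x} = {}"
          using nn by (auto simp: not_le intro: less_le_trans)
        then show ?thesis by (simp add: cdf_def u d)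
      next
        case 2
        then have "{u. mass f u \<le> x} = UNIV" "{0..1} \<inter> {..x} = {0..1}"
          using lt1 by (auto intro: less_imp_le less_le_trans)
        then show ?thesis using D.prob_space by (simp add: cdf_def u d)
      next
        case 3
        from order_tendstoD(1)[OF mass_tendsto_1[OF f], of x] 3
        have "\<forall>\<^sub>F v in at_top. x < mass f v \<and> 0 \<le> v"
          using eventually_ge_at_top[of 0] by (auto intro: eventually_conj)
        then obtain v where "x < mass f v" "0 \<le> v"
          by (metis (mono_tags, lifting) eventually_at_top_linorder order_refl)
        then obtain w where w: "w \<in> {0..v}" "mass f w = x"
          using mass_attains[OF f, of x v] 3 by auto
        have "{u. mass f u \<le> x} = {..w}"
        proof (intro set_eqI iffI)
          fix u assume "u \<in> {u. mass f u \<le> x}"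
          then show "u \<in> {..w}" using strict[of w u] w by (auto simp: not_less[symmetric])
        next
          fix u assume "u \<in> {..w}"
          then show "u \<in> {u. mass f u \<le> x}" using monoD[OF mono_mass[OF f], of u w] w by auto
        qed
        moreover have "{0..1} \<inter> {..x} = {0..x}" using 3 by auto
        ultimately show ?thesis
          using 3 w by (simp add: cdf_def u d measure_density_law_atMost[OF f])
      qed
    qed
  qed
qed

text \<open>Fejer's theorem transported by the distribution function: as \<open>mass f\<close> is uniform under the law
  with density \<open>f\<close>, on half-lines the claim is the one about \<open>frac (n * v)\<close> on an interval.\<close>

lemma fejer_density:
  fixes \<phi> g :: "real \<Rightarrow> real"
  assumes f: "prob_density_nonneg f" and strict: "\<And>u v. 0 \<le> u \<Longrightarrow> u < v \<Longrightarrow> mass f u < mass f v"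
    and [measurable]: "\<phi> \<in> borel_measurable borel" and bound: "\<And>x. \<bar>\<phi> x\<bar> \<le> B"
    and g: "integrable (density_law f) g"
  shows "(\<lambda>n. LINT u|density_law f. g u * \<phi> (frac (real n * mass f u)))
    \<longlonglongrightarrow> (LBINT x:{0..<1}. \<phi> x) * (LINT u|density_law f. g u)"
proof (rule weak_limit_from_half_lines[where B=B])
  note [measurable] = mass_measurable[OF f]
  interpret D: prob_space "density_law f" by (rule prob_space_density_law[OF f])
  show "prob_space (density_law f)" by unfold_locales
  have transfer: "(LINT u|density_law f. h (mass f u)) = (LBINT v:{0..1}. h v)"
    if [measurable]: "h \<in> borel_measurable borel" for h :: "real \<Rightarrow> real"
  proof -
    have "(LINT u|density_law f. h (mass f u)) = (LINT v|distr (density_law f) borel (mass f). h v)"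
      by (rule integral_distr[symmetric]) auto
    also have "\<dots> = (LINT v|uniform_measure lborel {0..1}. h v)"
      by (simp only: distr_mass_uniform[OF f strict])
    also have "\<dots> = (LBINT v:{0..1}. h v)"
    proof -
      have "uniform_measure lborel {0..1} = density lborel (\<lambda>x. ennreal (indicator {0..1::real} x))"
        unfolding uniform_measure_def
        by (auto intro!: arg_cong[of _ _ "density lborel"] simp: indicator_def divide_ennreal_def)
      then show ?thesis
        by (simp add: integral_density set_lebesgue_integral_def)
    qed
    finally show ?thesis .
  qed
  show "(\<lambda>n. LINT u|density_law f. \<phi> (frac (real n * mass f u))) \<longlonglongrightarrow> (LBINT x:{0..<1}. \<phi> x)"
    using integral_frac_tendsto[of \<phi> B 1] bound
    by (subst transfer) (auto)
  fix a :: real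
  show "(\<lambda>n. LINT u|density_law f. indicator {..a} u * \<phi> (frac (real n * mass f u)))
      \<longlonglongrightarrow> (LBINT x:{0..<1}. \<phi> x) * measure (density_law f) {..a}"
  proof (cases "a \<ge> 0")
    case True
    have le: "mass f u \<le> mass f a \<longleftrightarrow> u \<le> a" for u
      using strict[OF True, of u] monoD[OF mono_mass[OF f], of u a] by (auto simp: not_le[symmetric])
    have m: "0 \<le> mass f a" "mass f a \<le> 1" using mass_mono[OF f, of 0 a] mass_le_1[OF f True] True by auto
    have "(LINT u|density_law f. indicator {..a} u * \<phi> (frac (real n * mass f u))) =
        (LBINT v:{0..mass f a}. \<phi> (frac (real n * v)))" for n
    proof -
      have "(LINT u|density_law f. indicator {..a} u * \<phi> (frac (real n * mass f u))) =
          (LINT u|density_law f. indicator {..mass f a} (mass f u) * \<phi> (frac (real n * mass f u)))"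
        by (simp add: indicator_def le)
      also have "\<dots> = (LBINT v:{0..1}. indicator {..mass f a} v * \<phi> (frac (real n * v)))"
        by (rule transfer) measurable
      also have "\<dots> = (LBINT v:{0..mass f a}. \<phi> (frac (real n * v)))"
        unfolding set_lebesgue_integral_def using m
        by (intro Bochner_Integration.integral_cong) (auto simp: indicator_def)
      finally show ?thesis .
    qed
    moreover have "(\<lambda>n. LBINT v:{0..mass f a}. \<phi> (frac (real n * v))) \<longlonglongrightarrow> mass f a * (LBINT x:{0..<1}. \<phi> x)"
      by (rule integral_frac_tendsto) (use bound m(1) in auto)
    ultimately show ?thesis
      by (simp only: measure_density_law_atMost[OF f] mult.commute[of "mass f a"])
  next
    case False
    have "(LINT u|density_law f. indicator {..a} u * \<phi> (frac (real n * mass f u))) = 0" for n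
    proof -
      have "(LINT u|density_law f. indicator {..a} u * \<phi> (frac (real n * mass f u))) = (LINT u|density_law f. 0)"
      proof (rule integral_cong_AE)
        note [measurable] = prob_density_nonneg_measurable[OF f]
        have "(\<lambda>u. ennreal (indicator {0..} u * f u)) \<in> borel_measurable lborel" by measurable
        from AE_density[OF this] show "AE u in density_law f. indicator {..a} u * \<phi> (frac (real n * mass f u)) = 0"
          using False by (simp add: indicator_def)
      qed auto
      then show ?thesis by simp
    qed
    then show ?thesis using False by (simp add: measure_density_law_atMost[OF f] mass_neg)
  qed
qed (use g bound mass_measurable[OF f] in auto)

section \<open>Mean-square increments and piecewise constant approximation\<close>

definition msq_increment :: "'a measure \<Rightarrow> (real \<Rightarrow> 'a \<Rightarrow> real) \<Rightarrow> real \<Rightarrow> real \<Rightarrow> real" where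
  "msq_increment M X s t = (LINT \<omega>|M. (X s \<omega> - X t \<omega>)\<^sup>2)"

lemma msq_increment_nonneg: "0 \<le> msq_increment M X s t"
  by (simp add: msq_increment_def)

lemma msq_increment_self [simp]: "msq_increment M X t t = 0"
  by (simp add: msq_increment_def)

lemma locally_stationary_uniform:
  assumes "locally_stationary M X \<alpha> c" "\<epsilon> > 0"
  shows "\<exists>\<delta>>0. \<forall>s\<in>{0..1}. \<forall>t\<in>{0..1}. \<bar>s - t\<bar> < \<delta> \<longrightarrow>
    \<bar>msq_increment M X s t - c t * \<bar>s - t\<bar> powr \<alpha> t\<bar> \<le> \<epsilon> * \<bar>s - t\<bar> powr \<alpha> t"
proof -
  from assms(1) have "\<forall>\<epsilon>>0. \<exists>\<delta>>0. \<forall>t\<in>{0..1}. \<forall>s. s \<noteq> 0 \<and> \<bar>s\<bar> < \<delta> \<and> t + s \<in> {0..1} \<longrightarrow>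
      \<bar>(ms_norm M (\<lambda>\<omega>. X (t + s) \<omega> - X t \<omega>))\<^sup>2 / \<bar>s\<bar> powr \<alpha> t - c t\<bar> < \<epsilon>"
    unfolding locally_stationary_def by (elim conjE)
  with assms(2) obtain \<delta> where "\<delta> > 0" and \<delta>: "\<And>t s. t \<in> {0..1} \<Longrightarrow> s \<noteq> 0 \<Longrightarrow> \<bar>s\<bar> < \<delta> \<Longrightarrow> t + s \<in> {0..1} \<Longrightarrow>
      \<bar>(ms_norm M (\<lambda>\<omega>. X (t + s) \<omega> - X t \<omega>))\<^sup>2 / \<bar>s\<bar> powr \<alpha> t - c t\<bar> < \<epsilon>"
    by meson
  have "\<bar>msq_increment M X s t - c t * \<bar>s - t\<bar> powr \<alpha> t\<bar> \<le> \<epsilon> * \<bar>s - t\<bar> powr \<alpha> t"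
    if st: "s \<in> {0..1}" "t \<in> {0..1}" "\<bar>s - t\<bar> < \<delta>" for s t
  proof (cases "s = t")
    case False
    define h where "h = \<bar>s - t\<bar> powr \<alpha> t"
    have "h > 0" using False by (simp add: h_def)
    have "(ms_norm M (\<lambda>\<omega>. X s \<omega> - X t \<omega>))\<^sup>2 = msq_increment M X s t"
      by (simp add: ms_norm_def msq_increment_def)
    with \<delta>[of t "s - t"] st False have "\<bar>msq_increment M X s t / h - c t\<bar> < \<epsilon>"
      by (simp add: h_def)
    also have "msq_increment M X s t / h - c t = (msq_increment M X s t - c t * h) / h"
      using \<open>h > 0\<close> by (simp add: field_simps)
    finally show ?thesis
      using \<open>h > 0\<close> unfolding h_def[symmetric] by (simp add: abs_divide divide_simps)
  qed simp
  with \<open>\<delta> > 0\<close> show ?thesis by blast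
qed

lemma msq_increment_tendsto_0:
  assumes X: "locally_stationary M X \<alpha> c" and t: "t \<in> {0..1}"
  shows "((\<lambda>s. msq_increment M X s t) \<longlongrightarrow> 0) (at t within {0..1})"
proof -
  from locally_stationary_uniform[OF X, of 1] obtain \<delta> where "\<delta> > 0" and
    \<delta>: "\<And>s. s \<in> {0..1} \<Longrightarrow> \<bar>s - t\<bar> < \<delta> \<Longrightarrow>
      \<bar>msq_increment M X s t - c t * \<bar>s - t\<bar> powr \<alpha> t\<bar> \<le> 1 * \<bar>s - t\<bar> powr \<alpha> t"
    using t by auto
  have \<alpha>: "\<alpha> t > 0" using X t by (auto simp: locally_stationary_def)
  have "((\<lambda>s. (c t + 1) * \<bar>s - t\<bar> powr \<alpha> t) \<longlongrightarrow> (c t + 1) * \<bar>t - t\<bar> powr \<alpha> t) (at t within {0..1})"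
    using \<alpha> by (intro tendsto_intros tendsto_powr') auto
  then have lim: "((\<lambda>s. (c t + 1) * \<bar>s - t\<bar> powr \<alpha> t) \<longlongrightarrow> 0) (at t within {0..1})" by simp
  have "\<forall>\<^sub>F s in at t within {0..1}. s \<in> {0..1} \<and> \<bar>s - t\<bar> < \<delta>"
    unfolding eventually_at using \<open>\<delta> > 0\<close> by (auto simp: dist_real_def)
  then have "\<forall>\<^sub>F s in at t within {0..1}. norm (msq_increment M X s t) \<le> (c t + 1) * \<bar>s - t\<bar> powr \<alpha> t"
  proof eventually_elim
    case (elim s)
    with \<delta>[of s] show ?case
      using msq_increment_nonneg[of M X s t] by (simp add: abs_le_iff algebra_simps)
  qed
  from Lim_null_comparison[OF this lim] show ?thesis .
qed

text \<open>A weighted form of the inequality between the geometric and the arithmetic mean. Integrated, it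
  replaces the triangle inequality in \<open>L\<^sup>2\<close>.\<close>

lemma square_difference_bound:
  fixes A D :: real
  assumes "\<eta> > 0"
  shows "\<bar>(A + D)\<^sup>2 - A\<^sup>2\<bar> \<le> \<eta> * A\<^sup>2 + (1 + 1 / \<eta>) * D\<^sup>2"
proof -
  have "0 \<le> (sqrt \<eta> * A - D / sqrt \<eta>)\<^sup>2" "0 \<le> (sqrt \<eta> * A + D / sqrt \<eta>)\<^sup>2" by simp_all
  then have "\<bar>2 * A * D\<bar> \<le> \<eta> * A\<^sup>2 + D\<^sup>2 / \<eta>"
    using assms by (simp add: power2_diff power2_sum power_mult_distrib power_divide abs_le_iff)
  moreover have "(A + D)\<^sup>2 - A\<^sup>2 = 2 * A * D + D\<^sup>2" by (simp add: power2_sum)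
  moreover have "(1 + 1 / \<eta>) * D\<^sup>2 = D\<^sup>2 + D\<^sup>2 / \<eta>" "0 \<le> D\<^sup>2"
    by (simp_all add: algebra_simps)
  ultimately show ?thesis unfolding abs_le_iff by linarith
qed

lemma integrable_square_diff:
  assumes "second_order_process M X" "s \<in> {0..1}" "t \<in> {0..1}"
  shows "integrable M (\<lambda>\<omega>. (X s \<omega> - X t \<omega>)\<^sup>2)"
proof (rule Bochner_Integration.integrable_bound)
  from assms have [measurable]: "X s \<in> borel_measurable M" "X t \<in> borel_measurable M"
    and "integrable M (\<lambda>\<omega>. (X s \<omega>)\<^sup>2)" "integrable M (\<lambda>\<omega>. (X t \<omega>)\<^sup>2)"
    by (auto simp: second_order_process_def)
  then show "integrable M (\<lambda>\<omega>. 2 * (X s \<omega>)\<^sup>2 + 2 * (X t \<omega>)\<^sup>2)" by simp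
  show "(\<lambda>\<omega>. (X s \<omega> - X t \<omega>)\<^sup>2) \<in> borel_measurable M" by measurable
  show "AE \<omega> in M. norm ((X s \<omega> - X t \<omega>)\<^sup>2) \<le> norm (2 * (X s \<omega>)\<^sup>2 + 2 * (X t \<omega>)\<^sup>2)"
  proof (rule AE_I2)
    fix \<omega>
    have "0 \<le> (X s \<omega> + X t \<omega>)\<^sup>2" by simp
    then have "(X s \<omega> - X t \<omega>)\<^sup>2 \<le> 2 * (X s \<omega>)\<^sup>2 + 2 * (X t \<omega>)\<^sup>2"
      by (simp add: power2_diff power2_sum)
    then show "norm ((X s \<omega> - X t \<omega>)\<^sup>2) \<le> norm (2 * (X s \<omega>)\<^sup>2 + 2 * (X t \<omega>)\<^sup>2)"
      by simp
  qed
qed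

lemma continuous_on_msq_increment:
  assumes X: "locally_stationary M X \<alpha> c" and k: "k \<in> {0..1}"
  shows "continuous_on {0..1} (\<lambda>t. msq_increment M X t k)"
  unfolding continuous_on_def
proof
  fix t :: real assume t: "t \<in> {0..1}"
  have so: "second_order_process M X" using X by (simp add: locally_stationary_def)
  define V where "V = msq_increment M X"
  show "((\<lambda>s. msq_increment M X s k) \<longlongrightarrow> msq_increment M X t k) (at t within {0..1})"
    unfolding V_def[symmetric]
  proof (rule tendstoI)
    fix e :: real assume "e > 0"
    define W where "W = V t k + 1"
    (* the weight that leaves e / 2 for the part of the bound that does not vanish as s tends to t *)
    define \<eta> where "\<eta> = e / (2 * W)"
    have "W > 0" using msq_increment_nonneg[of M X t k] by (simp add: W_def V_def)
    then have "\<eta> > 0" using \<open>e > 0\<close> by (simp add: \<eta>_def)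
    have "((\<lambda>s. (1 + 1 / \<eta>) * V s t) \<longlongrightarrow> (1 + 1 / \<eta>) * 0) (at t within {0..1})"
      unfolding V_def by (intro tendsto_intros msq_increment_tendsto_0[OF X t])
    from order_tendstoD(2)[OF this, of "e / 2"] \<open>e > 0\<close>
    have "\<forall>\<^sub>F s in at t within {0..1}. (1 + 1 / \<eta>) * V s t < e / 2" by simp
    moreover have "\<forall>\<^sub>F s in at t within {0..1}. s \<in> {0..1}"
      unfolding eventually_at by (auto intro!: exI[of _ 1])
    ultimately show "\<forall>\<^sub>F s in at t within {0..1}. dist (V s k) (V t k) < e"
    proof eventually_elim
      case (elim s)
      note i = integrable_square_diff[OF so]
      have "V s k - V t k = (LINT \<omega>|M. (X s \<omega> - X k \<omega>)\<^sup>2 - (X t \<omega> - X k \<omega>)\<^sup>2)"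
        unfolding V_def msq_increment_def using elim t k
        by (intro Bochner_Integration.integral_diff[symmetric] i) auto
      also have "\<bar>\<dots>\<bar> \<le> (LINT \<omega>|M. \<bar>(X s \<omega> - X k \<omega>)\<^sup>2 - (X t \<omega> - X k \<omega>)\<^sup>2\<bar>)"
        by (rule integral_abs_bound)
      also have "\<dots> \<le> (LINT \<omega>|M. \<eta> * (X t \<omega> - X k \<omega>)\<^sup>2 + (1 + 1 / \<eta>) * (X s \<omega> - X t \<omega>)\<^sup>2)"
      proof (rule integral_mono)
        fix \<omega>
        show "\<bar>(X s \<omega> - X k \<omega>)\<^sup>2 - (X t \<omega> - X k \<omega>)\<^sup>2\<bar> \<le> \<eta> * (X t \<omega> - X k \<omega>)\<^sup>2 + (1 + 1 / \<eta>) * (X s \<omega> - X t \<omega>)\<^sup>2"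
          using square_difference_bound[OF \<open>\<eta> > 0\<close>, of "X t \<omega> - X k \<omega>" "X s \<omega> - X t \<omega>"] by simp
      qed (use elim t k in \<open>auto intro!: i integrable_abs Bochner_Integration.integrable_diff Bochner_Integration.integrable_add integrable_mult_right\<close>)
      also have "\<dots> = \<eta> * V t k + (1 + 1 / \<eta>) * V s t"
        unfolding V_def msq_increment_def using elim t k
        by (subst Bochner_Integration.integral_add) (auto intro!: i integrable_mult_right)
      also have "\<eta> * V t k \<le> \<eta> * W" using \<open>\<eta> > 0\<close> by (simp add: W_def)
      also have "\<eta> * W = e / 2" using \<open>W > 0\<close> by (simp add: \<eta>_def)
      finally show ?case using elim(1) unfolding dist_real_def by linarith
    qed
  qed
qed

definition prev_knot :: "real set \<Rightarrow> real \<Rightarrow> real" where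
  "prev_knot T s = Max {k \<in> T. k \<le> s}"

lemma prev_knot_props:
  assumes "finite T" "k \<in> T" "k \<le> s"
  shows prev_knot_mem: "prev_knot T s \<in> T" and prev_knot_le: "prev_knot T s \<le> s"
    and prev_knot_ge: "k \<le> prev_knot T s"
proof -
  have "finite {k \<in> T. k \<le> s}" "{k \<in> T. k \<le> s} \<noteq> {}" using assms by auto
  from Max_in[OF this] show "prev_knot T s \<in> T" "prev_knot T s \<le> s"
    by (auto simp: prev_knot_def)
  show "k \<le> prev_knot T s"
    unfolding prev_knot_def using assms by (intro Max_ge) auto
qed

text \<open>Frees everything that follows from the enumeration of the knots: only the last knot before a
  point matters.\<close>

lemma piecewise_const_approx_eq_prev_knot:
  assumes T: "finite T" "a \<in> T" "e \<in> T" "\<And>k. k \<in> T \<Longrightarrow> k \<le> e" and s: "a \<le> s" "s \<le> e"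
  shows "piecewise_const_approx X (\<lambda>j. sorted_list_of_set T ! j) (card T - 1) s = X (prev_knot T s)"
proof -
  define L where "L = sorted_list_of_set T"
  define N where "N = card T - 1"
  have len: "length L = Suc N"
    using T(1,2) card_gt_0_iff[of T] by (auto simp: L_def N_def)
  have set: "set L = T" using T by (simp add: L_def)
  have sorted: "sorted_wrt (<) L" unfolding L_def by (rule strict_sorted_list_of_set)
  have less: "L ! i < L ! j" if "i < j" "j \<le> N" for i j
    using sorted_wrt_nth_less[OF sorted, of i j] that len by simp
  have last: "L ! N = e"
  proof -
    from T(3) obtain i where i: "i \<le> N" "L ! i = e"
      by (metis set in_set_conv_nth len less_Suc_eq_le)
    have "L ! N \<in> T" using set len by (metis lessI nth_mem)
    from T(4)[OF this] show ?thesis using less[of i N] i by (cases "i = N") auto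
  qed
  note pk = prev_knot_mem[OF T(1,2) s(1)] prev_knot_le[OF T(1,2) s(1)] prev_knot_ge[OF T(1) _]
  show ?thesis
  proof (cases "s < e")
    case True
    obtain i where i: "i \<le> N" "L ! i = prev_knot T s"
      using pk(1) by (metis set in_set_conv_nth len less_Suc_eq_le)
    have "i \<noteq> N" using i pk(2) True last by auto
    then have iN: "Suc i \<le> N" using i by simp
    have next_gt: "s < L ! Suc i"
    proof (rule ccontr)
      assume "\<not> s < L ! Suc i"
      moreover have "L ! Suc i \<in> T" using set len iN by (metis less_Suc_eq_le nth_mem)
      ultimately have "L ! Suc i \<le> prev_knot T s" by (intro pk(3)) auto
      then show False using less[of i "Suc i"] i iN by simp
    qed
    have "(THE j. j \<in> {1..N} \<and> L ! (j - 1) \<le> s \<and> s < L ! j) = Suc i"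
    proof (rule the_equality)
      show "Suc i \<in> {1..N} \<and> L ! (Suc i - 1) \<le> s \<and> s < L ! Suc i"
        using iN i pk(2) next_gt by auto
      fix j assume j: "j \<in> {1..N} \<and> L ! (j - 1) \<le> s \<and> s < L ! j"
      show "j = Suc i"
      proof (rule ccontr)
        assume "j \<noteq> Suc i"
        then consider "j \<le> i" | "Suc i \<le> j - 1" using j by fastforce
        then show False
        proof cases
          case 1
          then have "L ! j \<le> L ! i" using less[of j i] i by (cases "j = i") auto
          then show False using j i pk(2) by simp
        next
          case 2
          moreover have "j - 1 \<le> N" using j by auto
          ultimately have "L ! Suc i \<le> L ! (j - 1)" using less[of "Suc i" "j - 1"] by (cases "Suc i = j - 1") simp_all
          then show False using j next_gt by simp
        qed
      qed
    qed
    then show ?thesis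
      using True last i unfolding piecewise_const_approx_def L_def[symmetric] N_def[symmetric] by simp
  next
    case False
    then have "s = e" using s by simp
    moreover have "prev_knot T e = e"
      using prev_knot_le[OF T(1,3), of e] prev_knot_ge[OF T(1,3), of e] by simp
    ultimately show ?thesis
      using last unfolding piecewise_const_approx_def L_def[symmetric] N_def[symmetric] by simp
  qed
qed

text \<open>Between two consecutive knots the error is a continuous function of time, so it is a finite sum
  of continuous functions restricted to Borel sets. The Bochner integral of a
  non-measurable error would be 0 by convention.\<close>

lemma msq_error_measurable:
  assumes X: "locally_stationary M X \<alpha> c" and T: "finite T" "0 \<in> T" "T \<subseteq> {0..1}"
  shows "(\<lambda>t. indicator {0..1} t * msq_increment M X t (prev_knot T t)) \<in> borel_measurable borel"
proof -
  have V: "(\<lambda>t. indicator {0..1} t *\<^sub>R msq_increment M X t k) \<in> borel_measurable borel" if "k \<in> T" for k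
    using that T by (intro borel_measurable_continuous_on_indicator continuous_on_msq_increment[OF X]) auto
  define J where "J k = {t::real. k \<le> t \<and> (\<forall>k'\<in>T. k' \<le> t \<longrightarrow> k' \<le> k)}" for k
  have "countable T" using T by (simp add: countable_finite)
  then have [measurable]: "J k \<in> sets borel" for k
    unfolding J_def by measurable
  have "(\<lambda>t. indicator {0..1} t * msq_increment M X t (prev_knot T t)) =
      (\<lambda>t. \<Sum>k\<in>T. indicator (J k) t *\<^sub>R
         (indicator {0..1} t *\<^sub>R msq_increment M X t k))" (is "_ = (\<lambda>t. \<Sum>k\<in>T. ?f t k)")
  proof
    fix t :: real
    show "indicator {0..1} t * msq_increment M X t (prev_knot T t) = (\<Sum>k\<in>T. ?f t k)"
    proof (cases "t \<in> {0..1}")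
      case True
      let ?p = "prev_knot T t"
      note pk = prev_knot_mem[OF T(1,2), of t] prev_knot_le[OF T(1,2), of t] prev_knot_ge[OF T(1), of _ t]
      have "(\<Sum>k\<in>T. ?f t k) = (\<Sum>k\<in>T. if k = ?p then msq_increment M X t k else 0)"
      proof (intro sum.cong refl)
        fix k assume "k \<in> T"
        have "(k \<le> t \<and> (\<forall>k'\<in>T. k' \<le> t \<longrightarrow> k' \<le> k)) \<longleftrightarrow> k = ?p"
        proof
          assume "k \<le> t \<and> (\<forall>k'\<in>T. k' \<le> t \<longrightarrow> k' \<le> k)"
          then show "k = ?p" using pk \<open>k \<in> T\<close> True by (intro antisym) auto
        next
          assume "k = ?p"
          then show "k \<le> t \<and> (\<forall>k'\<in>T. k' \<le> t \<longrightarrow> k' \<le> k)" using pk True by auto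
        qed
        then have "t \<in> J k \<longleftrightarrow> k = ?p"
          by (simp only: J_def mem_Collect_eq)
        then show "?f t k = (if k = ?p then msq_increment M X t k else 0)"
          using True by (cases "k = ?p") simp_all
      qed
      also have "\<dots> = msq_increment M X t ?p"
        using T pk(1) True by simp
      finally show ?thesis using True by simp
    qed simp
  qed
  also have "\<dots> \<in> borel_measurable borel"
    by (intro borel_measurable_sum borel_measurable_scaleR V) measurable
  finally show ?thesis .
qed

section \<open>Knots and spacings of composite dilated designs\<close>

text \<open>Counts knots: an injective function takes each of the values \<open>j / n\<close> at most once.\<close>

lemma strict_mono_level_set_card:
  fixes F :: "real \<Rightarrow> real" and x y :: real
  assumes inj: "inj_on F A" and n: "n > 0"
    and sub: "K \<subseteq> {t \<in> A. \<exists>j::int. x \<le> j \<and> j \<le> y \<and> F t = of_int j / real n}"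
  shows "finite K" "int (card K) \<le> max 0 (\<lfloor>y\<rfloor> - \<lceil>x\<rceil> + 1)"
proof -
  let ?J = "of_int ` {\<lceil>x\<rceil>..\<lfloor>y\<rfloor>} :: real set"
  have inj': "inj_on (\<lambda>t. real n * F t) K"
    using inj sub n by (auto simp: inj_on_def)
  have img: "(\<lambda>t. real n * F t) ` K \<subseteq> ?J"
  proof
    fix z assume "z \<in> (\<lambda>t. real n * F t) ` K"
    then obtain t j where "x \<le> of_int j" "of_int j \<le> y" "F t = of_int j / real n" "z = real n * F t"
      using sub by auto
    then have "z = of_int j" "j \<in> {\<lceil>x\<rceil>..\<lfloor>y\<rfloor>}"
      using n by (auto simp: ceiling_le_iff le_floor_iff)
    then show "z \<in> ?J" by blast
  qed
  show "finite K" by (rule inj_on_finite[OF inj' img]) simp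
  have "card K \<le> card ?J" by (rule card_inj_on_le[OF inj' img]) simp
  also have "card ?J = card {\<lceil>x\<rceil>..\<lfloor>y\<rfloor>}" by (rule card_image) (simp add: inj_on_def)
  finally show "int (card K) \<le> max 0 (\<lfloor>y\<rfloor> - \<lceil>x\<rceil> + 1)" by simp
qed

text \<open>The setting of the theorem, except that regular variation of \<open>p'\<close> is replaced by the polynomial
  lower bound that it implies.\<close>

locale composite_dilated_design =
  fixes M :: "'a measure" and X :: "real \<Rightarrow> 'a \<Rightarrow> real"
    and \<alpha> c p p' :: "real \<Rightarrow> real"
    and b \<gamma> \<rho> q1 q2 :: real
    and tail_const tail_exp tail_start :: real
  assumes X: "locally_stationary M X \<alpha> c"
    and C1: "\<forall>t\<in>{0<..1}. \<alpha> 0 < \<alpha> t"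
    and C2: "0 < b" "0 < \<gamma>"
      "(\<lambda>t. \<alpha> t - (\<alpha> 0 + b * t powr \<gamma>)) \<in> o[at_right 0](\<lambda>t. t powr \<gamma>)"
    and p: "prob_density_nonneg p" and p': "prob_density_nonneg p'"
    and rho: "0 < \<rho>" "\<rho> < 1"
    and A1: "antimono_on {0..} p"
      "0 < q1" "0 < q2" "q2 < b / \<alpha> 0"
      "\<forall>u\<ge>0. p u \<ge> q1 * exp (- q2 * u powr \<gamma>)"
    and A2: "0 < tail_const" "0 \<le> tail_exp" "1 \<le> tail_start" "\<And>u. tail_start \<le> u \<Longrightarrow> tail_const * u powr (- tail_exp) \<le> p' u"
    and A3: "q2 * (SUP t\<in>{0..\<rho>}. \<alpha> t) < (INF t\<in>{0<..\<rho>}. (\<alpha> t - \<alpha> 0) / t powr \<gamma>)"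
      "q2 * \<rho> powr \<gamma> < 1"
begin

abbreviation d :: "nat \<Rightarrow> real" where "d n \<equiv> dilation_factor \<gamma> n"
abbreviation T :: "nat \<Rightarrow> real set" where "T n \<equiv> composite_knots \<gamma> p \<rho> p' n"
abbreviation \<tau> :: "nat \<Rightarrow> real \<Rightarrow> real" where "\<tau> n \<equiv> prev_knot (T n)"

lemma d_powr: "n \<ge> 1 \<Longrightarrow> d n powr \<gamma> = ln (real n)"
  using C2(2) by (simp add: dilation_factor_def powr_powr)

lemma d_at_top: "filterlim d at_top sequentially"
proof -
  have "filterlim (\<lambda>x::real. ln x powr (1 / \<gamma>)) at_top at_top"
    using C2(2) by real_asymp
  from filterlim_compose[OF this filterlim_real_sequentially] show ?thesis
    by (simp add: dilation_factor_def[abs_def])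
qed

lemma d_mult_at_top: "x > 0 \<Longrightarrow> filterlim (\<lambda>n. d n * x) at_top sequentially"
  by (rule filterlim_at_top_mult_tendsto_pos[OF tendsto_const _ d_at_top])

text \<open>The reason for the choice of the dilation factor: stretched exponentials in the dilated variable
  are powers of \<open>n\<close>.\<close>

lemma exp_dilated_eq_powr:
  assumes "n \<ge> 1" "t \<ge> 0"
  shows "exp (k * (d n * t) powr \<gamma>) = real n powr (k * t powr \<gamma>)"
proof -
  have "(d n * t) powr \<gamma> = d n powr \<gamma> * t powr \<gamma>"
    by (rule powr_mult)
  also have "\<dots> = ln (real n) * t powr \<gamma>" using d_powr[OF assms(1)] by simp
  finally have "k * (d n * t) powr \<gamma> = k * t powr \<gamma> * ln (real n)" by simp
  then show ?thesis using assms(1) by (simp add: powr_def)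
qed

lemma p_int: "set_integrable lborel {0..} p"
  using p by (simp add: prob_density_nonneg_def)

lemma p'_int: "set_integrable lborel {0..} p'"
  using p' by (simp add: prob_density_nonneg_def)

lemma p_lower: "u \<ge> 0 \<Longrightarrow> q1 * exp (- q2 * u powr \<gamma>) \<le> p u"
  using A1 by blast

lemma p_pos: "u \<ge> 0 \<Longrightarrow> p u > 0"
  by (rule less_le_trans[OF _ p_lower]) (use A1 in auto)

lemma p_antimono: "0 \<le> u \<Longrightarrow> u \<le> v \<Longrightarrow> p v \<le> p u"
  using A1(1) by (auto simp: monotone_on_def)

lemma mass_p_lower: "0 \<le> u \<Longrightarrow> u \<le> v \<Longrightarrow> p v * (v - u) \<le> mass p v - mass p u"
  by (rule mass_diff_lower[OF p_int]) (auto intro: p_antimono)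

lemma mass_p_upper: "0 \<le> u \<Longrightarrow> u \<le> v \<Longrightarrow> mass p v - mass p u \<le> p u * (v - u)"
  by (rule mass_diff_upper[OF p_int]) (auto intro: p_antimono)

lemma mass_p_strict: "0 \<le> u \<Longrightarrow> u < v \<Longrightarrow> mass p u < mass p v"
  using mass_p_lower[of u v] mult_pos_pos[OF p_pos[of v], of "v - u"] by simp

text \<open>The \<open>n\<close> for which the lower bound on \<open>p'\<close> is available on the whole dilated interval
  \<open>[d n * \<rho>, d n]\<close>.\<close>

definition large :: "nat \<Rightarrow> bool" where
  "large n \<longleftrightarrow> n \<ge> 2 \<and> d n \<ge> 1 \<and> d n * \<rho> \<ge> tail_start"

lemma eventually_large: "\<forall>\<^sub>F n in sequentially. large n"
proof -
  have "\<forall>\<^sub>F n in sequentially. d n \<ge> 1"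
    using d_at_top by (simp add: filterlim_at_top)
  moreover have "\<forall>\<^sub>F n in sequentially. d n * \<rho> \<ge> tail_start"
    using d_mult_at_top[OF rho(1)] by (simp add: filterlim_at_top)
  ultimately show ?thesis
    using eventually_ge_at_top[of 2] unfolding large_def by eventually_elim simp
qed

definition p'_min :: "nat \<Rightarrow> real" where
  "p'_min n = tail_const * d n powr (- tail_exp)"

lemma large_pos:
  assumes "large n"
  shows "real n > 0" "d n > 0" "d n \<ge> 1" "p'_min n > 0" "n \<ge> 2" "n > 0"
  using assms A2(1) by (auto simp: large_def p'_min_def)

lemma mass_p'_lower:
  assumes n: "large n" and st: "\<rho> \<le> s" "s \<le> t" "t \<le> 1"
  shows "p'_min n * (d n * (t - s)) \<le> mass p' (d n * t) - mass p' (d n * s)"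
proof -
  have dp: "d n > 0" using large_pos[OF n] by simp
  have "p'_min n * (d n * t - d n * s) \<le> mass p' (d n * t) - mass p' (d n * s)"
  proof (rule mass_diff_lower[OF p'_int])
    fix u assume u: "u \<in> {d n * s..d n * t}"
    have "d n * \<rho> \<le> d n * s" "d n * t \<le> d n * 1"
      using st dp by (intro mult_left_mono; simp)+
    moreover have "d n * s \<le> u" "u \<le> d n * t" "tail_start \<le> d n * \<rho>"
      using u n by (auto simp: large_def)
    ultimately have "tail_start \<le> u" "u \<le> d n" by linarith+
    have "d n powr (- tail_exp) \<le> u powr (- tail_exp)"
      using \<open>u \<le> d n\<close> \<open>tail_start \<le> u\<close> A2(3) A2(2) by (intro powr_mono2') auto
    then have "p'_min n \<le> tail_const * u powr (- tail_exp)"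
      using A2(1) by (simp add: p'_min_def)
    also have "\<dots> \<le> p' u" by (rule A2(4)) fact
    finally show "p'_min n \<le> p' u" .
  qed (use st dp rho in auto)
  then show ?thesis by (simp add: right_diff_distrib)
qed

definition knots1 :: "nat \<Rightarrow> real set" where
  "knots1 n = {t \<in> {0..\<rho>}. \<exists>j::int. 0 \<le> real_of_int j \<and> of_int j \<le> real n * mass p (d n * \<rho>) \<and>
     mass p (d n * t) = of_int j / real n}"

definition knots2 :: "nat \<Rightarrow> real set" where
  "knots2 n = {t \<in> {\<rho><..1}. \<exists>j::int. real n * mass p' (d n * \<rho>) < of_int j \<and>
     of_int j \<le> real n * mass p' (d n) \<and> mass p' (d n * t) = of_int j / real n}"

lemma T_eq: "large n \<Longrightarrow> T n = knots1 n \<union> knots2 n \<union> {1}"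
  using mass_dilated[of \<gamma> n] large_pos(2)[of n]
  by (simp add: composite_knots_def knots1_def knots2_def)

lemma inj_on_mass_p: "large n \<Longrightarrow> inj_on (\<lambda>t. mass p (d n * t)) {0..\<rho>}"
proof (rule linorder_inj_onI')
  fix s t assume n: "large n" and st: "s \<in> {0..\<rho>}" "t \<in> {0..\<rho>}" "s < t"
  have "mass p (d n * s) < mass p (d n * t)"
    using st large_pos(2)[OF n] by (intro mass_p_strict) auto
  then show "mass p (d n * s) \<noteq> mass p (d n * t)" by simp
qed

lemma inj_on_mass_p_tail: "large n \<Longrightarrow> inj_on (\<lambda>t. mass p' (d n * t)) {\<rho><..1}"
proof (rule linorder_inj_onI')
  fix s t assume n: "large n" and st: "s \<in> {\<rho><..1}" "t \<in> {\<rho><..1}" "s < t"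
  have "0 < p'_min n * (d n * (t - s))"
    using st large_pos[OF n] by simp
  also have "\<dots> \<le> mass p' (d n * t) - mass p' (d n * s)"
    using st by (intro mass_p'_lower n) auto
  finally show "mass p' (d n * s) \<noteq> mass p' (d n * t)" by simp
qed

lemma mass_p_bounds: "u \<ge> 0 \<Longrightarrow> 0 \<le> mass p u \<and> mass p u \<le> 1"
  using mass_mono[OF p, of 0 u] mass_le_1[OF p, of u] by simp

lemma mass_p'_bounds: "u \<ge> 0 \<Longrightarrow> 0 \<le> mass p' u \<and> mass p' u \<le> 1"
  using mass_mono[OF p', of 0 u] mass_le_1[OF p', of u] by simp

lemma knots1_card:
  assumes n: "large n"
  shows "finite (knots1 n)" "int (card (knots1 n)) = \<lfloor>real n * mass p (d n * \<rho>)\<rfloor> + 1"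
proof -
  let ?y = "real n * mass p (d n * \<rho>)"
  note pos = large_pos[OF n]
  have y: "?y \<ge> 0" using mass_p_bounds[of "d n * \<rho>"] pos rho by simp
  have sub: "knots1 n \<subseteq> {t \<in> {0..\<rho>}. \<exists>j::int. 0 \<le> real_of_int j \<and> j \<le> ?y \<and> mass p (d n * t) = of_int j / real n}"
    by (auto simp: knots1_def)
  note * = strict_mono_level_set_card[OF inj_on_mass_p[OF n] pos(6) sub]
  show fin: "finite (knots1 n)" by (rule *(1))
  have "int (card (knots1 n)) \<le> \<lfloor>?y\<rfloor> + 1"
    using *(2) y by simp
  moreover have "\<lfloor>?y\<rfloor> + 1 \<le> int (card (knots1 n))"
  proof -
    have "of_int ` {0..\<lfloor>?y\<rfloor>} \<subseteq> (\<lambda>t. real n * mass p (d n * t)) ` knots1 n"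
    proof
      fix z :: real assume "z \<in> of_int ` {0..\<lfloor>?y\<rfloor>}"
      then obtain j where j: "z = of_int j" "0 \<le> j" "j \<le> \<lfloor>?y\<rfloor>" by auto
      then have jy: "of_int j \<le> ?y" by (simp add: le_floor_iff)
      then have "of_int j / real n \<le> mass p (d n * \<rho>)"
        using pos by (simp add: field_simps)
      then obtain u where u: "u \<in> {0..d n * \<rho>}" "mass p u = of_int j / real n"
        using mass_attains[OF p, of "of_int j / real n" "d n * \<rho>"] j pos rho by auto
      then have "u / d n \<in> knots1 n"
        using pos jy j unfolding knots1_def by (auto simp: field_simps intro!: exI[of _ j])
      moreover have "real n * mass p (d n * (u / d n)) = z"
        using pos u j by simp
      ultimately show "z \<in> (\<lambda>t. real n * mass p (d n * t)) ` knots1 n" by (metis image_eqI)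
    qed
    then have "card (of_int ` {0..\<lfloor>?y\<rfloor>} :: real set) \<le> card ((\<lambda>t. real n * mass p (d n * t)) ` knots1 n)"
      by (intro card_mono finite_imageI fin)
    also have "\<dots> \<le> card (knots1 n)" by (rule card_image_le[OF fin])
    also have "card (of_int ` {0..\<lfloor>?y\<rfloor>} :: real set) = card {0..\<lfloor>?y\<rfloor>}"
      by (rule card_image) (simp add: inj_on_def)
    finally show ?thesis using y by simp
  qed
  ultimately show "int (card (knots1 n)) = \<lfloor>?y\<rfloor> + 1" by simp
qed

lemma knots2_card:
  assumes n: "large n"
  shows "finite (knots2 n)"
    "real (card (knots2 n)) \<le> real n * (mass p' (d n) - mass p' (d n * \<rho>)) + 1"
proof -
  let ?x = "real n * mass p' (d n * \<rho>)" and ?y = "real n * mass p' (d n)"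
  note pos = large_pos[OF n]
  have sub: "knots2 n \<subseteq> {t \<in> {\<rho><..1}. \<exists>j::int. ?x \<le> j \<and> j \<le> ?y \<and> mass p' (d n * t) = of_int j / real n}"
    by (auto simp: knots2_def intro: less_imp_le)
  note * = strict_mono_level_set_card[OF inj_on_mass_p_tail[OF n] pos(6) sub]
  show fin: "finite (knots2 n)" by (rule *(1))
  have "mass p' (d n * \<rho>) \<le> mass p' (d n)"
    using pos rho by (intro mass_mono p') auto
  then have "?x \<le> ?y" using pos by simp
  have "real (card (knots2 n)) = of_int (int (card (knots2 n)))" by simp
  also have "\<dots> \<le> of_int (max 0 (\<lfloor>?y\<rfloor> - \<lceil>?x\<rceil> + 1))" using *(2) by (simp only: of_int_le_iff)
  also have "\<dots> \<le> ?y - ?x + 1"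
    unfolding of_int_max
    using \<open>?x \<le> ?y\<close> le_of_int_ceiling[of ?x] of_int_floor_le[of ?y]
    unfolding of_int_add of_int_diff of_int_0 of_int_1 by (intro max.boundedI; linarith)
  finally show "real (card (knots2 n)) \<le> real n * (mass p' (d n) - mass p' (d n * \<rho>)) + 1"
    by (simp add: right_diff_distrib)
qed

lemma T_props:
  assumes n: "large n"
  shows finite_T: "finite (T n)" and zero_T: "0 \<in> T n" and one_T: "1 \<in> T n" and T_sub: "T n \<subseteq> {0..1}"
proof -
  show "finite (T n)" using knots1_card[OF n] knots2_card[OF n] by (simp add: T_eq[OF n])
  show "1 \<in> T n" by (simp add: T_eq[OF n])
  have "0 \<in> knots1 n"
    using rho mass_p_bounds[of "d n * \<rho>"] large_pos[OF n] by (auto simp: knots1_def intro!: exI[of _ 0])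
  then show "0 \<in> T n" by (simp add: T_eq[OF n])
  show "T n \<subseteq> {0..1}" using rho by (auto simp: T_eq[OF n] knots1_def knots2_def)
qed

text \<open>Up to bounded errors there are \<open>n * mass p (d n * \<rho>)\<close> knots in \<open>[0, \<rho>]\<close>, which is asymptotically
  \<open>n\<close>, whereas the knots in \<open>(\<rho>, 1]\<close> share the mass that \<open>p'\<close> gives to \<open>(d n * \<rho>, d n]\<close>, which
  tends to 0.\<close>

lemma num_intervals_asymp:
  "(\<lambda>n. real (num_intervals \<gamma> p \<rho> p' n)) \<sim>[at_top] (\<lambda>n. real n)"
proof -
  let ?N = "num_intervals \<gamma> p \<rho> p'"
  have bounds: "real n * mass p (d n * \<rho>) - 1 \<le> real (?N n) \<and>
      real (?N n) \<le> real n * mass p (d n * \<rho>) + real n * (mass p' (d n) - mass p' (d n * \<rho>)) + 2"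
    if n: "large n" for n
  proof -
    note k1 = knots1_card[OF n] and k2 = knots2_card[OF n]
    have y: "real n * mass p (d n * \<rho>) \<ge> 0"
      using mass_p_bounds[of "d n * \<rho>"] large_pos[OF n] rho by simp
    have "card (knots1 n) \<le> card (T n)"
      using finite_T[OF n] by (intro card_mono) (auto simp: T_eq[OF n])
    then have c1: "real (card (knots1 n)) \<le> real (card (T n))" by simp
    have "card (T n) \<le> card (knots1 n) + card (knots2 n) + 1"
      unfolding T_eq[OF n] using card_Un_le[of "knots1 n \<union> knots2 n" "{1}"] card_Un_le[of "knots1 n" "knots2 n"]
      by simp
    then have c2: "real (card (T n)) \<le> real (card (knots1 n)) + real (card (knots2 n)) + 1"
      by linarith
    have "real (card (knots1 n)) = of_int (\<lfloor>real n * mass p (d n * \<rho>)\<rfloor> + 1)"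
      by (simp only: k1(2)[symmetric] of_int_of_nat_eq)
    then have c3: "real (card (knots1 n)) \<le> real n * mass p (d n * \<rho>) + 1"
      "real n * mass p (d n * \<rho>) < real (card (knots1 n))"
      by linarith+
    have "card (T n) \<ge> 1"
      using finite_T[OF n] one_T[OF n] by (metis One_nat_def Suc_leI card_gt_0_iff empty_iff)
    then have "real (?N n) = real (card (T n)) - 1"
      unfolding num_intervals_def by (simp add: of_nat_diff)
    then show ?thesis
      using k2(2) c1 c2 c3 by linarith
  qed
  have lim_p: "(\<lambda>n. mass p (d n * \<rho>)) \<longlonglongrightarrow> 1"
    by (rule filterlim_compose[OF mass_tendsto_1[OF p] d_mult_at_top[OF rho(1)]])
  have lim_p': "(\<lambda>n. mass p' (d n)) \<longlonglongrightarrow> 1" "(\<lambda>n. mass p' (d n * \<rho>)) \<longlonglongrightarrow> 1"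
    by (rule filterlim_compose[OF mass_tendsto_1[OF p'] d_at_top]
             filterlim_compose[OF mass_tendsto_1[OF p'] d_mult_at_top[OF rho(1)]])+
  have "(\<lambda>n. real (?N n) / real n) \<longlonglongrightarrow> 1"
  proof (rule tendsto_sandwich)
    show "\<forall>\<^sub>F n in sequentially. mass p (d n * \<rho>) - 1 / real n \<le> real (?N n) / real n"
      using eventually_large
    proof eventually_elim
      case (elim n)
      have "mass p (d n * \<rho>) - 1 / real n = (real n * mass p (d n * \<rho>) - 1) / real n"
        using large_pos(1)[OF elim] by (simp add: field_simps)
      also have "\<dots> \<le> real (?N n) / real n"
        using bounds[OF elim] by (intro divide_right_mono) auto
      finally show ?case .
    qed
    show "\<forall>\<^sub>F n in sequentially. real (?N n) / real n \<le>
        mass p (d n * \<rho>) + (mass p' (d n) - mass p' (d n * \<rho>)) + 2 / real n"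
      using eventually_large
    proof eventually_elim
      case (elim n)
      have "real (?N n) / real n \<le> (real n * mass p (d n * \<rho>) + real n * (mass p' (d n) - mass p' (d n * \<rho>)) + 2) / real n"
        using bounds[OF elim] by (intro divide_right_mono) auto
      also have "\<dots> = mass p (d n * \<rho>) + (mass p' (d n) - mass p' (d n * \<rho>)) + 2 / real n"
        using large_pos(1)[OF elim] by (simp add: add_divide_distrib)
      finally show ?case .
    qed
    have "(\<lambda>n. mass p (d n * \<rho>) - 1 / real n) \<longlonglongrightarrow> 1 - 0"
      by (intro tendsto_diff lim_p) real_asymp
    then show "(\<lambda>n. mass p (d n * \<rho>) - 1 / real n) \<longlonglongrightarrow> 1" by simp
    have "(\<lambda>n. mass p (d n * \<rho>) + (mass p' (d n) - mass p' (d n * \<rho>)) + 2 / real n) \<longlonglongrightarrow> 1 + (1 - 1) + 0"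
      by (intro tendsto_add tendsto_diff lim_p lim_p') real_asymp
    then show "(\<lambda>n. mass p (d n * \<rho>) + (mass p' (d n) - mass p' (d n * \<rho>)) + 2 / real n) \<longlonglongrightarrow> 1" by simp
  qed
  then show ?thesis
    by (rule asymp_equivI')
qed

lemma tau_mem:
  assumes "large n" "0 \<le> t"
  shows "\<tau> n t \<in> T n" "\<tau> n t \<le> t" "0 \<le> \<tau> n t"
  using prev_knot_mem[OF finite_T zero_T] prev_knot_le[OF finite_T zero_T] prev_knot_ge[OF finite_T zero_T] assms
  by auto

lemma tau_ge: "large n \<Longrightarrow> k \<in> T n \<Longrightarrow> k \<le> t \<Longrightarrow> k \<le> \<tau> n t"
  by (rule prev_knot_ge[OF finite_T])

text \<open>At the last knot before \<open>t\<close> the value of \<open>n * mass p\<close> is the integer part of its value at \<open>t\<close>, so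
  the mass gained since that knot is a fractional part.\<close>

lemma frac_mass_eq:
  assumes n: "large n" and t: "0 \<le> t" "t \<le> \<rho>"
  shows "frac (real n * mass p (d n * t)) = real n * (mass p (d n * t) - mass p (d n * \<tau> n t))"
proof -
  note pos = large_pos[OF n] and tau = tau_mem[OF n t(1)]
  define j where "j = \<lfloor>real n * mass p (d n * t)\<rfloor>"
  have m: "0 \<le> mass p (d n * t)" using mass_p_bounds[of "d n * t"] pos t by simp
  have j: "0 \<le> j" "of_int j \<le> real n * mass p (d n * t)" using m by (simp_all add: j_def)
  have le: "real n * mass p (d n * t) \<le> real n * mass p (d n * \<rho>)"
    using pos t by (intro mult_left_mono mass_mono p) auto
  have "of_int j / real n \<le> mass p (d n * t)" using j pos by (simp add: field_simps)
  then obtain u where u: "u \<in> {0..d n * t}" "mass p u = of_int j / real n"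
    using mass_attains[OF p, of "of_int j / real n" "d n * t"] j pos t by auto
  have ut: "u / d n \<le> t" "0 \<le> u / d n" using u pos by (auto simp: field_simps)
  have jle: "of_int j \<le> real n * mass p (d n * \<rho>)" using j(2) le by linarith
  have "u / d n \<in> knots1 n"
    using pos u j(1) jle ut t unfolding knots1_def by (auto intro!: exI[of _ j])
  then have k: "u / d n \<in> T n" by (simp add: T_eq[OF n])
  have "mass p (d n * (u / d n)) \<le> mass p (d n * \<tau> n t)"
    using tau_ge[OF n k ut(1)] ut u pos by (intro mass_mono p mult_left_mono) auto
  then have ge: "of_int j \<le> real n * mass p (d n * \<tau> n t)"
    using u pos by (simp add: field_simps)
  have "\<tau> n t \<in> knots1 n"
    using tau t rho by (auto simp: T_eq[OF n] knots2_def)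
  then obtain i :: int where i: "mass p (d n * \<tau> n t) = of_int i / real n"
    by (auto simp: knots1_def)
  then have i': "real n * mass p (d n * \<tau> n t) = of_int i" using pos by simp
  have "of_int i \<le> real n * mass p (d n * t)"
    unfolding i'[symmetric] using tau pos by (intro mult_left_mono mass_mono p) auto
  then have "i \<le> j" by (simp add: j_def le_floor_iff)
  moreover have "j \<le> i" using ge i' by simp
  ultimately have "i = j" by simp
  then show ?thesis using i' by (simp add: frac_def j_def right_diff_distrib)
qed

lemma step_le_density:
  assumes n: "large n" and t: "0 \<le> t" "t \<le> \<rho>"
  shows "t - \<tau> n t \<le> 1 / (real n * d n * p (d n * t))"
proof -
  note pos = large_pos[OF n] and tau = tau_mem[OF n t(1)]
  have pp: "p (d n * t) > 0" using pos t by (intro p_pos) auto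
  have "real n * (p (d n * t) * (d n * t - d n * \<tau> n t)) \<le> real n * (mass p (d n * t) - mass p (d n * \<tau> n t))"
    using tau pos by (intro mult_left_mono mass_p_lower) auto
  also have "\<dots> = frac (real n * mass p (d n * t))" using frac_mass_eq[OF assms] by simp
  also have "\<dots> < 1" by (rule frac_lt_1)
  finally show ?thesis using pp pos by (simp add: field_simps)
qed

lemma step_le_rho:
  assumes n: "large n" and t: "0 \<le> t" "t \<le> \<rho>"
  shows "t - \<tau> n t \<le> 1 / (real n * d n * p (d n * \<rho>))"
proof -
  note pos = large_pos[OF n]
  have "p (d n * \<rho>) \<le> p (d n * t)" "p (d n * \<rho>) > 0"
    using pos t rho by (auto intro!: p_antimono p_pos mult_left_mono)
  then have "1 / (real n * d n * p (d n * t)) \<le> 1 / (real n * d n * p (d n * \<rho>))"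
    using pos by (intro divide_left_mono mult_left_mono) auto
  with step_le_density[OF assms] show ?thesis by simp
qed

text \<open>In the second alternative the mass of \<open>p'\<close> between \<open>\<rho>\<close> and \<open>t\<close> is too small to produce a knot. The
  last knot may then belong to the left part of the design, and the step is bounded by the sum of
  a piece on either side of \<open>\<rho>\<close>.\<close>

lemma step_beyond_rho:
  assumes n: "large n" and t: "\<rho> \<le> t" "t \<le> 1"
  shows "t - \<tau> n t \<le> 1 / (real n * d n * p'_min n) \<or>
    (t - \<rho> \<le> 1 / (real n * d n * p'_min n) \<and>
     t - \<tau> n t \<le> 1 / (real n * d n * p'_min n) + 1 / (real n * d n * p (d n * \<rho>)))"
proof -
  note pos = large_pos[OF n]
  define j where "j = \<lfloor>real n * mass p' (d n * t)\<rfloor>"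
  have bound: "t - s \<le> 1 / (real n * d n * p'_min n)"
    if s: "\<rho> \<le> s" "s \<le> t" and lt: "real n * mass p' (d n * t) - real n * mass p' (d n * s) \<le> 1" for s
  proof -
    have "real n * (p'_min n * (d n * (t - s))) \<le> real n * (mass p' (d n * t) - mass p' (d n * s))"
      using s t pos by (intro mult_left_mono mass_p'_lower n) auto
    also have "\<dots> \<le> 1" using lt by (simp add: right_diff_distrib)
    finally show ?thesis using pos by (simp add: field_simps)
  qed
  have jt: "of_int j \<le> real n * mass p' (d n * t)" "real n * mass p' (d n * t) < of_int j + 1"
    by (auto simp: j_def)
  show ?thesis
  proof (cases "real n * mass p' (d n * \<rho>) < of_int j")
    case True
    have dr: "0 \<le> mass p' (d n * \<rho>)" using mass_p'_bounds[of "d n * \<rho>"] pos rho by simp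
    have "0 \<le> real n * mass p' (d n * \<rho>)" using dr by simp
    then have "0 \<le> real_of_int j" using True by linarith
    then have j0: "0 \<le> of_int j / real n" by simp
    have "of_int j / real n \<le> mass p' (d n * t)" using jt pos by (simp add: field_simps)
    then obtain u where u: "u \<in> {0..d n * t}" "mass p' u = of_int j / real n"
      using mass_attains[OF p', of "of_int j / real n" "d n * t"] j0 pos t rho by auto
    have uj: "real n * mass p' u = of_int j" using u pos by simp
    have "\<rho> < u / d n"
    proof (rule ccontr)
      assume "\<not> \<rho> < u / d n"
      then have "u \<le> d n * \<rho>" using pos by (simp add: field_simps)
      then have "mass p' u \<le> mass p' (d n * \<rho>)" using u by (intro mass_mono p') auto
      then have "real n * mass p' u \<le> real n * mass p' (d n * \<rho>)" using pos by simp
      then show False using True uj by simp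
    qed
    moreover have "u / d n \<le> t" using u pos by (auto simp: field_simps)
    moreover have "of_int j \<le> real n * mass p' (d n)"
    proof -
      have "mass p' (d n * t) \<le> mass p' (d n)"
        using t rho pos by (intro mass_mono p') (auto simp: mult_left_le)
      then have "real n * mass p' (d n * t) \<le> real n * mass p' (d n)" using pos by simp
      with jt show ?thesis by simp
    qed
    moreover have "u \<le> d n"
    proof -
      have "d n * t \<le> d n * 1" using t pos by (intro mult_left_mono) auto
      with u show ?thesis by simp
    qed
    ultimately have "u / d n \<in> knots2 n"
      using True t u pos unfolding knots2_def by (auto intro!: exI[of _ j])
    then have "u / d n \<le> \<tau> n t"
      using \<open>u / d n \<le> t\<close> by (intro tau_ge n) (simp_all add: T_eq[OF n])
    moreover have "t - u / d n \<le> 1 / (real n * d n * p'_min n)"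
      by (rule bound) (use \<open>\<rho> < u / d n\<close> \<open>u / d n \<le> t\<close> jt uj pos in auto)
    ultimately show ?thesis by simp
  next
    case False
    have a: "t - \<rho> \<le> 1 / (real n * d n * p'_min n)"
      by (rule bound) (use False jt t in auto)
    have "\<rho> - \<tau> n \<rho> \<le> 1 / (real n * d n * p (d n * \<rho>))"
      by (rule step_le_rho[OF n]) (use rho in auto)
    moreover have "\<tau> n \<rho> \<le> \<tau> n t"
      using tau_mem[OF n, of \<rho>] rho t by (intro tau_ge n) auto
    ultimately show ?thesis using a by simp
  qed
qed

end

section \<open>Bounds on the mean-square error\<close>

text \<open>Absorbs every polynomial in the dilation factor, as that factor is a power of the logarithm.\<close>

lemma powr_ln_tendsto_0:
  assumes "e > (0::real)"
  shows "(\<lambda>n. real n powr (- e) * ln (real n) powr k) \<longlonglongrightarrow> 0"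
proof -
  have "((\<lambda>x::real. x powr (- e) * ln x powr k) \<longlongrightarrow> 0) at_top"
    using assms by real_asymp
  from filterlim_compose[OF this filterlim_real_sequentially] show ?thesis .
qed

context composite_dilated_design
begin

lemma alpha_pos: "t \<in> {0..1} \<Longrightarrow> 0 < \<alpha> t" and alpha_le_2: "t \<in> {0..1} \<Longrightarrow> \<alpha> t \<le> 2"
  and c_pos: "t \<in> {0..1} \<Longrightarrow> 0 < c t"
  and cont_alpha: "continuous_on {0..1} \<alpha>" and cont_c: "continuous_on {0..1} c"
  using X by (auto simp: locally_stationary_def)

lemma alpha_ge: "t \<in> {0..1} \<Longrightarrow> \<alpha> 0 \<le> \<alpha> t"
  using C1 by (cases "t = 0") (auto intro: less_imp_le)

definition err :: "nat \<Rightarrow> real \<Rightarrow> real" where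
  "err n t = msq_increment M X t (\<tau> n t)"

lemma err_nonneg: "0 \<le> err n t"
  by (simp add: err_def msq_increment_nonneg)

lemma approx_error_eq:
  assumes n: "large n" and t: "t \<in> {0..1}"
  shows "(LINT \<omega>|M. (X t \<omega> - composite_approx X \<gamma> p \<rho> p' n t \<omega>)\<^sup>2) = err n t"
proof -
  have "composite_approx X \<gamma> p \<rho> p' n t = X (\<tau> n t)"
    unfolding composite_approx_def composite_design_def[abs_def] num_intervals_def
    by (rule piecewise_const_approx_eq_prev_knot[where a=0 and e=1])
       (use t T_sub[OF n] in \<open>auto simp: finite_T[OF n] zero_T[OF n] one_T[OF n]\<close>)
  then show ?thesis by (simp add: err_def msq_increment_def)
qed

definition \<theta> :: real where "\<theta> = q2 * \<rho> powr \<gamma>"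

lemma theta: "0 < \<theta>" "\<theta> < 1"
  using A3(2) A1(3) rho by (auto simp: \<theta>_def)

text \<open>A bound on steps inside \<open>(\<rho>, 1]\<close>, coming from the polynomial lower bound on \<open>p'\<close>; \<open>step1\<close> is the
  bound on \<open>[0, \<rho>]\<close>, where the worst case is at \<open>\<rho>\<close> because \<open>p\<close> decreases.\<close>

definition step2 :: "nat \<Rightarrow> real" where "step2 n = d n powr tail_exp / (tail_const * real n)"
definition step1 :: "nat \<Rightarrow> real" where "step1 n = real n powr (\<theta> - 1) / q1"

lemma p_dilated_lower:
  assumes n: "large n" and t: "0 \<le> t"
  shows "q1 * real n powr (- q2 * t powr \<gamma>) \<le> p (d n * t)"
  using p_lower[of "d n * t"] exp_dilated_eq_powr[of n t "- q2"] large_pos[OF n] t by simp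

lemma step1_bound:
  assumes n: "large n"
  shows "1 / (real n * d n * p (d n * \<rho>)) \<le> step1 n"
proof -
  note pos = large_pos[OF n]
  have l: "q1 * real n powr (- \<theta>) \<le> p (d n * \<rho>)"
    using p_dilated_lower[OF n, of \<rho>] rho by (simp add: \<theta>_def)
  have q: "0 < q1 * real n powr (- \<theta>)" using A1 pos by simp
  have "real n * 1 * (q1 * real n powr (- \<theta>)) \<le> real n * d n * p (d n * \<rho>)"
    using l q pos by (intro mult_mono) auto
  then have "1 / (real n * d n * p (d n * \<rho>)) \<le> 1 / (real n * 1 * (q1 * real n powr (- \<theta>)))"
    using q pos less_le_trans[OF q l] A1(2) by (intro divide_left_mono mult_pos_pos) auto
  also have "\<dots> = step1 n"
    using pos A1(2) by (simp add: step1_def powr_diff powr_minus field_simps)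
  finally show ?thesis .
qed

lemma step2_bound:
  assumes n: "large n"
  shows "1 / (real n * d n * p'_min n) \<le> step2 n"
proof -
  note pos = large_pos[OF n]
  have "real n * 1 * p'_min n \<le> real n * d n * p'_min n"
    using pos by (intro mult_mono) auto
  then have "1 / (real n * d n * p'_min n) \<le> 1 / (real n * 1 * p'_min n)"
    using pos by (intro divide_left_mono mult_pos_pos) auto
  also have "\<dots> = step2 n"
    using pos A2(1) by (simp add: step2_def p'_min_def powr_minus field_simps)
  finally show ?thesis .
qed

lemma step_nonneg: "0 \<le> step1 n" "0 \<le> step2 n"
  using A1(2) A2(1) by (auto simp: step1_def step2_def)

lemma step_beyond_rho':
  assumes n: "large n" and t: "\<rho> \<le> t" "t \<le> 1"
  shows "t - \<tau> n t \<le> step2 n \<or> (t - \<rho> \<le> step2 n \<and> t - \<tau> n t \<le> step2 n + step1 n)"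
  using step_beyond_rho[OF assms] step1_bound[OF n] step2_bound[OF n] by linarith

lemma step_le:
  assumes n: "large n" and t: "0 \<le> t" "t \<le> 1"
  shows "t - \<tau> n t \<le> step2 n + step1 n"
proof (cases "t \<le> \<rho>")
  case True
  then show ?thesis using step_le_rho[OF n t(1)] step1_bound[OF n] step_nonneg[of n] by linarith
next
  case False
  then show ?thesis using step_beyond_rho'[OF n, of t] t step_nonneg[of n] by linarith
qed

lemma d_powr_eq: "d n powr k = ln (real n) powr (k / \<gamma>)"
  by (simp add: dilation_factor_def powr_powr)

lemma step2_tendsto: "step2 \<longlonglongrightarrow> 0"
proof -
  have "(\<lambda>n. (real n powr (- 1) * ln (real n) powr (tail_exp / \<gamma>)) * (1 / tail_const)) \<longlonglongrightarrow> 0 * (1 / tail_const)"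
    by (intro tendsto_mult powr_ln_tendsto_0 tendsto_const) simp
  then show ?thesis
    by (simp add: step2_def[abs_def] d_powr_eq powr_minus_divide mult.commute)
qed

lemma step1_tendsto: "step1 \<longlonglongrightarrow> 0"
proof -
  have "(\<lambda>n. real n powr (\<theta> - 1) * (1 / q1)) \<longlonglongrightarrow> 0 * (1 / q1)"
    using theta by (intro tendsto_mult tendsto_neg_powr filterlim_real_sequentially tendsto_const) simp
  then show ?thesis
    by (simp add: step1_def[abs_def])
qed

lemma mesh_tendsto_0:
  assumes "\<epsilon> > 0"
  shows "\<forall>\<^sub>F n in sequentially. \<forall>t\<in>{0..1}. t - \<tau> n t < \<epsilon>"
proof -
  have "(\<lambda>n. step2 n + step1 n) \<longlonglongrightarrow> 0 + 0"
    by (intro tendsto_add step1_tendsto step2_tendsto)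
  then have "\<forall>\<^sub>F n in sequentially. step2 n + step1 n < \<epsilon>"
    by (intro order_tendstoD(2)) (use assms in auto)
  then show ?thesis using eventually_large
    by eventually_elim (use step_le in \<open>fastforce intro: le_less_trans\<close>)
qed

text \<open>Local stationarity with base point \<open>t\<close> and negative increment \<open>\<tau> n t - t\<close>.\<close>

lemma err_local:
  assumes "\<epsilon> > 0"
  shows "\<forall>\<^sub>F n in sequentially. \<forall>t\<in>{0..1}.
    \<bar>err n t - c t * (t - \<tau> n t) powr \<alpha> t\<bar> \<le> \<epsilon> * (t - \<tau> n t) powr \<alpha> t"
proof -
  from locally_stationary_uniform[OF X assms] obtain \<delta> where "\<delta> > 0" and
    \<delta>: "\<And>s t. s \<in> {0..1} \<Longrightarrow> t \<in> {0..1} \<Longrightarrow> \<bar>s - t\<bar> < \<delta> \<Longrightarrow>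
      \<bar>msq_increment M X s t - c t * \<bar>s - t\<bar> powr \<alpha> t\<bar> \<le> \<epsilon> * \<bar>s - t\<bar> powr \<alpha> t"
    by blast
  from mesh_tendsto_0[OF \<open>\<delta> > 0\<close>] eventually_large show ?thesis
  proof eventually_elim
    case (elim n)
    show ?case
    proof
      fix t :: real assume t: "t \<in> {0..1}"
      then have tau: "\<tau> n t \<in> {0..1}" "\<tau> n t \<le> t" using tau_mem[OF elim(2), of t] by auto
      have "\<bar>\<tau> n t - t\<bar> = t - \<tau> n t" using tau by simp
      moreover have "msq_increment M X (\<tau> n t) t = err n t"
        by (simp add: err_def msq_increment_def power2_commute)
      ultimately show "\<bar>err n t - c t * (t - \<tau> n t) powr \<alpha> t\<bar> \<le> \<epsilon> * (t - \<tau> n t) powr \<alpha> t"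
        using \<delta>[OF tau(1) t] elim t by auto
    qed
  qed
qed

lemma err_upper: "\<exists>C>0. \<forall>\<^sub>F n in sequentially. \<forall>t\<in>{0..1}. err n t \<le> C * (t - \<tau> n t) powr \<alpha> t"
proof -
  obtain z where z: "z \<in> {0..1}" "\<And>t. t \<in> {0..1} \<Longrightarrow> c t \<le> c z"
    using continuous_attains_sup[OF _ _ cont_c] by auto
  have "\<forall>\<^sub>F n in sequentially. \<forall>t\<in>{0..1}. err n t \<le> (c z + 1) * (t - \<tau> n t) powr \<alpha> t"
    using err_local[of 1, simplified]
  proof eventually_elim
    case (elim n)
    show ?case
    proof
      fix t :: real assume t: "t \<in> {0..1}"
      have "err n t \<le> (c t + 1) * (t - \<tau> n t) powr \<alpha> t"
        using elim t by (auto simp: abs_le_iff algebra_simps)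
      also have "\<dots> \<le> (c z + 1) * (t - \<tau> n t) powr \<alpha> t"
        using z(2)[OF t] by (intro mult_right_mono) auto
      finally show "err n t \<le> (c z + 1) * (t - \<tau> n t) powr \<alpha> t" .
    qed
  qed
  then show ?thesis using c_pos[OF z(1)] by (intro exI[of _ "c z + 1"]) auto
qed

definition \<kappa> :: real where
  "\<kappa> = (INF t\<in>{0<..\<rho>}. (\<alpha> t - \<alpha> 0) / t powr \<gamma>) - q2 * (SUP t\<in>{0..\<rho>}. \<alpha> t)"

lemma kappa_pos: "\<kappa> > 0" using A3(1) by (simp add: \<kappa>_def)

text \<open>The form in which the first part of (A3) is used: \<open>q2 * \<alpha> t * t powr \<gamma>\<close> is what a density as
  small as its lower bound costs, \<open>\<alpha> t - \<alpha> 0\<close> is what the smoother process gains.\<close>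

lemma alpha_growth:
  assumes t: "0 \<le> t" "t \<le> \<rho>"
  shows "(q2 * \<alpha> t + \<kappa>) * t powr \<gamma> \<le> \<alpha> t - \<alpha> 0"
proof (cases "t = 0")
  case False
  then have t0: "t > 0" using t by simp
  have "bdd_below ((\<lambda>t. (\<alpha> t - \<alpha> 0) / t powr \<gamma>) ` {0<..\<rho>})"
    by (rule bdd_belowI[of _ 0]) (use alpha_ge rho in \<open>auto intro!: divide_nonneg_nonneg\<close>)
  then have "(INF t\<in>{0<..\<rho>}. (\<alpha> t - \<alpha> 0) / t powr \<gamma>) \<le> (\<alpha> t - \<alpha> 0) / t powr \<gamma>"
    using t0 t by (intro cINF_lower) auto
  moreover have "bdd_above (\<alpha> ` {0..\<rho>})"
    by (rule bdd_aboveI[of _ 2]) (use alpha_le_2 rho in auto)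
  then have "\<alpha> t \<le> (SUP t\<in>{0..\<rho>}. \<alpha> t)"
    using t by (intro cSUP_upper) auto
  then have "q2 * \<alpha> t \<le> q2 * (SUP t\<in>{0..\<rho>}. \<alpha> t)" using A1(3) by simp
  ultimately have "q2 * \<alpha> t + \<kappa> \<le> (\<alpha> t - \<alpha> 0) / t powr \<gamma>" by (simp add: \<kappa>_def)
  then show ?thesis using t0 by (simp add: field_simps)
qed simp

text \<open>The spacing at \<open>t\<close> is at most \<open>1 / (n * d * p (d * t))\<close>, and the lower bound on \<open>p\<close> makes this
  \<open>n powr (q2 * t powr \<gamma> - 1)\<close> up to constants. Raised to the power \<open>\<alpha> t\<close> and rescaled, it is
  bounded by \<open>n powr (- \<kappa> * t powr \<gamma>)\<close> according to \<open>alpha_growth\<close>.\<close>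

lemma err_dominated:
  "\<exists>D>0. \<forall>\<^sub>F n in sequentially. \<forall>t\<in>{0..\<rho>}.
     (real n * d n) powr \<alpha> 0 * err n t \<le> D * exp (- \<kappa> * (d n * t) powr \<gamma>)"
proof -
  obtain C where "C > 0" and C: "\<forall>\<^sub>F n in sequentially. \<forall>t\<in>{0..1}. err n t \<le> C * (t - \<tau> n t) powr \<alpha> t"
    using err_upper by blast
  (* bounds q1 powr (- \<alpha> t) uniformly in t, as 0 < \<alpha> t \<le> 2 *)
  define D where "D = max 1 (q1 powr (- 2))"
  have "D > 0" by (simp add: D_def)
  have D: "q1 powr (- a) \<le> D" if "0 \<le> a" "a \<le> 2" for a
  proof (cases "q1 \<ge> 1")
    case True
    then have "q1 powr (- a) \<le> q1 powr 0" using that by (intro powr_mono) auto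
    then show ?thesis using True by (simp add: D_def)
  next
    case False
    then have "q1 powr (- a) \<le> q1 powr (- 2)" using that A1(2) by (intro powr_mono') auto
    then show ?thesis by (simp add: D_def)
  qed
  from C eventually_large have "\<forall>\<^sub>F n in sequentially. \<forall>t\<in>{0..\<rho>}.
     (real n * d n) powr \<alpha> 0 * err n t \<le> (C * D) * exp (- \<kappa> * (d n * t) powr \<gamma>)"
  proof eventually_elim
    case (elim n)
    note pos = large_pos[OF elim(2)]
    show ?case
    proof
      fix t assume t': "t \<in> {0..\<rho>}"
      then have t: "0 \<le> t" "t \<le> \<rho>" and t1: "t \<in> {0..1}" using rho by auto
      let ?s = "t - \<tau> n t" and ?a = "\<alpha> t" and ?nd = "real n * d n"
      have nd: "?nd > 0" "real n \<le> ?nd" "1 \<le> ?nd"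
      proof -
        show "?nd > 0" using pos by simp
        show "real n \<le> ?nd" using pos by simp
        then show "1 \<le> ?nd" using pos by linarith
      qed
      have s0: "0 \<le> ?s" using tau_mem[OF elim(2) t(1)] by simp
      let ?l = "q1 * real n powr (- q2 * t powr \<gamma>)"
      have l: "0 < ?l" "?l \<le> p (d n * t)"
        using p_dilated_lower[OF elim(2) t(1)] A1(2) pos by auto
      have "?s \<le> 1 / (?nd * p (d n * t))"
        using step_le_density[OF elim(2) t] .
      also have "\<dots> \<le> 1 / (?nd * ?l)"
        using l nd less_le_trans[OF l] pos by (intro divide_left_mono mult_left_mono mult_pos_pos[OF nd(1)]) auto
      finally have "?s powr ?a \<le> (1 / (?nd * ?l)) powr ?a"
        using s0 alpha_pos[OF t1] by (intro powr_mono2) auto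
      also have "\<dots> = ?nd powr (- ?a) * (q1 powr (- ?a) * real n powr (q2 * ?a * t powr \<gamma>))"
        using nd l A1(2) pos
        by (simp add: powr_divide powr_mult powr_powr powr_minus field_simps)
      finally have sa: "?s powr ?a \<le> ?nd powr (- ?a) * (q1 powr (- ?a) * real n powr (q2 * ?a * t powr \<gamma>))" .
      have "?nd powr \<alpha> 0 * err n t \<le> ?nd powr \<alpha> 0 * (C * ?s powr ?a)"
        using elim(1) t1 by (intro mult_left_mono) auto
      also have "\<dots> \<le> ?nd powr \<alpha> 0 * (C * (?nd powr (- ?a) * (q1 powr (- ?a) * real n powr (q2 * ?a * t powr \<gamma>))))"
        using sa \<open>C > 0\<close> by (intro mult_left_mono) auto
      also have "\<dots> = C * q1 powr (- ?a) * (?nd powr (- (?a - \<alpha> 0)) * real n powr (q2 * ?a * t powr \<gamma>))"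
        by (simp add: powr_diff powr_minus divide_inverse mult_ac)
      also have "\<dots> \<le> C * D * (real n powr (- (?a - \<alpha> 0)) * real n powr (q2 * ?a * t powr \<gamma>))"
      proof (intro mult_mono mult_right_mono mult_left_mono)
        show "?nd powr (- (?a - \<alpha> 0)) \<le> real n powr (- (?a - \<alpha> 0))"
          using nd pos alpha_ge[OF t1] by (intro powr_mono2') auto
        show "q1 powr (- ?a) \<le> D"
          using D alpha_pos[OF t1] alpha_le_2[OF t1] by simp
      qed (use \<open>C > 0\<close> \<open>D > 0\<close> in auto)
      also have "real n powr (- (?a - \<alpha> 0)) * real n powr (q2 * ?a * t powr \<gamma>) =
          real n powr (q2 * ?a * t powr \<gamma> - (?a - \<alpha> 0))"
        unfolding powr_add[symmetric] by (simp add: algebra_simps)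
      also have "C * D * \<dots> \<le> C * D * real n powr (- \<kappa> * t powr \<gamma>)"
        using alpha_growth[OF t] pos \<open>C > 0\<close> \<open>D > 0\<close>
        by (intro mult_left_mono powr_mono) (auto simp: algebra_simps)
      also have "real n powr (- \<kappa> * t powr \<gamma>) = exp (- \<kappa> * (d n * t) powr \<gamma>)"
        using exp_dilated_eq_powr[of n t "- \<kappa>"] pos t by simp
      finally show "?nd powr \<alpha> 0 * err n t \<le> (C * D) * exp (- \<kappa> * (d n * t) powr \<gamma>)" .
    qed
  qed
  then show ?thesis using \<open>C > 0\<close> \<open>D > 0\<close> by (intro exI[of _ "C * D"]) auto
qed

text \<open>Near \<open>\<rho>\<close> steps may be as long as \<open>n powr (\<theta> - 1)\<close>, so what counts there is \<open>(1 - \<theta>) * \<alpha> t\<close>; it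
  exceeds \<open>\<alpha> 0\<close> at \<open>\<rho>\<close> by \<open>alpha_growth\<close>, and nearby by continuity.\<close>

lemma alpha_margin:
  "\<exists>e>0. \<exists>\<eta>>0. \<forall>t\<in>{\<rho>..1}. \<alpha> 0 + e \<le> \<alpha> t \<and> (t - \<rho> < \<eta> \<longrightarrow> \<alpha> 0 + e \<le> (1 - \<theta>) * \<alpha> t)"
proof -
  have cont: "continuous_on {\<rho>..1} \<alpha>"
    by (rule continuous_on_subset[OF cont_alpha]) (use rho in auto)
  then obtain z where z: "z \<in> {\<rho>..1}" "\<And>t. t \<in> {\<rho>..1} \<Longrightarrow> \<alpha> z \<le> \<alpha> t"
    using continuous_attains_inf[of "{\<rho>..1}" \<alpha>] rho by auto
  have az: "\<alpha> 0 < \<alpha> z" using C1 z(1) rho by auto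
  have "\<kappa> * \<rho> powr \<gamma> > 0" using kappa_pos rho by simp
  moreover have "\<theta> * \<alpha> \<rho> + \<kappa> * \<rho> powr \<gamma> \<le> \<alpha> \<rho> - \<alpha> 0"
    using alpha_growth[of \<rho>] rho by (simp add: \<theta>_def algebra_simps)
  ultimately have ar: "\<alpha> 0 < (1 - \<theta>) * \<alpha> \<rho>" by (simp add: algebra_simps)
  (* half of the margin at \<rho> is left to continuity *)
  define e where "e = min (\<alpha> z - \<alpha> 0) (((1 - \<theta>) * \<alpha> \<rho> - \<alpha> 0) / 2)"
  have "e > 0" using az ar by (simp add: e_def)
  have "\<alpha> 0 + e < (1 - \<theta>) * \<alpha> \<rho>" using ar by (simp add: e_def min_def field_simps)
  moreover have "continuous_on {\<rho>..1} (\<lambda>t. (1 - \<theta>) * \<alpha> t)"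
    by (intro continuous_intros cont)
  then have "((\<lambda>t. (1 - \<theta>) * \<alpha> t) \<longlongrightarrow> (1 - \<theta>) * \<alpha> \<rho>) (at \<rho> within {\<rho>..1})"
    using rho unfolding continuous_on_def by auto
  ultimately have "\<forall>\<^sub>F t in at \<rho> within {\<rho>..1}. \<alpha> 0 + e < (1 - \<theta>) * \<alpha> t"
    by (intro order_tendstoD(1))
  then obtain \<eta> where "\<eta> > 0" and \<eta>: "\<And>t. t \<in> {\<rho>..1} \<Longrightarrow> t \<noteq> \<rho> \<Longrightarrow> dist t \<rho> < \<eta> \<Longrightarrow> \<alpha> 0 + e < (1 - \<theta>) * \<alpha> t"
    by (auto simp: eventually_at)
  have "\<alpha> 0 + e \<le> \<alpha> t \<and> (t - \<rho> < \<eta> \<longrightarrow> \<alpha> 0 + e \<le> (1 - \<theta>) * \<alpha> t)" if t: "t \<in> {\<rho>..1}" for t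
  proof (intro conjI impI)
    have "e \<le> \<alpha> z - \<alpha> 0" by (simp add: e_def)
    then show "\<alpha> 0 + e \<le> \<alpha> t" using z(2)[OF t] by linarith
    assume "t - \<rho> < \<eta>"
    then show "\<alpha> 0 + e \<le> (1 - \<theta>) * \<alpha> t"
      using \<eta>[of t] t \<open>\<alpha> 0 + e < (1 - \<theta>) * \<alpha> \<rho>\<close> by (cases "t = \<rho>") (auto simp: dist_real_def)
  qed
  with \<open>e > 0\<close> \<open>\<eta> > 0\<close> show ?thesis by blast
qed

text \<open>In both cases of \<open>step_beyond_rho'\<close> the error is at most \<open>n powr (- \<alpha> 0 - e)\<close> times a power of
  \<open>ln n\<close>. The second case occurs only close to \<open>\<rho>\<close>, where \<open>alpha_margin\<close> compensates for the
  longer step.\<close>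

lemma tail_negligible:
  "\<exists>W. W \<longlonglongrightarrow> 0 \<and> (\<forall>\<^sub>F n in sequentially. \<forall>t\<in>{\<rho>..1}. (real n * d n) powr \<alpha> 0 * d n * err n t \<le> W n)"
proof -
  obtain C where "C > 0" and C: "\<forall>\<^sub>F n in sequentially. \<forall>t\<in>{0..1}. err n t \<le> C * (t - \<tau> n t) powr \<alpha> t"
    using err_upper by blast
  obtain e \<eta> where e: "e > 0" "\<eta> > 0"
    and far: "\<And>t. t \<in> {\<rho>..1} \<Longrightarrow> \<alpha> 0 + e \<le> \<alpha> t"
    and near: "\<And>t. t \<in> {\<rho>..1} \<Longrightarrow> t - \<rho> < \<eta> \<Longrightarrow> \<alpha> 0 + e \<le> (1 - \<theta>) * \<alpha> t"
    using alpha_margin by blast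
  define B where "B = 1 + 1 / tail_const + 1 / q1"
  have B: "B \<ge> 1" using A2(1) A1(2) by (simp add: B_def)
  define W where "W n = C * B powr 2 * (real n powr (- e) * ln (real n) powr ((\<alpha> 0 + 1 + 2 * tail_exp) / \<gamma>))" for n
  have "W \<longlonglongrightarrow> C * B powr 2 * 0"
    unfolding W_def by (intro tendsto_mult_left powr_ln_tendsto_0 e)
  moreover have "\<forall>\<^sub>F n in sequentially. step2 n < \<eta>"
    by (rule order_tendstoD(2)[OF step2_tendsto e(2)])
  with C eventually_large have "\<forall>\<^sub>F n in sequentially. \<forall>t\<in>{\<rho>..1}. (real n * d n) powr \<alpha> 0 * d n * err n t \<le> W n"
  proof eventually_elim
    case (elim n)
    note pos = large_pos[OF elim(2)]
    have n1: "real n \<ge> 1" using pos by simp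
    have dC: "d n powr tail_exp \<ge> 1" using pos A2(2) by (simp add: ge_one_powr_ge_zero)
    let ?F = "B * d n powr tail_exp"
    have F1: "?F \<ge> 1" using mult_mono[OF B dC] B by simp
    have s2: "step2 n \<le> ?F * real n powr (- 1)"
    proof -
      have "step2 n = (1 / tail_const) * (d n powr tail_exp * real n powr (- 1))"
        using pos by (simp add: step2_def powr_minus_divide)
      also have "\<dots> \<le> B * (d n powr tail_exp * real n powr (- 1))"
        using A1(2) by (intro mult_right_mono) (auto simp: B_def)
      finally show ?thesis by (simp add: mult_ac)
    qed
    have s12: "step2 n + step1 n \<le> ?F * real n powr (- (1 - \<theta>))"
    proof -
      have nn: "real n powr (- 1) \<le> real n powr (- (1 - \<theta>))"
        using n1 theta by (intro powr_mono) auto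
      have "step2 n = (1 / tail_const) * (d n powr tail_exp * real n powr (- 1))"
        using pos by (simp add: step2_def powr_minus_divide)
      also have "\<dots> \<le> (1 / tail_const) * (d n powr tail_exp * real n powr (- (1 - \<theta>)))"
        using nn A2(1) by (intro mult_left_mono) auto
      finally have a: "step2 n \<le> (1 / tail_const) * (d n powr tail_exp * real n powr (- (1 - \<theta>)))" .
      have "step1 n = (1 / q1) * (1 * real n powr (- (1 - \<theta>)))"
        by (simp add: step1_def)
      also have "\<dots> \<le> (1 / q1) * (d n powr tail_exp * real n powr (- (1 - \<theta>)))"
        using dC A1(2) by (intro mult_left_mono mult_right_mono) auto
      finally have "step2 n + step1 n \<le> (1 / tail_const + 1 / q1) * (d n powr tail_exp * real n powr (- (1 - \<theta>)))"
        using a by (simp add: distrib_right)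
      also have "\<dots> \<le> B * (d n powr tail_exp * real n powr (- (1 - \<theta>)))"
        by (intro mult_right_mono) (auto simp: B_def)
      finally show ?thesis by (simp add: mult_ac)
    qed
    have key: "s powr \<alpha> t \<le> ?F powr 2 * real n powr (- (\<alpha> 0 + e))"
      if t: "t \<in> {\<rho>..1}" and s: "0 \<le> s" "s \<le> ?F * real n powr (- m)" and m: "\<alpha> 0 + e \<le> m * \<alpha> t" for s t m
    proof -
      have t1: "t \<in> {0..1}" using t rho by auto
      have "s powr \<alpha> t \<le> (?F * real n powr (- m)) powr \<alpha> t"
        using s alpha_pos[OF t1] by (intro powr_mono2) auto
      also have "\<dots> = ?F powr \<alpha> t * real n powr (- (m * \<alpha> t))"
        by (simp add: powr_mult powr_powr)
      also have "\<dots> \<le> ?F powr 2 * real n powr (- (\<alpha> 0 + e))"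
        using F1 alpha_le_2[OF t1] n1 m by (intro mult_mono powr_mono) auto
      finally show ?thesis .
    qed
    show ?case
    proof
      fix t assume t: "t \<in> {\<rho>..1}"
      then have t1: "t \<in> {0..1}" "0 \<le> t" "\<rho> \<le> t" "t \<le> 1" using rho by auto
      let ?s = "t - \<tau> n t"
      have s0: "0 \<le> ?s" using tau_mem[OF elim(2) t1(2)] by simp
      have "?s powr \<alpha> t \<le> ?F powr 2 * real n powr (- (\<alpha> 0 + e))"
        using step_beyond_rho'[OF elim(2) t1(3,4)]
      proof (elim disjE conjE)
        assume "?s \<le> step2 n"
        then show ?thesis using key[OF t s0, of 1] s2 far[OF t] by simp
      next
        assume a: "t - \<rho> \<le> step2 n" "?s \<le> step2 n + step1 n"
        then have "\<alpha> 0 + e \<le> (1 - \<theta>) * \<alpha> t" using elim(3) by (intro near t) simp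
        with a show ?thesis using s12 by (intro key[OF t s0, of "1 - \<theta>"]) auto
      qed
      then have "err n t \<le> C * (?F powr 2 * real n powr (- (\<alpha> 0 + e)))"
        using elim(1) t1(1) \<open>C > 0\<close> by (meson mult_left_mono less_imp_le order_trans)
      then have "(real n * d n) powr \<alpha> 0 * d n * err n t \<le>
          (real n * d n) powr \<alpha> 0 * d n * (C * (?F powr 2 * real n powr (- (\<alpha> 0 + e))))"
        using pos by (intro mult_left_mono) auto
      also have "\<dots> = C * B powr 2 * ((real n powr \<alpha> 0 * real n powr (- (\<alpha> 0 + e))) *
          (d n powr \<alpha> 0 * d n powr 1 * d n powr (2 * tail_exp)))"
        using pos B by (simp add: powr_mult powr_powr mult_ac)
      also have "real n powr \<alpha> 0 * real n powr (- (\<alpha> 0 + e)) = real n powr (- e)"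
        by (simp add: powr_add[symmetric])
      also have "d n powr \<alpha> 0 * d n powr 1 * d n powr (2 * tail_exp) = d n powr (\<alpha> 0 + 1 + 2 * tail_exp)"
        by (simp only: powr_add)
      also have "\<dots> = ln (real n) powr ((\<alpha> 0 + 1 + 2 * tail_exp) / \<gamma>)"
        by (rule d_powr_eq)
      finally show "(real n * d n) powr \<alpha> 0 * d n * err n t \<le> W n"
        by (simp add: W_def)
    qed
  qed
  ultimately show ?thesis by auto
qed

lemma alpha_expansion: "((\<lambda>t. (\<alpha> t - \<alpha> 0) / t powr \<gamma>) \<longlongrightarrow> b) (at_right 0)"
proof -
  have "((\<lambda>t. (\<alpha> t - (\<alpha> 0 + b * t powr \<gamma>)) / t powr \<gamma>) \<longlongrightarrow> 0) (at_right 0)"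
    by (rule smalloD_tendsto[OF C2(3)])
  then have "((\<lambda>t. (\<alpha> t - (\<alpha> 0 + b * t powr \<gamma>)) / t powr \<gamma> + b) \<longlongrightarrow> 0 + b) (at_right 0)"
    by (intro tendsto_add tendsto_const)
  then have "((\<lambda>t. (\<alpha> t - (\<alpha> 0 + b * t powr \<gamma>)) / t powr \<gamma> + b) \<longlongrightarrow> b) (at_right 0)" by simp
  then show ?thesis
  proof (rule Lim_transform_eventually)
    show "\<forall>\<^sub>F t in at_right 0. (\<alpha> t - (\<alpha> 0 + b * t powr \<gamma>)) / t powr \<gamma> + b = (\<alpha> t - \<alpha> 0) / t powr \<gamma>"
      using eventually_at_right_less[of 0] by eventually_elim (simp add: field_simps)
  qed
qed

lemma ln_d_over_ln_tendsto_0: "(\<lambda>n. ln (d n) / ln (real n)) \<longlonglongrightarrow> 0"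
proof -
  have "((\<lambda>x::real. ln (ln x powr (1 / \<gamma>)) / ln x) \<longlongrightarrow> 0) at_top"
    using C2(2) by real_asymp
  from filterlim_compose[OF this filterlim_real_sequentially] show ?thesis
    by (simp add: dilation_factor_def)
qed

lemma t_over_d:
  assumes u: "u > 0"
  shows "filterlim (\<lambda>n. u / d n) (at_right 0) sequentially"
proof -
  have "(\<lambda>n. u / d n) \<longlonglongrightarrow> 0"
    by (rule tendsto_divide_0[OF tendsto_const]) (rule filterlim_at_top_imp_at_infinity[OF d_at_top])
  moreover have "\<forall>\<^sub>F n in sequentially. u / d n \<in> {0<..}"
    using eventually_large by eventually_elim (use u large_pos in auto)
  ultimately show ?thesis
    by (auto simp: filterlim_at elim: eventually_mono)
qed

text \<open>Since \<open>t powr \<gamma> = u powr \<gamma> / ln n\<close> for \<open>t = u / d n\<close>, the product \<open>(\<alpha> t - \<alpha> 0) * ln n\<close> tends to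
  \<open>b * u powr \<gamma>\<close>; the contribution of \<open>ln (d n)\<close> is of lower order.\<close>

lemma scaled_exponent_limit:
  assumes u: "u > 0"
  shows "(\<lambda>n. (real n * d n) powr (\<alpha> 0 - \<alpha> (u / d n))) \<longlonglongrightarrow> exp (- b * u powr \<gamma>)"
proof -
  define A where "A n = (\<alpha> (u / d n) - \<alpha> 0) / (u / d n) powr \<gamma>" for n
  have A: "A \<longlonglongrightarrow> b"
    unfolding A_def[abs_def] by (rule filterlim_compose[OF alpha_expansion t_over_d[OF u]])
  have "(\<lambda>n. exp (- (A n * u powr \<gamma> * (1 + ln (d n) / ln (real n))))) \<longlonglongrightarrow> exp (- (b * u powr \<gamma> * (1 + 0)))"
    by (intro tendsto_intros A ln_d_over_ln_tendsto_0)
  then have "(\<lambda>n. exp (- (A n * u powr \<gamma> * (1 + ln (d n) / ln (real n))))) \<longlonglongrightarrow> exp (- b * u powr \<gamma>)"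
    by simp
  then show ?thesis
  proof (rule Lim_transform_eventually)
    show "\<forall>\<^sub>F n in sequentially. exp (- (A n * u powr \<gamma> * (1 + ln (d n) / ln (real n)))) =
        (real n * d n) powr (\<alpha> 0 - \<alpha> (u / d n))"
      using eventually_large
    proof eventually_elim
      case (elim n)
      note pos = large_pos[OF elim]
      have ln: "ln (real n) > 0" using pos by simp
      have pw: "(u / d n) powr \<gamma> = u powr \<gamma> / ln (real n)"
        using d_powr[of n] pos u by (simp add: powr_divide)
      have "A n * u powr \<gamma> = (\<alpha> (u / d n) - \<alpha> 0) * ln (real n)"
        using u ln by (simp add: A_def pw)
      then have "A n * u powr \<gamma> * (1 + ln (d n) / ln (real n)) = (\<alpha> (u / d n) - \<alpha> 0) * (ln (real n) + ln (d n))"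
        using ln by (simp add: distrib_left)
      also have "ln (real n) + ln (d n) = ln (real n * d n)"
        using pos by (simp add: ln_mult)
      finally show ?case using pos by (simp add: powr_def algebra_simps)
    qed
  qed
qed

text \<open>Between the last knot and \<open>u\<close> the monotone density lies between \<open>p u\<close> and its value at the knot,
  which converges to \<open>p u\<close> at a point of continuity; so the mass of this interval, a fractional part
  divided by \<open>n\<close>, is asymptotically \<open>p u\<close> times its length.\<close>

lemma spacing_limit:
  assumes u: "u > 0" and cont: "isCont (\<lambda>v. p (max v 0)) u"
  shows "(\<lambda>n. real n * (u - d n * \<tau> n (u / d n)) - frac (real n * mass p u) / p u) \<longlonglongrightarrow> 0"
    and "\<forall>\<^sub>F n in sequentially. 0 \<le> real n * (u - d n * \<tau> n (u / d n)) \<and>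
      real n * (u - d n * \<tau> n (u / d n)) \<le> 1 / p u"
proof -
  define v where "v n = d n * \<tau> n (u / d n)" for n
  define x where "x n = real n * (u - v n)" for n
  have pu: "p u > 0" using u by (intro p_pos) simp
  have ev_rho: "\<forall>\<^sub>F n in sequentially. u / d n \<le> \<rho>"
  proof -
    have "\<forall>\<^sub>F n in sequentially. u \<le> d n * \<rho>"
      using d_mult_at_top[OF rho(1)] by (simp add: filterlim_at_top)
    with eventually_large show ?thesis
      by eventually_elim (use large_pos in \<open>simp add: field_simps\<close>)
  qed
  have main: "\<forall>\<^sub>F n in sequentially. 0 \<le> v n \<and> v n \<le> u \<and> p u * x n \<le> frac (real n * mass p u) \<and>
      frac (real n * mass p u) \<le> p (v n) * x n \<and> 0 \<le> x n"
    using ev_rho eventually_large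
  proof eventually_elim
    case (elim n)
    note pos = large_pos[OF elim(2)]
    have t: "0 \<le> u / d n" using u pos by simp
    note tau = tau_mem[OF elim(2) t]
    have v: "0 \<le> v n" "v n \<le> u" using tau pos unfolding v_def by (auto simp: field_simps)
    have fr: "frac (real n * mass p u) = real n * (mass p u - mass p (v n))"
      using frac_mass_eq[OF elim(2) t elim(1)] pos by (simp add: v_def)
    have "real n * (p u * (u - v n)) \<le> frac (real n * mass p u)"
      unfolding fr using v pos by (intro mult_left_mono mass_p_lower) auto
    moreover have "frac (real n * mass p u) \<le> real n * (p (v n) * (u - v n))"
      unfolding fr using v pos by (intro mult_left_mono mass_p_upper) auto
    ultimately show ?case using v pos by (simp add: x_def mult_ac)
  qed
  have ub: "\<forall>\<^sub>F n in sequentially. 0 \<le> x n \<and> x n \<le> 1 / p u"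
    using main
  proof eventually_elim
    case (elim n)
    have "p u * x n < 1" using elim frac_lt_1[of "real n * mass p u"] by linarith
    then show ?case using elim pu by (simp add: field_simps)
  qed
  then show "\<forall>\<^sub>F n in sequentially. 0 \<le> real n * (u - d n * \<tau> n (u / d n)) \<and>
      real n * (u - d n * \<tau> n (u / d n)) \<le> 1 / p u"
    by (simp add: x_def v_def)
  have "(\<lambda>n. u - v n) \<longlonglongrightarrow> 0"
  proof (rule Lim_null_comparison)
    show "\<forall>\<^sub>F n in sequentially. norm (u - v n) \<le> (1 / p u) / real n"
      using ub main eventually_gt_at_top[of 0]
    proof eventually_elim
      case (elim n)
      then have "norm (u - v n) = x n / real n" by (simp add: x_def)
      also have "\<dots> \<le> (1 / p u) / real n" using elim by (intro divide_right_mono) auto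
      finally show ?case .
    qed
    show "(\<lambda>n. (1 / p u) / real n) \<longlonglongrightarrow> 0" by real_asymp
  qed
  then have "(\<lambda>n. u - (u - v n)) \<longlonglongrightarrow> u - 0" by (intro tendsto_diff tendsto_const)
  then have vlim: "v \<longlonglongrightarrow> u" by simp
  have "(\<lambda>n. p (max (v n) 0)) \<longlonglongrightarrow> p (max u 0)"
    by (rule isCont_tendsto_compose[OF cont vlim])
  then have "(\<lambda>n. (p (max (v n) 0) - p u) / p u / p u) \<longlonglongrightarrow> (p u - p u) / p u / p u"
    using u pu by (intro tendsto_divide tendsto_diff tendsto_const) (auto simp: max_def)
  then have lim0: "(\<lambda>n. (p (max (v n) 0) - p u) / p u / p u) \<longlonglongrightarrow> 0" by simp
  have "(\<lambda>n. x n - frac (real n * mass p u) / p u) \<longlonglongrightarrow> 0"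
  proof (rule Lim_null_comparison[OF _ lim0])
    show "\<forall>\<^sub>F n in sequentially. norm (x n - frac (real n * mass p u) / p u) \<le> (p (max (v n) 0) - p u) / p u / p u"
      using main ub
    proof eventually_elim
      case (elim n)
      have pv: "p u \<le> p (v n)" using elim by (intro p_antimono) auto
      have "norm (x n - frac (real n * mass p u) / p u) = (frac (real n * mass p u) - p u * x n) / p u"
      proof -
        have "x n - frac (real n * mass p u) / p u = - ((frac (real n * mass p u) - p u * x n) / p u)"
          using pu by (simp add: field_simps)
        then show ?thesis using elim pu by simp
      qed
      also have "\<dots> \<le> ((p (v n) - p u) * x n) / p u"
        using elim pu by (intro divide_right_mono) (auto simp: algebra_simps)
      also have "\<dots> \<le> ((p (v n) - p u) * (1 / p u)) / p u"
        using elim pu pv by (intro divide_right_mono mult_left_mono) auto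
      finally have "norm (x n - frac (real n * mass p u) / p u) \<le> (p (v n) - p u) * (1 / p u) / p u" .
      moreover have "max (v n) 0 = v n" using elim by simp
      ultimately show ?case by (simp only:) simp
    qed
  qed
  then show "(\<lambda>n. real n * (u - d n * \<tau> n (u / d n)) - frac (real n * mass p u) / p u) \<longlonglongrightarrow> 0"
    by (simp add: x_def v_def)
qed

end

section \<open>Limit of the rescaled error\<close>

text \<open>Uniform continuity of the power function in base and exponent jointly on a compact set. The base
  may approach 0, and \<open>y n\<close> need not converge, as it oscillates in the application.\<close>

lemma powr_joint_continuity:
  fixes x y a :: "nat \<Rightarrow> real"
  assumes a: "a \<longlonglongrightarrow> a0" and a0: "a0 > 0" and diff: "(\<lambda>n. x n - y n) \<longlonglongrightarrow> 0"
    and x: "\<forall>\<^sub>F n in sequentially. 0 \<le> x n \<and> x n \<le> B" and y: "\<And>n. 0 \<le> y n \<and> y n \<le> B"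
  shows "(\<lambda>n. x n powr a n - y n powr a0) \<longlonglongrightarrow> 0"
proof -
  define S where "S = {0..B} \<times> {a0 / 2..2 * a0}"
  have "compact S" unfolding S_def by (intro compact_Times) auto
  moreover have "continuous_on S (\<lambda>z. fst z powr snd z)"
    by (intro continuous_on_powr' continuous_intros) (use a0 in \<open>auto simp: S_def\<close>)
  ultimately have uc: "uniformly_continuous_on S (\<lambda>z. fst z powr snd z)"
    by (rule compact_uniformly_continuous[rotated])
  show ?thesis
  proof (rule tendstoI)
    fix e :: real assume "e > 0"
    with uc obtain \<delta> where "\<delta> > 0" and \<delta>: "\<And>z w. z \<in> S \<Longrightarrow> w \<in> S \<Longrightarrow> dist w z < \<delta> \<Longrightarrow>
        dist (fst w powr snd w) (fst z powr snd z) < e"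
      unfolding uniformly_continuous_on_def by meson
    have "\<forall>\<^sub>F n in sequentially. dist (x n - y n) 0 < \<delta> / 2"
      by (rule tendstoD[OF diff]) (use \<open>\<delta> > 0\<close> in simp)
    moreover have "\<forall>\<^sub>F n in sequentially. dist (a n) a0 < min (\<delta> / 2) (a0 / 2)"
      by (rule tendstoD[OF a]) (use \<open>\<delta> > 0\<close> a0 in simp)
    ultimately show "\<forall>\<^sub>F n in sequentially. dist (x n powr a n - y n powr a0) 0 < e"
      using x
    proof eventually_elim
      case (elim n)
      have "(x n, a n) \<in> S" "(y n, a0) \<in> S"
      proof -
        have "\<bar>a n - a0\<bar> < a0 / 2" using elim by (simp add: dist_real_def)
        then have "a0 / 2 \<le> a n" "a n \<le> 2 * a0" by linarith+
        then show "(x n, a n) \<in> S" "(y n, a0) \<in> S" using elim y[of n] a0 by (auto simp: S_def)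
      qed
      moreover have "dist (x n, a n) (y n, a0) < \<delta>"
      proof -
        have "dist (x n, a n) (y n, a0) \<le> dist (x n) (y n) + dist (a n) a0"
          unfolding dist_Pair_Pair by (rule sqrt_sum_squares_le_sum) auto
        then show ?thesis using elim by (simp add: dist_real_def)
      qed
      ultimately show ?case using \<delta>[of "(y n, a0)" "(x n, a n)"] by (simp add: dist_real_def)
    qed
  qed
qed

lemma set_integrable_stretched_exponential:
  fixes k \<gamma> :: real
  assumes "k > 0" "\<gamma> > 0"
  shows "set_integrable lborel {0..} (\<lambda>u. exp (- k * u powr \<gamma>))"
proof -
  have "((\<lambda>u. (1 + u\<^sup>2) * exp (- k * u powr \<gamma>)) \<longlongrightarrow> 0) at_top"
    using assms by real_asymp
  then have "\<forall>\<^sub>F u in at_top. (1 + u\<^sup>2) * exp (- k * u powr \<gamma>) < 1"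
    by (rule order_tendstoD(2)) simp
  then obtain A where A: "\<And>u. u \<ge> A \<Longrightarrow> (1 + u\<^sup>2) * exp (- k * u powr \<gamma>) < 1"
    by (auto simp: eventually_at_top_linorder)
  (* valid beyond A by its choice, and below A because the exponential is at most 1 *)
  define C where "C = 1 + A\<^sup>2"
  have bound: "exp (- k * u powr \<gamma>) \<le> C * inverse (1 + u\<^sup>2)" if "u \<ge> 0" for u
  proof -
    have "(1 + u\<^sup>2) * exp (- k * u powr \<gamma>) \<le> C"
    proof (cases "u \<ge> A")
      case True
      then show ?thesis using A[OF True] by (simp add: C_def add_increasing2 less_imp_le)
    next
      case False
      then have "u\<^sup>2 \<le> A\<^sup>2" using that by (intro power_mono) auto
      moreover have "exp (- k * u powr \<gamma>) \<le> 1" using assms by simp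
      ultimately have "(1 + u\<^sup>2) * exp (- k * u powr \<gamma>) \<le> (1 + A\<^sup>2) * 1"
        by (intro mult_mono) auto
      then show ?thesis by (simp add: C_def)
    qed
    moreover have "0 < 1 + u\<^sup>2" by (simp add: add_pos_nonneg)
    ultimately show ?thesis by (simp add: field_simps)
  qed
  have "set_integrable lborel {0..} (\<lambda>u::real. inverse (1 + u\<^sup>2))"
    by (rule set_integrable_subset[OF integrable_inverse_1_plus_square]) (auto simp: einterval_iff)
  then have i: "set_integrable lborel {0..} (\<lambda>u::real. C * inverse (1 + u\<^sup>2))"
    by (rule set_integrable_mult_right)
  show ?thesis
  proof (rule set_integrable_bound[OF i])
    show "set_borel_measurable lborel {0..} (\<lambda>u. exp (- k * u powr \<gamma>))"
      unfolding set_borel_measurable_def by measurable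
    have "C \<ge> 0" by (simp add: C_def)
    then show "AE u in lborel. u \<in> {0..} \<longrightarrow> norm (exp (- k * u powr \<gamma>)) \<le> norm (C * inverse (1 + u\<^sup>2))"
      using bound by (intro AE_I2) (auto simp: add_nonneg_nonneg)
  qed
qed

text \<open>The power function cut off to \<open>[0, 1)\<close>, the range of \<open>frac\<close>, so that it is bounded.\<close>

definition unit_powr :: "real \<Rightarrow> real \<Rightarrow> real" where
  "unit_powr a x = indicator {0..<1} x * x powr a"

lemma unit_powr_measurable [measurable]: "unit_powr a \<in> borel_measurable borel"
  unfolding unit_powr_def[abs_def] by measurable

lemma unit_powr_bound: "a \<ge> 0 \<Longrightarrow> \<bar>unit_powr a x\<bar> \<le> 1"
  by (auto simp: unit_powr_def indicator_def intro: powr_le1)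

lemma unit_powr_frac: "unit_powr a (frac x) = frac x powr a"
  using frac_lt_1[of x] by (simp add: unit_powr_def)

lemma integral_unit_powr:
  assumes "a > 0"
  shows "(LBINT x:{0..<1}. unit_powr a x) = 1 / (a + 1)"
proof -
  have i: "set_integrable lborel {0..1} (\<lambda>x. x powr a)"
    unfolding set_integrable_def
  proof (rule Bochner_Integration.integrable_bound[where f="\<lambda>x. indicator {0..1::real} x"])
    show "AE x in lborel. norm (indicator {0..1} x *\<^sub>R x powr a) \<le> norm (indicator {0..1} x :: real)"
      using assms by (intro AE_I2) (auto simp: indicator_def intro: powr_le1)
  qed auto
  have "(LBINT x:{0..<1}. unit_powr a x) = (LBINT x:{0..1}. x powr a)"
    unfolding set_lebesgue_integral_def
    by (rule integral_discrete_difference[where X="{1}"]) (auto simp: indicator_def unit_powr_def)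
  also have "\<dots> = integral {0..1} (\<lambda>x. x powr a)"
    by (rule set_borel_integral_eq_integral(2)[OF i])
  also have "\<dots> = 1 / (a + 1)"
    using has_integral_powr_from_0[of a 1] assms by (intro integral_unique) simp
  finally show ?thesis .
qed

context composite_dilated_design
begin

lemma alpha0_pos: "\<alpha> 0 > 0" by (rule alpha_pos) simp

definition profile :: "real \<Rightarrow> real" where
  "profile u = p u powr (- \<alpha> 0) * exp (- b * u powr \<gamma>)"

text \<open>The rescaled error is \<open>c t * A * x powr \<alpha> t\<close> up to a negligible multiple of itself, with
  \<open>A = (n * d) powr (\<alpha> 0 - \<alpha> t)\<close> and \<open>x\<close> equal to \<open>n\<close> times the dilated step. The limits of \<open>A\<close> and of
  \<open>x - frac (n * mass p u) / p u\<close> are known, and the power function is uniformly continuous. There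
  is no limit of the error itself, only of the difference.\<close>

lemma pointwise_limit:
  assumes u: "u > 0" and cont: "isCont (\<lambda>v. p (max v 0)) u"
  shows "(\<lambda>n. (real n * d n) powr \<alpha> 0 * err n (u / d n) -
      c 0 * (profile u * frac (real n * mass p u) powr \<alpha> 0)) \<longlonglongrightarrow> 0"
proof -
  define t where "t n = u / d n" for n
  define a where "a n = \<alpha> (t n)" for n
  define x where "x n = real n * (u - d n * \<tau> n (t n))" for n
  define y where "y n = frac (real n * mass p u) / p u" for n
  define A where "A n = (real n * d n) powr (\<alpha> 0 - a n)" for n
  define H where "H n = A n * x n powr a n" for n
  define E where "E n = (real n * d n) powr \<alpha> 0 * err n (t n)" for n
  have pu: "p u > 0" using u by (intro p_pos) simp
  have tlim: "filterlim t (at_right 0) sequentially"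
    unfolding t_def[abs_def] by (rule t_over_d[OF u])
  then have "t \<longlonglongrightarrow> 0" by (simp add: filterlim_at)
  have t01: "\<forall>\<^sub>F n in sequentially. t n \<in> {0..1}"
  proof -
    have "\<forall>\<^sub>F n in sequentially. t n < 1" using \<open>t \<longlonglongrightarrow> 0\<close> by (rule order_tendstoD) simp
    with eventually_large show ?thesis
      by eventually_elim (use u large_pos in \<open>auto simp: t_def\<close>)
  qed
  have comp: "(\<lambda>n. f (t n)) \<longlonglongrightarrow> f 0" if "continuous_on {0..1} f" for f :: "real \<Rightarrow> real"
    by (rule continuous_on_tendsto_compose[OF that \<open>t \<longlonglongrightarrow> 0\<close> _ t01]) simp
  have alim: "a \<longlonglongrightarrow> \<alpha> 0" unfolding a_def[abs_def] by (rule comp[OF cont_alpha])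
  have clim: "(\<lambda>n. c (t n)) \<longlonglongrightarrow> c 0" by (rule comp[OF cont_c])
  have Alim: "A \<longlonglongrightarrow> exp (- b * u powr \<gamma>)"
    unfolding A_def[abs_def] a_def t_def by (rule scaled_exponent_limit[OF u])
  have xy: "(\<lambda>n. x n - y n) \<longlonglongrightarrow> 0" and xb: "\<forall>\<^sub>F n in sequentially. 0 \<le> x n \<and> x n \<le> 1 / p u"
    using spacing_limit[OF u cont] by (simp_all add: x_def y_def t_def)
  have yb: "0 \<le> y n \<and> y n \<le> 1 / p u" for n
    using pu frac_ge_0[of "real n * mass p u"] less_imp_le[OF frac_lt_1[of "real n * mass p u"]]
    by (auto simp: y_def intro: divide_right_mono)
  have pw: "(\<lambda>n. x n powr a n - y n powr \<alpha> 0) \<longlonglongrightarrow> 0"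
    by (rule powr_joint_continuity[OF alim alpha0_pos xy xb yb])
  define Y where "Y = (1 / p u) powr \<alpha> 0"
  have ypb: "norm (y n powr \<alpha> 0) \<le> Y" for n
    using yb[of n] alpha0_pos by (auto simp: Y_def intro: powr_mono2)
  have prod0: "(\<lambda>n. f n * y n powr \<alpha> 0) \<longlonglongrightarrow> 0" if "f \<longlonglongrightarrow> 0" for f :: "nat \<Rightarrow> real"
    by (rule lim_null_mult_right_bounded[OF that, of _ Y]) (use ypb in simp)
  have Hlim: "(\<lambda>n. H n - exp (- b * u powr \<gamma>) * y n powr \<alpha> 0) \<longlonglongrightarrow> 0"
  proof -
    have "(\<lambda>n. A n * (x n powr a n - y n powr \<alpha> 0) + (A n - exp (- b * u powr \<gamma>)) * y n powr \<alpha> 0)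
        \<longlonglongrightarrow> exp (- b * u powr \<gamma>) * 0 + 0"
      by (intro tendsto_add tendsto_mult Alim pw prod0) (use Alim in \<open>simp add: LIM_zero\<close>)
    then show ?thesis by (simp add: H_def algebra_simps)
  qed
  define B where "B = 1 + Y"
  have "Y \<ge> 0" by (simp add: Y_def)
  then have "B > 0" by (simp add: B_def)
  have Hb: "\<forall>\<^sub>F n in sequentially. norm (H n) \<le> B"
    using tendstoD[OF Hlim zero_less_one]
  proof eventually_elim
    case (elim n)
    let ?e = "exp (- b * u powr \<gamma>) * y n powr \<alpha> 0"
    have "?e \<le> 1 * Y"
      using ypb[of n] C2(1) by (intro mult_mono) auto
    moreover have "0 \<le> ?e" by simp
    moreover have "\<bar>H n - ?e\<bar> < 1" using elim by (simp add: dist_real_def)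
    ultimately show ?case unfolding B_def real_norm_def by linarith
  qed
  have EH: "\<forall>\<^sub>F n in sequentially. \<bar>E n - c (t n) * H n\<bar> \<le> \<epsilon> * H n" if "\<epsilon> > 0" for \<epsilon>
    using err_local[OF that] t01 eventually_large
  proof eventually_elim
    case (elim n)
    note pos = large_pos[OF elim(3)]
    let ?nd = "real n * d n"
    have nd: "?nd > 0" using pos by simp
    have s0: "0 \<le> t n - \<tau> n (t n)" using tau_mem[OF elim(3), of "t n"] elim(2) by simp
    have "x n = ?nd * (t n - \<tau> n (t n))"
      using pos by (simp add: x_def t_def field_simps)
    then have s: "?nd powr \<alpha> 0 * (t n - \<tau> n (t n)) powr a n = H n"
      using nd s0 by (simp add: H_def A_def powr_mult powr_diff)
    have "\<bar>?nd powr \<alpha> 0 * (err n (t n) - c (t n) * (t n - \<tau> n (t n)) powr a n)\<bar> \<le>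
        ?nd powr \<alpha> 0 * (\<epsilon> * (t n - \<tau> n (t n)) powr a n)"
      using elim(1,2) by (auto simp: abs_mult a_def intro!: mult_left_mono)
    then have "\<bar>E n - c (t n) * (?nd powr \<alpha> 0 * (t n - \<tau> n (t n)) powr a n)\<bar> \<le>
        \<epsilon> * (?nd powr \<alpha> 0 * (t n - \<tau> n (t n)) powr a n)"
      by (simp add: E_def algebra_simps)
    then show ?case unfolding s .
  qed
  have EHlim: "(\<lambda>n. E n - c (t n) * H n) \<longlonglongrightarrow> 0"
  proof (rule tendstoI)
    fix e :: real assume "e > 0"
    have "e / (2 * B) > 0" using \<open>e > 0\<close> \<open>B > 0\<close> by simp
    from EH[OF this] Hb show "\<forall>\<^sub>F n in sequentially. dist (E n - c (t n) * H n) 0 < e"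
    proof eventually_elim
      case (elim n)
      note elim(1)
      also have "e / (2 * B) * H n \<le> e / (2 * B) * B"
        using elim(2) \<open>e > 0\<close> \<open>B > 0\<close> by (intro mult_left_mono) (auto simp: abs_le_iff)
      also have "\<dots> < e" using \<open>e > 0\<close> \<open>B > 0\<close> by simp
      finally show ?case by (simp add: dist_real_def)
    qed
  qed
  have cH: "(\<lambda>n. (c (t n) - c 0) * H n) \<longlonglongrightarrow> 0"
    by (rule lim_null_mult_right_bounded[OF _ Hb]) (use clim in \<open>simp add: LIM_zero\<close>)
  have "(\<lambda>n. (E n - c (t n) * H n) + (c (t n) - c 0) * H n +
      c 0 * (H n - exp (- b * u powr \<gamma>) * y n powr \<alpha> 0)) \<longlonglongrightarrow> 0 + 0 + c 0 * 0"
    by (intro tendsto_add EHlim tendsto_mult_left Hlim cH)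
  moreover have "exp (- b * u powr \<gamma>) * y n powr \<alpha> 0 = profile u * frac (real n * mass p u) powr \<alpha> 0" for n
    using pu by (simp add: profile_def y_def powr_divide powr_minus_divide)
  ultimately show ?thesis
    by (simp add: algebra_simps E_def t_def)
qed

abbreviation p0 :: "real \<Rightarrow> real" where "p0 u \<equiv> indicator {0..} u * p u"

lemma p0_measurable [measurable]: "p0 \<in> borel_measurable borel"
  by (rule prob_density_nonneg_measurable[OF p])

lemma indicator_profile_eq: "indicator {0..} u * profile u = indicator {0..} u * (p0 u powr (- \<alpha> 0) * exp (- b * u powr \<gamma>))"
  by (simp add: profile_def indicator_def)

lemma indicator_profile_measurable [measurable]: "(\<lambda>u. indicator {0..} u * profile u) \<in> borel_measurable borel"
  unfolding indicator_profile_eq by measurable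

lemma profile_nonneg: "0 \<le> profile u" by (simp add: profile_def)

lemma profile_pos: "u \<ge> 0 \<Longrightarrow> 0 < profile u"
  using p_pos[of u] by (simp add: profile_def)

lemma profile_integrable: "set_integrable lborel {0..} profile"
proof -
  define k where "k = b - \<alpha> 0 * q2"
  have "k > 0" using A1(4) alpha0_pos by (simp add: k_def field_simps)
  have i: "set_integrable lborel {0..} (\<lambda>u. q1 powr (- \<alpha> 0) * exp (- k * u powr \<gamma>))"
    by (intro set_integrable_mult_right set_integrable_stretched_exponential \<open>k > 0\<close> C2)
  have le: "profile u \<le> q1 powr (- \<alpha> 0) * exp (- k * u powr \<gamma>)" if "u \<ge> 0" for u
  proof -
    have q: "0 < q1 * exp (- q2 * u powr \<gamma>)" using A1(2) by simp
    have "p u powr (- \<alpha> 0) \<le> (q1 * exp (- q2 * u powr \<gamma>)) powr (- \<alpha> 0)"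
      using p_lower[OF that] q alpha0_pos by (intro powr_mono2') auto
    also have "\<dots> = q1 powr (- \<alpha> 0) * exp (\<alpha> 0 * q2 * u powr \<gamma>)"
      using A1(2) by (simp add: powr_mult exp_powr_real algebra_simps)
    finally have "profile u \<le> q1 powr (- \<alpha> 0) * exp (\<alpha> 0 * q2 * u powr \<gamma>) * exp (- b * u powr \<gamma>)"
      unfolding profile_def by (intro mult_right_mono) auto
    also have "\<dots> = q1 powr (- \<alpha> 0) * exp (- k * u powr \<gamma>)"
      by (simp add: k_def exp_add[symmetric] algebra_simps)
    finally show ?thesis .
  qed
  show ?thesis
  proof (rule set_integrable_bound[OF i])
    show "set_borel_measurable lborel {0..} profile"
      using indicator_profile_measurable by (simp add: set_borel_measurable_def)
    show "AE u in lborel. u \<in> {0..} \<longrightarrow> norm (profile u) \<le> norm (q1 powr (- \<alpha> 0) * exp (- k * u powr \<gamma>))"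
      using le by (intro AE_I2) (simp add: profile_nonneg)
  qed
qed

lemma profile_integral_pos: "0 < (LBINT u:{0..}. profile u)"
proof -
  have int: "integrable lborel (\<lambda>u. indicator {0..} u * profile u)"
    using profile_integrable by (simp add: set_integrable_def)
  have nn: "AE u in lborel. 0 \<le> indicator {0..} u * profile u"
    by (intro AE_I2) (simp add: profile_nonneg)
  have "0 \<le> (LBINT u. indicator {0..} u * profile u)"
    by (rule integral_nonneg_AE[OF nn])
  moreover have "(LBINT u. indicator {0..} u * profile u) \<noteq> 0"
  proof
    assume "(LBINT u. indicator {0..} u * profile u) = 0"
    then have "AE u in lborel. indicator {0..} u * profile u = 0"
      using integral_nonneg_eq_0_iff_AE[OF int nn] by simp
    then have "AE u in lborel. u \<notin> {0..1::real}"
      by eventually_elim (use profile_pos in \<open>fastforce simp: indicator_def\<close>)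
    then have "{0..1::real} \<in> null_sets lborel"
      by (subst AE_iff_null_sets) simp_all
    then have "emeasure lborel {0..1::real} = 0" by (rule null_setsD1)
    then show False by simp
  qed
  ultimately show ?thesis by (simp add: set_lebesgue_integral_def)
qed

text \<open>\<open>profile\<close> is divided by \<open>p\<close> in order to write the integral as one with respect to the law with
  density \<open>p\<close>.\<close>

lemma oscillating_limit:
  "(\<lambda>n. LBINT u. indicator {0..} u * (profile u * frac (real n * mass p u) powr \<alpha> 0))
     \<longlonglongrightarrow> 1 / (\<alpha> 0 + 1) * (LBINT u:{0..}. profile u)"
proof -
  define h where "h u = p0 u powr (- \<alpha> 0 - 1) * exp (- b * u powr \<gamma>)" for u
  have [measurable]: "h \<in> borel_measurable borel" unfolding h_def[abs_def] by measurable
  note [measurable] = mass_measurable[OF p]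
  have p0nn: "p0 u \<ge> 0" for u using p_pos[of u] by (auto simp: indicator_def)
  have ph: "p0 u * h u = indicator {0..} u * profile u" for u
  proof (cases "u \<ge> 0")
    case True
    with p_pos[OF True] have "p u * p u powr (- \<alpha> 0 - 1) = p u powr (- \<alpha> 0)"
      by (simp add: powr_diff)
    then show ?thesis using True by (simp add: h_def profile_def mult.assoc[symmetric])
  qed simp
  have hint: "integrable (density_law p) h"
    using profile_integrable p0nn
    by (subst integrable_density) (auto simp: ph set_integrable_def)
  have eq: "(LINT u|density_law p. h u * f u) = (LBINT u. indicator {0..} u * (profile u * f u))"
    if [measurable]: "f \<in> borel_measurable borel" for f :: "real \<Rightarrow> real"
  proof -
    have "(LINT u|density_law p. h u * f u) = (LBINT u. p0 u *\<^sub>R (h u * f u))"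
      by (rule integral_density) (use p0nn in auto)
    also have "\<dots> = (LBINT u. indicator {0..} u * (profile u * f u))"
      using ph by (intro Bochner_Integration.integral_cong refl) (simp add: mult.assoc[symmetric])
    finally show ?thesis .
  qed
  have "(\<lambda>n. LINT u|density_law p. h u * unit_powr (\<alpha> 0) (frac (real n * mass p u)))
      \<longlonglongrightarrow> (LBINT x:{0..<1}. unit_powr (\<alpha> 0) x) * (LINT u|density_law p. h u)"
    by (rule fejer_density[OF p mass_p_strict _ _ hint, where B=1])
       (use alpha0_pos unit_powr_bound[of "\<alpha> 0"] in auto)
  moreover have "(LINT u|density_law p. h u) = (LBINT u:{0..}. profile u)"
    using eq[of "\<lambda>_. 1"] by (simp add: set_lebesgue_integral_def)
  moreover have "(LINT u|density_law p. h u * unit_powr (\<alpha> 0) (frac (real n * mass p u))) =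
      (LBINT u. indicator {0..} u * (profile u * frac (real n * mass p u) powr \<alpha> 0))" for n
    by (subst eq) (simp_all add: unit_powr_frac)
  ultimately show ?thesis
    using integral_unit_powr[OF alpha0_pos] by simp
qed

lemma AE_isCont_p: "AE u in lborel. isCont (\<lambda>v. p (max v 0)) u"
proof -
  have "mono (\<lambda>v. - p (max v 0))"
    by (rule monoI) (auto intro!: p_antimono)
  from mono_ctble_discont[OF this] have c: "countable {u. \<not> isCont (\<lambda>v. - p (max v 0)) u}" .
  have "isCont (\<lambda>v. - p (max v 0)) u \<longleftrightarrow> isCont (\<lambda>v. p (max v 0)) u" for u
    using isCont_minus[of u "\<lambda>v. - p (max v 0)"] isCont_minus[of u "\<lambda>v. p (max v 0)"] by auto
  with c have "countable {u. \<not> isCont (\<lambda>v. p (max v 0)) u}" by simp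
  from AE_not_in[OF countable_imp_null_set_lborel[OF this]]
  show ?thesis by simp
qed

lemma err_measurable: "large n \<Longrightarrow> (\<lambda>t. indicator {0..1} t * err n t) \<in> borel_measurable borel"
  unfolding err_def by (rule msq_error_measurable[OF X finite_T zero_T T_sub])

definition scaled_err :: "nat \<Rightarrow> real \<Rightarrow> real" where
  "scaled_err n u = indicator {0..d n * \<rho>} u * ((real n * d n) powr \<alpha> 0 * err n (u / d n))"

lemma scaled_err_measurable: "large n \<Longrightarrow> scaled_err n \<in> borel_measurable borel"
proof -
  assume n: "large n"
  note pos = large_pos[OF n]
  note [measurable] = err_measurable[OF n]
  have "(\<lambda>u. indicator {0..d n * \<rho>} u * ((real n * d n) powr \<alpha> 0 * (indicator {0..1} (u / d n) * err n (u / d n))))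
      \<in> borel_measurable borel"
    by measurable
  also have "(\<lambda>u. indicator {0..d n * \<rho>} u * ((real n * d n) powr \<alpha> 0 * (indicator {0..1} (u / d n) * err n (u / d n)))) = scaled_err n"
  proof
    fix u
    have "u / d n \<in> {0..1}" if "u \<in> {0..d n * \<rho>}"
    proof -
      have "d n * \<rho> \<le> d n * 1" using rho pos by (intro mult_left_mono) auto
      then have "u \<le> d n" using that by simp
      then show ?thesis using that pos by (auto simp: field_simps)
    qed
    then show "indicator {0..d n * \<rho>} u * ((real n * d n) powr \<alpha> 0 * (indicator {0..1} (u / d n) * err n (u / d n))) = scaled_err n u"
      by (auto simp: scaled_err_def indicator_def)
  qed
  finally show ?thesis .
qed

text \<open>Dominated convergence for the difference to the oscillating function, whose integrals converge
  by \<open>oscillating_limit\<close>.\<close>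

lemma scaled_err_limit:
  "(\<lambda>n. LBINT u. scaled_err n u) \<longlonglongrightarrow> c 0 / (\<alpha> 0 + 1) * (LBINT u:{0..}. profile u)"
proof -
  obtain D where "D > 0" and D: "\<forall>\<^sub>F n in sequentially. \<forall>t\<in>{0..\<rho>}.
     (real n * d n) powr \<alpha> 0 * err n t \<le> D * exp (- \<kappa> * (d n * t) powr \<gamma>)"
    using err_dominated by blast
  have c0: "c 0 > 0" by (rule c_pos) simp
  define R where "R n u = c 0 * (indicator {0..} u * (profile u * frac (real n * mass p u) powr \<alpha> 0))" for n u
  define w where "w u = D * (indicator {0..} u * exp (- \<kappa> * u powr \<gamma>)) + c 0 * (indicator {0..} u * profile u)" for u
  have wint: "integrable lborel w"
    using set_integrable_stretched_exponential[OF kappa_pos C2(2)] profile_integrable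
    unfolding w_def[abs_def] set_integrable_def
    by (intro Bochner_Integration.integrable_add integrable_mult_right) auto
  note [measurable] = mass_measurable[OF p]
  have "(\<lambda>u. indicator {0..} u * profile u * frac (real n * mass p u) powr \<alpha> 0) \<in> borel_measurable borel" for n
    by measurable
  then have Rm [measurable]: "R n \<in> borel_measurable borel" for n
    unfolding R_def[abs_def] by (simp add: mult.assoc)
  have Rb: "\<bar>R n u\<bar> \<le> c 0 * (indicator {0..} u * profile u)" for n u
  proof -
    have "frac (real n * mass p u) powr \<alpha> 0 \<le> 1"
      using alpha0_pos frac_lt_1[of "real n * mass p u"] by (intro powr_le1) auto
    then have "profile u * frac (real n * mass p u) powr \<alpha> 0 \<le> profile u"
      using profile_nonneg by (intro mult_left_le) auto
    then show ?thesis using c0 profile_nonneg[of u]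
      by (auto simp: R_def indicator_def abs_mult)
  qed
  have Rint: "integrable lborel (R n)" for n
  proof (rule Bochner_Integration.integrable_bound[where f="\<lambda>u. c 0 * (indicator {0..} u * profile u)"])
    show "integrable lborel (\<lambda>u. c 0 * (indicator {0..} u * profile u))"
      using profile_integrable by (simp add: set_integrable_def)
    show "AE u in lborel. norm (R n u) \<le> norm (c 0 * (indicator {0..} u * profile u))"
      using Rb[of n] by (intro AE_I2) (auto intro: order_trans[OF _ abs_ge_self])
  qed simp
  from D eventually_large have "\<forall>\<^sub>F n in sequentially. large n \<and> (\<forall>u. \<bar>scaled_err n u\<bar> \<le> D * (indicator {0..} u * exp (- \<kappa> * u powr \<gamma>)))"
  proof eventually_elim
    case (elim n)
    note pos = large_pos[OF elim(2)]
    have "\<bar>scaled_err n u\<bar> \<le> D * (indicator {0..} u * exp (- \<kappa> * u powr \<gamma>))" for u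
    proof (cases "u \<in> {0..d n * \<rho>}")
      case True
      then have "u / d n \<in> {0..\<rho>}" using pos by (auto simp: field_simps)
      with elim(1) have "(real n * d n) powr \<alpha> 0 * err n (u / d n) \<le> D * exp (- \<kappa> * (d n * (u / d n)) powr \<gamma>)"
        by blast
      then show ?thesis using True pos err_nonneg[of n "u / d n"] by (simp add: scaled_err_def abs_mult)
    next
      case False
      then show ?thesis using \<open>D > 0\<close> by (simp add: scaled_err_def)
    qed
    with elim(2) show ?case by blast
  qed
  then obtain n0 where n0: "\<And>n. n \<ge> n0 \<Longrightarrow> large n"
    and Sb: "\<And>n u. n \<ge> n0 \<Longrightarrow> \<bar>scaled_err n u\<bar> \<le> D * (indicator {0..} u * exp (- \<kappa> * u powr \<gamma>))"
    by (auto simp: eventually_sequentially)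
  have Sint: "integrable lborel (scaled_err n)" if "n \<ge> n0" for n
  proof (rule Bochner_Integration.integrable_bound[where f="\<lambda>u. D * (indicator {0..} u * exp (- \<kappa> * u powr \<gamma>))"])
    show "integrable lborel (\<lambda>u. D * (indicator {0..} u * exp (- \<kappa> * u powr \<gamma>)))"
      using set_integrable_stretched_exponential[OF kappa_pos C2(2)] by (simp add: set_integrable_def)
    show "scaled_err n \<in> borel_measurable lborel" using scaled_err_measurable[OF n0[OF that]] by simp
    show "AE u in lborel. norm (scaled_err n u) \<le> norm (D * (indicator {0..} u * exp (- \<kappa> * u powr \<gamma>)))"
      using Sb[OF that] by (intro AE_I2) (auto intro: order_trans[OF _ abs_ge_self])
  qed
  have "(\<lambda>n. LBINT u. scaled_err (n + n0) u - R (n + n0) u) \<longlonglongrightarrow> (LBINT u::real. 0)"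
  proof (rule integral_dominated_convergence[where w=w])
    show "AE u in lborel. (\<lambda>n. scaled_err (n + n0) u - R (n + n0) u) \<longlonglongrightarrow> 0"
      using AE_isCont_p AE_lborel_singleton[of 0]
    proof eventually_elim
      case (elim u)
      have "(\<lambda>n. scaled_err n u - R n u) \<longlonglongrightarrow> 0"
      proof (cases "u > 0")
        case True
        have ev: "\<forall>\<^sub>F n in sequentially. u \<le> d n * \<rho>"
          using d_mult_at_top[OF rho(1)] by (simp add: filterlim_at_top)
        show ?thesis
        proof (rule Lim_transform_eventually[OF pointwise_limit[OF True elim(1)]])
          show "\<forall>\<^sub>F n in sequentially. (real n * d n) powr \<alpha> 0 * err n (u / d n) -
              c 0 * (profile u * frac (real n * mass p u) powr \<alpha> 0) = scaled_err n u - R n u"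
            using ev by eventually_elim (use True in \<open>simp add: scaled_err_def R_def\<close>)
        qed
      next
        case False
        then have "u < 0" using elim(2) by simp
        then show ?thesis by (simp add: scaled_err_def R_def)
      qed
      then show ?case by (rule LIMSEQ_ignore_initial_segment)
    qed
    fix n
    show "(\<lambda>u. scaled_err (n + n0) u - R (n + n0) u) \<in> borel_measurable lborel"
      using scaled_err_measurable[OF n0[of "n + n0"]] by simp
    show "AE u in lborel. norm (scaled_err (n + n0) u - R (n + n0) u) \<le> w u"
    proof (rule AE_I2)
      fix u
      show "norm (scaled_err (n + n0) u - R (n + n0) u) \<le> w u"
        using Sb[of "n + n0" u] Rb[of "n + n0" u] unfolding w_def real_norm_def by linarith
    qed
  qed (use wint in auto)
  then have "(\<lambda>n. (LBINT u. scaled_err (n + n0) u) - (LBINT u. R (n + n0) u)) \<longlonglongrightarrow> 0"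
    using Sint Rint by (simp add: Bochner_Integration.integral_diff)
  then have diff: "(\<lambda>n. (LBINT u. scaled_err n u) - (LBINT u. R n u)) \<longlonglongrightarrow> 0"
    by (rule LIMSEQ_offset)
  have Rlim: "(\<lambda>n. LBINT u. R n u) \<longlonglongrightarrow> c 0 * (1 / (\<alpha> 0 + 1) * (LBINT u:{0..}. profile u))"
    unfolding R_def integral_mult_right_zero by (intro tendsto_mult_left oscillating_limit)
  from tendsto_add[OF diff Rlim] show ?thesis by simp
qed

lemma total_error_limit:
  "(\<lambda>n. (real n powr \<alpha> 0 * ln (real n) powr ((\<alpha> 0 + 1) / \<gamma>)) * (LBINT t:{0..1}. err n t))
     \<longlonglongrightarrow> c 0 / (\<alpha> 0 + 1) * (LBINT u:{0..}. profile u)"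
proof -
  obtain W where "W \<longlonglongrightarrow> 0" and W: "\<forall>\<^sub>F n in sequentially. \<forall>t\<in>{\<rho>..1}. (real n * d n) powr \<alpha> 0 * d n * err n t \<le> W n"
    using tail_negligible by blast
  obtain C where "C > 0" and C: "\<forall>\<^sub>F n in sequentially. \<forall>t\<in>{0..1}. err n t \<le> C * (t - \<tau> n t) powr \<alpha> t"
    using err_upper by blast
  define m where "m n = (real n * d n) powr \<alpha> 0 * d n" for n
  define rest where "rest n = m n * (LBINT t:{\<rho>..1}. err n t)" for n
  have err_int: "\<forall>\<^sub>F n in sequentially. set_integrable lborel {0..1} (err n)"
    using C eventually_large
  proof eventually_elim
    case (elim n)
    have le: "err n t \<le> C" if t: "t \<in> {0..1}" for t
    proof -
      have "(t - \<tau> n t) powr \<alpha> t \<le> 1"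
        using tau_mem[OF elim(2), of t] t alpha_pos[OF t] by (intro powr_le1) auto
      then have "C * (t - \<tau> n t) powr \<alpha> t \<le> C * 1" using \<open>C > 0\<close> by (intro mult_left_mono) auto
      then show ?thesis using elim(1) t by force
    qed
    show ?case
      unfolding set_integrable_def
    proof (rule Bochner_Integration.integrable_bound[where f="\<lambda>t. indicator {0..1} t * C"])
      show "integrable lborel (\<lambda>t. indicator {0..1::real} t * C)"
        using set_integrable_const_interval[of 0 1 C] by (simp add: set_integrable_def)
      show "(\<lambda>t. indicator {0..1} t *\<^sub>R err n t) \<in> borel_measurable lborel"
        using err_measurable[OF elim(2)] by simp
      show "AE t in lborel. norm (indicator {0..1} t *\<^sub>R err n t) \<le> norm (indicator {0..1} t * C)"
        using le \<open>C > 0\<close> by (intro AE_I2) (auto simp: indicator_def err_nonneg)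
    qed
  qed
  have split: "\<forall>\<^sub>F n in sequentially.
      m n * (LBINT t:{0..1}. err n t) = (LBINT u. scaled_err n u) + rest n"
    using err_int eventually_large
  proof eventually_elim
    case (elim n)
    note pos = large_pos[OF elim(2)]
    have "AE x in lborel. x \<noteq> \<rho>" by (rule AE_lborel_singleton)
    then have ae: "AE x in lborel. \<not> (x \<in> {0..\<rho>} \<and> x \<in> {\<rho>..1})" by eventually_elim auto
    have "(LBINT t:{0..\<rho>} \<union> {\<rho>..1}. err n t) = (LBINT t:{0..\<rho>}. err n t) + (LBINT t:{\<rho>..1}. err n t)"
      using ae rho by (intro set_integral_Un_AE set_integrable_subset[OF elim(1)]) auto
    also have "{0..\<rho>} \<union> {\<rho>..1} = {0..1}" using rho by auto
    finally have s: "(LBINT t:{0..1}. err n t) = (LBINT t:{0..\<rho>}. err n t) + (LBINT t:{\<rho>..1}. err n t)" .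
    have "(LBINT u. scaled_err n u) = d n * (LBINT t. scaled_err n (d n * t))"
      using lborel_integral_real_affine[of "d n" "scaled_err n" 0] pos by simp
    also have "(LBINT t. scaled_err n (d n * t)) = (LBINT t. (real n * d n) powr \<alpha> 0 * (indicator {0..\<rho>} t * err n t))"
      using pos by (intro Bochner_Integration.integral_cong refl)
        (auto simp: scaled_err_def indicator_def zero_le_mult_iff)
    also have "\<dots> = (real n * d n) powr \<alpha> 0 * (LBINT t:{0..\<rho>}. err n t)"
      by (simp add: set_lebesgue_integral_def)
    finally show ?case by (simp add: s rest_def m_def algebra_simps)
  qed
  have "rest \<longlonglongrightarrow> 0"
  proof (rule Lim_null_comparison)
    show "(\<lambda>n. W n * (1 - \<rho>)) \<longlonglongrightarrow> 0"
      using tendsto_mult_right[OF \<open>W \<longlonglongrightarrow> 0\<close>, of "1 - \<rho>"] by simp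
    show "\<forall>\<^sub>F n in sequentially. norm (rest n) \<le> W n * (1 - \<rho>)"
      using W err_int eventually_large
    proof eventually_elim
      case (elim n)
      note pos = large_pos[OF elim(3)]
      have m0: "m n \<ge> 0" using pos by (simp add: m_def)
      have i: "set_integrable lborel {\<rho>..1} (err n)"
        using rho by (intro set_integrable_subset[OF elim(2)]) auto
      have "rest n = (LBINT t:{\<rho>..1}. m n * err n t)" by (simp add: rest_def)
      also have "\<dots> \<le> (LBINT t:{\<rho>..1}. W n)"
        using elim(1) i by (intro set_integral_mono) (auto simp: m_def)
      also have "\<dots> = W n * (1 - \<rho>)" using rho by (intro set_integral_const_interval) simp
      finally have "rest n \<le> W n * (1 - \<rho>)" .
      moreover have "rest n \<ge> 0"
        unfolding rest_def set_lebesgue_integral_def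
        using m0 by (intro mult_nonneg_nonneg integral_nonneg_AE AE_I2) (auto simp: err_nonneg)
      ultimately show ?case by simp
    qed
  qed
  from tendsto_add[OF scaled_err_limit this]
  have "(\<lambda>n. (LBINT u. scaled_err n u) + rest n) \<longlonglongrightarrow> c 0 / (\<alpha> 0 + 1) * (LBINT u:{0..}. profile u)" by simp
  then show ?thesis
  proof (rule Lim_transform_eventually)
    show "\<forall>\<^sub>F n in sequentially. (LBINT u. scaled_err n u) + rest n =
        (real n powr \<alpha> 0 * ln (real n) powr ((\<alpha> 0 + 1) / \<gamma>)) * (LBINT t:{0..1}. err n t)"
      using split eventually_large
    proof eventually_elim
      case (elim n)
      note pos = large_pos[OF elim(2)]
      have "m n = real n powr \<alpha> 0 * (d n powr \<alpha> 0 * d n powr 1)"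
        using pos by (simp add: m_def powr_mult)
      also have "d n powr \<alpha> 0 * d n powr 1 = ln (real n) powr ((\<alpha> 0 + 1) / \<gamma>)"
        unfolding powr_add[symmetric] by (rule d_powr_eq)
      finally show ?case using elim(1) by simp
    qed
  qed
qed

end

section \<open>The rate of the integrated error\<close>

text \<open>If \<open>N n\<close> is asymptotically \<open>n\<close>, so is \<open>ln (N n)\<close> to \<open>ln n\<close>, because the quotient of the former
  pair contributes only a bounded term to the logarithm.\<close>

lemma asymp_equiv_rate:
  fixes N :: "nat \<Rightarrow> nat"
  assumes N: "(\<lambda>n. real (N n)) \<sim>[at_top] (\<lambda>n. real n)"
  shows "(\<lambda>n. K / (real n powr a * ln (real n) powr e)) \<sim>[at_top]
    (\<lambda>n. K / (real (N n) powr a * ln (real (N n)) powr e))"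
proof -
  have ratio: "(\<lambda>n. real (N n) / real n) \<longlonglongrightarrow> 1"
    by (rule asymp_equivD_strong[OF N]) (auto intro: eventually_mono[OF eventually_gt_at_top[of 0]])
  have "\<forall>\<^sub>F n in sequentially. real (N n) / real n > 1 / 2"
    by (rule order_tendstoD(1)[OF ratio]) simp
  then have Npos: "\<forall>\<^sub>F n in sequentially. real (N n) > real n / 2 \<and> n > 1"
    using eventually_gt_at_top[of 1] by eventually_elim (simp add: field_simps)
  have lnr: "(\<lambda>n. ln (real (N n)) / ln (real n)) \<longlonglongrightarrow> 1"
  proof -
    have inv: "(\<lambda>n. inverse (ln (real n))) \<longlonglongrightarrow> 0" by real_asymp
    have "(\<lambda>n. 1 + ln (real (N n) / real n) * inverse (ln (real n))) \<longlonglongrightarrow> 1 + ln 1 * 0"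
      by (intro tendsto_intros ratio inv) simp
    then have "(\<lambda>n. 1 + ln (real (N n) / real n) * inverse (ln (real n))) \<longlonglongrightarrow> 1" by simp
    then show ?thesis
    proof (rule Lim_transform_eventually)
      show "\<forall>\<^sub>F n in sequentially. 1 + ln (real (N n) / real n) * inverse (ln (real n)) = ln (real (N n)) / ln (real n)"
        using Npos
      proof eventually_elim
        case (elim n)
        then have "real (N n) > 0" "real n > 0" by auto
        moreover have "ln (real n) > 0" using elim by simp
        ultimately show ?case by (simp add: ln_div field_simps)
      qed
    qed
  qed
  then have lnN: "(\<lambda>n. ln (real (N n))) \<sim>[at_top] (\<lambda>n. ln (real n))"
    by (rule asymp_equivI')
  have ev1: "\<forall>\<^sub>F n in sequentially. 0 \<le> ln (real n)"
    using eventually_gt_at_top[of 1] by eventually_elim simp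
  have ev2: "\<forall>\<^sub>F n in sequentially. 0 \<le> ln (real (N n))"
    using Npos by eventually_elim (intro ln_ge_zero; linarith)
  have "(\<lambda>n. real (N n) powr a * ln (real (N n)) powr e) \<sim>[at_top] (\<lambda>n. real n powr a * ln (real n) powr e)"
    by (intro asymp_equiv_mult asymp_equiv_powr_real N lnN ev1 ev2) auto
  then have "(\<lambda>n. K / (real (N n) powr a * ln (real (N n)) powr e)) \<sim>[at_top] (\<lambda>n. K / (real n powr a * ln (real n) powr e))"
    by (intro asymp_equiv_divide asymp_equiv_refl)
  then show ?thesis by (rule asymp_equiv_symI)
qed

theorem theorem1:
  fixes M :: "'a measure" and X :: "real \<Rightarrow> 'a \<Rightarrow> real"
    and \<alpha> c p p' :: "real \<Rightarrow> real"
    and b \<gamma> \<rho> q1 q2 r K :: real and N :: "nat \<Rightarrow> nat"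
  assumes X: "locally_stationary M X \<alpha> c"
    and C1: "\<forall>t\<in>{0<..1}. \<alpha> 0 < \<alpha> t"
    and C2: "0 < b" "0 < \<gamma>"
      "(\<lambda>t. \<alpha> t - (\<alpha> 0 + b * t powr \<gamma>)) \<in> o[at_right 0](\<lambda>t. t powr \<gamma>)"
    and p: "prob_density_nonneg p" and p': "prob_density_nonneg p'"
    and rho: "0 < \<rho>" "\<rho> < 1"
    and A1: "bounded (p ` {0..})" "antimono_on {0..} p"
      "0 < q1" "0 < q2" "q2 < b / \<alpha> 0"
      "\<forall>u\<ge>0. p u \<ge> q1 * exp (- q2 * u powr \<gamma>)"
    and A2: "regularly_varying p' r" "r \<le> -1"
    and A3: "q2 * (SUP t\<in>{0..\<rho>}. \<alpha> t) < (INF t\<in>{0<..\<rho>}. (\<alpha> t - \<alpha> 0) / t powr \<gamma>)"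
      "q2 * \<rho> powr \<gamma> < 1"
    and N: "N = num_intervals \<gamma> p \<rho> p'"
    and K: "K = c 0 / (\<alpha> 0 + 1) * (LBINT u:{0..}. p u powr (- \<alpha> 0) * exp (- b * u powr \<gamma>))"
  shows "(\<lambda>n. real (N n)) \<sim>[at_top] (\<lambda>n. real n) \<and>
    set_integrable lborel {0..} (\<lambda>u. p u powr (- \<alpha> 0) * exp (- b * u powr \<gamma>)) \<and>
    (\<lambda>n. LBINT t:{0..1}. integral\<^sup>L M (\<lambda>\<omega>. (X t \<omega> - composite_approx X \<gamma> p \<rho> p' n t \<omega>)\<^sup>2))
      \<sim>[at_top]
    (\<lambda>n. K / (real n powr \<alpha> 0 * ln (real n) powr ((\<alpha> 0 + 1) / \<gamma>))) \<and>
    (\<lambda>n. K / (real n powr \<alpha> 0 * ln (real n) powr ((\<alpha> 0 + 1) / \<gamma>)))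
      \<sim>[at_top]
    (\<lambda>n. K / (real (N n) powr \<alpha> 0 * ln (real (N n)) powr ((\<alpha> 0 + 1) / \<gamma>)))"
proof -
  have p'_nonneg: "0 \<le> p' u" if "0 \<le> u" for u
    using p' that by (auto simp: prob_density_nonneg_def)
  have p'_meas: "set_borel_measurable borel {0..} p'"
    using prob_density_nonneg_measurable[OF p'] by (simp add: set_borel_measurable_def)
  obtain c0 C A where tail: "0 < c0" "0 \<le> C" "1 \<le> A" "\<And>u. A \<le> u \<Longrightarrow> c0 * u powr (- C) \<le> p' u"
    using regularly_varying_polynomial_lower_bound[OF A2(1) p'_nonneg p'_meas] by blast
  interpret D: composite_dilated_design M X \<alpha> c p p' b \<gamma> \<rho> q1 q2 c0 C A
    by unfold_locales (fact+)
  have profile: "D.profile = (\<lambda>u. p u powr (- \<alpha> 0) * exp (- b * u powr \<gamma>))"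
    by (simp add: D.profile_def[abs_def])
  have Ng: "(\<lambda>n. real (N n)) \<sim>[at_top] (\<lambda>n. real n)"
    unfolding N by (rule D.num_intervals_asymp)
  have Kpos: "K > 0"
    using D.profile_integral_pos D.c_pos[of 0] D.alpha0_pos unfolding K profile by simp
  define S where "S n = real n powr \<alpha> 0 * ln (real n) powr ((\<alpha> 0 + 1) / \<gamma>)" for n :: nat
  define I where "I n = (LBINT t:{0..1}. integral\<^sup>L M (\<lambda>\<omega>. (X t \<omega> - composite_approx X \<gamma> p \<rho> p' n t \<omega>)\<^sup>2))" for n
  have "(\<lambda>n. S n * (LBINT t:{0..1}. D.err n t)) \<longlonglongrightarrow> K"
    using D.total_error_limit unfolding S_def K profile .
  then have "(\<lambda>n. S n * (LBINT t:{0..1}. D.err n t) / K) \<longlonglongrightarrow> K / K"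
    by (intro tendsto_divide tendsto_const) (use Kpos in simp_all)
  then have lim: "(\<lambda>n. S n * (LBINT t:{0..1}. D.err n t) / K) \<longlonglongrightarrow> 1" using Kpos by simp
  have "(\<lambda>n. I n / (K / S n)) \<longlonglongrightarrow> 1"
  proof (rule Lim_transform_eventually[OF lim])
    show "\<forall>\<^sub>F n in sequentially. S n * (LBINT t:{0..1}. D.err n t) / K = I n / (K / S n)"
      using D.eventually_large
    proof eventually_elim
      case (elim n)
      have "I n = (LBINT t:{0..1}. D.err n t)"
        unfolding I_def by (rule set_lebesgue_integral_cong) (auto simp: D.approx_error_eq[OF elim])
      then show ?case by simp
    qed
  qed
  then have "I \<sim>[at_top] (\<lambda>n. K / S n)" by (rule asymp_equivI')
  moreover have "set_integrable lborel {0..} (\<lambda>u. p u powr (- \<alpha> 0) * exp (- b * u powr \<gamma>))"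
    using D.profile_integrable unfolding profile .
  moreover note asymp_equiv_rate[OF Ng, of K "\<alpha> 0" "(\<alpha> 0 + 1) / \<gamma>"]
  ultimately show ?thesis using Ng unfolding I_def S_def by blast
qed

end
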